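(* There is a functor $$\mathsf{Hom}:\mathrm{Alg}^*\times_{P,L}\mathrm{BAlg}\longrightarrow\mathrm{Alg}$$ that sends each object $(\mathscr{T},\mathscr{U},A,D)$ to $(\mathscr{U},\mathrm{Hom}_{\mathscr{T}}(A,D))$ and sends each morphism $$(M,f,g):(\mathscr{T}_1,\mathscr{U}_1,A_1,D_1)\to(\mathscr{T}_2,\mathscr{U}_2,A_2,D_2)$$ to the morphism $$(M_r,\psi^{(M,f,g)}):(\mathscr{U}_1,\mathrm{Hom}_{\mathscr{T}_1}(A_1,D_1))\to(\mathscr{U}_2,\mathrm{Hom}_{\mathscr{T}_2}(A_2,D_2))$$ in $\mathrm{Alg}$, where $\psi^{(M,f,g)}:M_r^*\mathrm{Hom}_{\mathscr{T}_1}(A_1,D_1)\to\mathrm{Hom}_{\mathscr{T}_2}(A_2,D_2)$ is defined as the composite $$M_r^*\mathrm{Hom}_{\mathscr{T}_1}(A_1,D_1)\xrightarrow{(\mathsf{hom}_M)_{A_1D_1}}\mathrm{Hom}_{\mathscr{T}_2}(M_\ell^*A_1,M^*D_1)\xrightarrow{\mathrm{Hom}_{\mathscr{T}_2}(f,g)}\mathrm{Hom}_{\mathscr{T}_2}(A_2,D_2)$$ in the category of $\mathscr{U}_2$-algebras.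
   Context: Setting. $\mathscr{V}=(\mathscr{V},\otimes,I)$ is a symmetric monoidal closed category whose underlying ordinary category has finite limits; $\mathscr{V}$-categories may be large. $\mathscr{J}\hookrightarrow\mathscr{V}$ is a system of arities, i.e. a full sub-$\mathscr{V}$-category closed under $\otimes$ and containing $I$. $\mathscr{J}$-powers in a $\mathscr{V}$-category are powers (cotensors) by objects $J\in\mathscr{J}$. A $\mathscr{J}$-theory is a $\mathscr{V}$-category $\mathscr{T}$ with $\mathrm{ob}\,\mathscr{T}=\mathrm{ob}\,\mathscr{J}$, equipped with an identity-on-objects $\mathscr{V}$-functor $\mathscr{J}^{\mathrm{op}}\to\mathscr{T}$ that preserves $\mathscr{J}$-powers; morphisms of $\mathscr{J}$-theories are $\mathscr{V}$-functors commuting with these structure functors, giving a category $\mathrm{Th}_{\mathscr{J}}$. A $\mathscr{T}$-algebra is a $\mathscr{V}$-functor $\mathscr{T}\to\mathscr{V}$ that preserves $\mathscr{J}$-powers; $\mathscr{T}\text{-}\mathrm{Alg}$ is the full subcategory of $[\mathscr{T},\mathscr{V}]$ on these, and $G^{\mathscr{T}}:\mathscr{T}\text{-}\mathrm{Alg}\to\mathscr{V}$ is evaluation at $I$. Throughout, $\mathscr{J}$ is amenable: for every $\mathscr{J}$-theory $\mathscr{T}$, $\mathscr{T}\text{-}\mathrm{Alg}$ exists as a $\mathscr{V}$-category and $G^{\mathscr{T}}$ has a left adjoint. For a morphism of $\mathscr{J}$-theories $M:\mathscr{T}\to\mathscr{U}$, $M^*:\mathscr{U}\text{-}\mathrm{Alg}\to\mathscr{T}\text{-}\mathrm{Alg}$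 is $M^*A=AM$. Bifold algebras. A $(\mathscr{T},\mathscr{U})$-algebra is a $\mathscr{V}$-functor $D:\mathscr{T}\otimes\mathscr{U}\to\mathscr{V}$ that preserves $\mathscr{J}$-powers in each variable separately; $(\mathscr{T},\mathscr{U})\text{-}\mathrm{Alg}$ is the $\mathscr{V}$-category of these (full in $[\mathscr{T}\otimes\mathscr{U},\mathscr{V}]$). A bifold algebra is a triple $(\mathscr{T},\mathscr{U},D)$. For morphisms of $\mathscr{J}$-theories $M_\ell:\mathscr{T}_2\to\mathscr{T}_1$, $M_r:\mathscr{U}_2\to\mathscr{U}_1$, written $M=(M_\ell,M_r)$, $M^*:(\mathscr{T}_1,\mathscr{U}_1)\text{-}\mathrm{Alg}\to(\mathscr{T}_2,\mathscr{U}_2)\text{-}\mathrm{Alg}$ is $M^*D=D(M_\ell-,M_r?)$. The $\mathscr{V}$-functor $\mathrm{Hom}_{\mathscr{T}}:\mathscr{T}\text{-}\mathrm{Alg}^{\mathrm{op}}\otimes(\mathscr{T},\mathscr{U})\text{-}\mathrm{Alg}\to\mathscr{U}\text{-}\mathrm{Alg}$ is given by $(\mathrm{Hom}_{\mathscr{T}}(A,D))K=\mathscr{T}\text{-}\mathrm{Alg}(A,D(-,K))$. Categories involved. $\mathrm{Alg}$ has as objects pairs $(\mathscr{T},A)$ with $\mathscr{T}$ a $\mathscr{J}$-theory and $A$ a $\mathscr{T}$-algebra; a morphism $(M,f):(\mathscr{T}_1,A_1)\to(\mathscr{T}_2,A_2)$ is a morphism of $\mathscr{J}$-theories $M:\mathscr{T}_2\to\mathscr{T}_1$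 with a morphism $f:M^*A_1\to A_2$ of $\mathscr{T}_2$-algebras; composition is $(N,h)\cdot(M,f)=(MN,h\cdot N^*f)$. $\mathrm{Alg}^*$ has the same objects, but a morphism $(M,f)$ has $M:\mathscr{T}_2\to\mathscr{T}_1$ and $f:A_2\to M^*A_1$, with $(N,h)\cdot(M,f)=(MN,N^*f\cdot h)$. $\mathrm{BAlg}$ has bifold algebras as objects; a morphism $(M,g):(\mathscr{T}_1,\mathscr{U}_1,D_1)\to(\mathscr{T}_2,\mathscr{U}_2,D_2)$ consists of $M=(M_\ell:\mathscr{T}_2\to\mathscr{T}_1,\ M_r:\mathscr{U}_2\to\mathscr{U}_1)$ and a morphism $g:M^*D_1\to D_2$ of $(\mathscr{T}_2,\mathscr{U}_2)$-algebras, with $(N,h)\cdot(M,g)=(MN,h\cdot N^*g)$. $P:\mathrm{Alg}^*\to\mathrm{Th}_{\mathscr{J}}^{\mathrm{op}}$ sends $(\mathscr{T},A)$ to $\mathscr{T}$, $L:\mathrm{BAlg}\to\mathrm{Th}_{\mathscr{J}}^{\mathrm{op}}$ sends $(\mathscr{T},\mathscr{U},D)$ to $\mathscr{T}$, and $\mathrm{Alg}^*\times_{P,L}\mathrm{BAlg}$ is their (strict) pullback. So its objects are written $(\mathscr{T},\mathscr{U},A,D)$ with $A$ a $\mathscr{T}$-algebra and $D$ a $(\mathscr{T},\mathscr{U})$-algebra, and its morphisms $(M,f,g):(\mathscr{T}_1,\mathscr{U}_1,A_1,D_1)\to(\mathscr{T}_2,\mathscr{U}_2,A_2,D_2)$ consist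 of a pair $M=(M_\ell,M_r)$ of morphisms of $\mathscr{J}$-theories $M_\ell:\mathscr{T}_2\to\mathscr{T}_1$ and $M_r:\mathscr{U}_2\to\mathscr{U}_1$, $f:A_2\to M_\ell^*A_1$ in $\mathscr{T}_2\text{-}\mathrm{Alg}$ and $g:M^*D_1\to D_2$ in $(\mathscr{T}_2,\mathscr{U}_2)\text{-}\mathrm{Alg}$. The transformation $\mathsf{hom}_M$. $(\mathsf{hom}_M)_{AD}:M_r^*\mathrm{Hom}_{\mathscr{T}_1}(A,D)\to\mathrm{Hom}_{\mathscr{T}_2}(M_\ell^*A,M^*D)$ (for $A\in\mathscr{T}_1\text{-}\mathrm{Alg}$, $D\in(\mathscr{T}_1,\mathscr{U}_1)\text{-}\mathrm{Alg}$) is the $\mathscr{U}_2$-homomorphism whose component at $K\in\mathrm{ob}\,\mathscr{U}_2$ is the action of the $\mathscr{V}$-functor $M_\ell^*$ on homs, $\mathscr{T}_1\text{-}\mathrm{Alg}(A,D(-,M_rK))\to\mathscr{T}_2\text{-}\mathrm{Alg}(AM_\ell,D(M_\ell-,M_rK))$. *)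

theory Defs
  imports Main "HOL-Library.FuncSet"
begin

section \<open>Ordinary categories\<close>

text \<open>Categories are given by hom-sets.  Composition \<open>g \<cdot> f\<close> is a single operation on
  the type of arrows, constrained only on composable pairs; the hom-sets need not be disjoint, so
  an arrow need not determine its domain and codomain.  For this reason the arrow part of a functor
  also takes the domain and the codomain as arguments.\<close>

record ('o, 'a) cat =
  Ob    :: "'o set"
  Hom   :: "'o \<Rightarrow> 'o \<Rightarrow> 'a set"
  ident :: "'o \<Rightarrow> 'a"  ("\<iota>\<index>")
  cmp   :: "'a \<Rightarrow> 'a \<Rightarrow> 'a"  (infixl "\<cdot>\<index>" 70)

locale category =
  fixes C :: "('o, 'a, 'z) cat_scheme" (structure)
  assumes ident_in: "X \<in> Ob C \<Longrightarrow> \<iota> X \<in> Hom C X X"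
    and cmp_in: "\<lbrakk>X \<in> Ob C; Y \<in> Ob C; Z \<in> Ob C; f \<in> Hom C X Y; g \<in> Hom C Y Z\<rbrakk>
      \<Longrightarrow> g \<cdot> f \<in> Hom C X Z"
    and ident_left: "\<lbrakk>X \<in> Ob C; Y \<in> Ob C; f \<in> Hom C X Y\<rbrakk> \<Longrightarrow> \<iota> Y \<cdot> f = f"
    and ident_right: "\<lbrakk>X \<in> Ob C; Y \<in> Ob C; f \<in> Hom C X Y\<rbrakk> \<Longrightarrow> f \<cdot> \<iota> X = f"
    and cmp_assoc: "\<lbrakk>W \<in> Ob C; X \<in> Ob C; Y \<in> Ob C; Z \<in> Ob C;
        f \<in> Hom C W X; g \<in> Hom C X Y; h \<in> Hom C Y Z\<rbrakk>
      \<Longrightarrow> (h \<cdot> g) \<cdot> f = h \<cdot> (g \<cdot> f)"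

record ('o, 'a, 'p, 'b) fctr =
  onOb :: "'o \<Rightarrow> 'p"
  onAr :: "'o \<Rightarrow> 'o \<Rightarrow> 'a \<Rightarrow> 'b"

locale cat_functor = dom: category C + cod: category D
  for C :: "('o, 'a, 'y) cat_scheme" and D :: "('p, 'b, 'z) cat_scheme" +
  fixes F :: "('o, 'a, 'p, 'b) fctr"
  assumes onOb_in: "X \<in> Ob C \<Longrightarrow> onOb F X \<in> Ob D"
    and onAr_in: "\<lbrakk>X \<in> Ob C; Y \<in> Ob C; f \<in> Hom C X Y\<rbrakk>
      \<Longrightarrow> onAr F X Y f \<in> Hom D (onOb F X) (onOb F Y)"
    and onAr_ident: "X \<in> Ob C \<Longrightarrow> onAr F X X (ident C X) = ident D (onOb F X)"
    and onAr_cmp: "\<lbrakk>X \<in> Ob C; Y \<in> Ob C; Z \<in> Ob C; f \<in> Hom C X Y; g \<in> Hom C Y Z\<rbrakk>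
      \<Longrightarrow> onAr F X Z (cmp C g f) = cmp D (onAr F Y Z g) (onAr F X Y f)"

definition pullback_cat ::
  "('o, 'a) cat \<Rightarrow> ('p, 'b) cat \<Rightarrow> ('o, 'a, 'q, 'c) fctr \<Rightarrow> ('p, 'b, 'q, 'c) fctr
    \<Rightarrow> ('o \<times> 'p, 'a \<times> 'b) cat" where
  "pullback_cat C D P L =
    \<lparr>Ob = {(X, Y). X \<in> Ob C \<and> Y \<in> Ob D \<and> onOb P X = onOb L Y},
     Hom = (\<lambda>(X, Y) (X', Y'). {(f, g). f \<in> Hom C X X' \<and> g \<in> Hom D Y Y' \<and>
       onAr P X X' f = onAr L Y Y' g}),
     ident = (\<lambda>(X, Y). (ident C X, ident D Y)),
     cmp = (\<lambda>(f', g') (f, g). (cmp C f' f, cmp D g' g))\<rparr>"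

definition finite_cat :: "('o, 'a) cat \<Rightarrow> bool" where
  "finite_cat S \<longleftrightarrow> category S \<and> finite (Ob S) \<and> (\<forall>i\<in>Ob S. \<forall>j\<in>Ob S. finite (Hom S i j))"

definition is_cone :: "('i, 'k) cat \<Rightarrow> ('o, 'a, 'z) cat_scheme \<Rightarrow> ('i, 'k, 'o, 'a) fctr
    \<Rightarrow> 'o \<Rightarrow> ('i \<Rightarrow> 'a) \<Rightarrow> bool" where
  "is_cone S C D W p \<longleftrightarrow> W \<in> Ob C \<and> (\<forall>i\<in>Ob S. p i \<in> Hom C W (onOb D i)) \<and>
    (\<forall>i\<in>Ob S. \<forall>j\<in>Ob S. \<forall>u\<in>Hom S i j. cmp C (onAr D i j u) (p i) = p j)"

definition is_limit_cone :: "('i, 'k) cat \<Rightarrow> ('o, 'a, 'z) cat_scheme \<Rightarrow> ('i, 'k, 'o, 'a) fctr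
    \<Rightarrow> 'o \<Rightarrow> ('i \<Rightarrow> 'a) \<Rightarrow> bool" where
  "is_limit_cone S C D W p \<longleftrightarrow> is_cone S C D W p \<and>
    (\<forall>W' p'. is_cone S C D W' p' \<longrightarrow>
      (\<exists>!h. h \<in> Hom C W' W \<and> (\<forall>i\<in>Ob S. cmp C (p i) h = p' i)))"

text \<open>Every finite category is isomorphic to one whose objects and arrows are natural numbers.\<close>

definition has_finite_limits :: "('o, 'a, 'z) cat_scheme \<Rightarrow> bool" where
  "has_finite_limits C \<longleftrightarrow>
    (\<forall>(S :: (nat, nat) cat) (D :: (nat, nat, 'o, 'a) fctr).
      finite_cat S \<and> cat_functor S C D \<longrightarrow> (\<exists>W p. is_limit_cone S C D W p))"

definition is_inverse :: "('o, 'a, 'z) cat_scheme \<Rightarrow> 'o \<Rightarrow> 'o \<Rightarrow> 'a \<Rightarrow> 'a \<Rightarrow> bool" where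
  "is_inverse C X Y f g \<longleftrightarrow> f \<in> Hom C X Y \<and> g \<in> Hom C Y X \<and>
    cmp C g f = ident C X \<and> cmp C f g = ident C Y"

definition is_iso :: "('o, 'a, 'z) cat_scheme \<Rightarrow> 'o \<Rightarrow> 'o \<Rightarrow> 'a \<Rightarrow> bool" where
  "is_iso C X Y f \<longleftrightarrow> (\<exists>g. is_inverse C X Y f g)"

definition inv_ar :: "('o, 'a, 'z) cat_scheme \<Rightarrow> 'o \<Rightarrow> 'o \<Rightarrow> 'a \<Rightarrow> 'a" where
  "inv_ar C X Y f = (THE g. is_inverse C X Y f g)"


section \<open>Symmetric monoidal closed categories\<close>

text \<open>\<open>\<otimes>\<close> is the tensor product of objects, \<open>\<boxtimes>\<close> that of arrows;
  \<open>assoc X Y Z : (X \<otimes> Y) \<otimes> Z \<rightarrow> X \<otimes> (Y \<otimes> Z)\<close>, \<open>lun X : \<one> \<otimes> X \<rightarrow> X\<close>, \<open>run X : X \<otimes> \<one> \<rightarrow> X\<close>,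
  \<open>swp X Y : X \<otimes> Y \<rightarrow> Y \<otimes> X\<close> and \<open>evl X Y : (X \<Rrightarrow> Y) \<otimes> X \<rightarrow> Y\<close>, where \<open>X \<Rrightarrow> Y\<close> is the
  internal hom.\<close>

record ('o, 'a) smc = "('o, 'a) cat" +
  tens  :: "'o \<Rightarrow> 'o \<Rightarrow> 'o"  (infixr "\<otimes>\<index>" 80)
  tensA :: "'a \<Rightarrow> 'a \<Rightarrow> 'a"  (infixr "\<boxtimes>\<index>" 80)
  unt   :: "'o"  ("\<one>\<index>")
  assoc :: "'o \<Rightarrow> 'o \<Rightarrow> 'o \<Rightarrow> 'a"
  lun   :: "'o \<Rightarrow> 'a"
  run   :: "'o \<Rightarrow> 'a"
  swp   :: "'o \<Rightarrow> 'o \<Rightarrow> 'a"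
  ihom  :: "'o \<Rightarrow> 'o \<Rightarrow> 'o"  (infixr "\<Rrightarrow>\<index>" 75)
  evl   :: "'o \<Rightarrow> 'o \<Rightarrow> 'a"

locale symmetric_monoidal_closed = category V
  for V :: "('o, 'm) smc" (structure) +
  assumes unt_in: "\<one> \<in> Ob V"
    and tens_in: "\<lbrakk>X \<in> Ob V; Y \<in> Ob V\<rbrakk> \<Longrightarrow> X \<otimes> Y \<in> Ob V"
    and tensA_in: "\<lbrakk>X \<in> Ob V; Y \<in> Ob V; X' \<in> Ob V; Y' \<in> Ob V; f \<in> Hom V X X'; g \<in> Hom V Y Y'\<rbrakk>
      \<Longrightarrow> f \<boxtimes> g \<in> Hom V (X \<otimes> Y) (X' \<otimes> Y')"
    and tensA_ident: "\<lbrakk>X \<in> Ob V; Y \<in> Ob V\<rbrakk> \<Longrightarrow> \<iota> X \<boxtimes> \<iota> Y = \<iota> (X \<otimes> Y)"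
    and tensA_cmp: "\<lbrakk>X \<in> Ob V; X' \<in> Ob V; X'' \<in> Ob V; Y \<in> Ob V; Y' \<in> Ob V; Y'' \<in> Ob V;
        f \<in> Hom V X X'; f' \<in> Hom V X' X''; g \<in> Hom V Y Y'; g' \<in> Hom V Y' Y''\<rbrakk>
      \<Longrightarrow> (f' \<cdot> f) \<boxtimes> (g' \<cdot> g) = (f' \<boxtimes> g') \<cdot> (f \<boxtimes> g)"
    and assoc_iso: "\<lbrakk>X \<in> Ob V; Y \<in> Ob V; Z \<in> Ob V\<rbrakk>
      \<Longrightarrow> is_iso V ((X \<otimes> Y) \<otimes> Z) (X \<otimes> (Y \<otimes> Z)) (assoc V X Y Z)"
    and assoc_natural: "\<lbrakk>X \<in> Ob V; Y \<in> Ob V; Z \<in> Ob V; X' \<in> Ob V; Y' \<in> Ob V; Z' \<in> Ob V;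
        f \<in> Hom V X X'; g \<in> Hom V Y Y'; h \<in> Hom V Z Z'\<rbrakk>
      \<Longrightarrow> assoc V X' Y' Z' \<cdot> ((f \<boxtimes> g) \<boxtimes> h) = (f \<boxtimes> (g \<boxtimes> h)) \<cdot> assoc V X Y Z"
    and lun_iso: "X \<in> Ob V \<Longrightarrow> is_iso V (\<one> \<otimes> X) X (lun V X)"
    and lun_natural: "\<lbrakk>X \<in> Ob V; X' \<in> Ob V; f \<in> Hom V X X'\<rbrakk>
      \<Longrightarrow> lun V X' \<cdot> (\<iota> \<one> \<boxtimes> f) = f \<cdot> lun V X"
    and run_iso: "X \<in> Ob V \<Longrightarrow> is_iso V (X \<otimes> \<one>) X (run V X)"
    and run_natural: "\<lbrakk>X \<in> Ob V; X' \<in> Ob V; f \<in> Hom V X X'\<rbrakk>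
      \<Longrightarrow> run V X' \<cdot> (f \<boxtimes> \<iota> \<one>) = f \<cdot> run V X"
    and pentagon: "\<lbrakk>W \<in> Ob V; X \<in> Ob V; Y \<in> Ob V; Z \<in> Ob V\<rbrakk>
      \<Longrightarrow> assoc V W X (Y \<otimes> Z) \<cdot> assoc V (W \<otimes> X) Y Z
        = (\<iota> W \<boxtimes> assoc V X Y Z) \<cdot> (assoc V W (X \<otimes> Y) Z \<cdot> (assoc V W X Y \<boxtimes> \<iota> Z))"
    and triangle: "\<lbrakk>X \<in> Ob V; Y \<in> Ob V\<rbrakk>
      \<Longrightarrow> (\<iota> X \<boxtimes> lun V Y) \<cdot> assoc V X \<one> Y = run V X \<boxtimes> \<iota> Y"
    and swp_in: "\<lbrakk>X \<in> Ob V; Y \<in> Ob V\<rbrakk> \<Longrightarrow> swp V X Y \<in> Hom V (X \<otimes> Y) (Y \<otimes> X)"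
    and swp_natural: "\<lbrakk>X \<in> Ob V; Y \<in> Ob V; X' \<in> Ob V; Y' \<in> Ob V; f \<in> Hom V X X'; g \<in> Hom V Y Y'\<rbrakk>
      \<Longrightarrow> swp V X' Y' \<cdot> (f \<boxtimes> g) = (g \<boxtimes> f) \<cdot> swp V X Y"
    and swp_swp: "\<lbrakk>X \<in> Ob V; Y \<in> Ob V\<rbrakk> \<Longrightarrow> swp V Y X \<cdot> swp V X Y = \<iota> (X \<otimes> Y)"
    and hexagon: "\<lbrakk>X \<in> Ob V; Y \<in> Ob V; Z \<in> Ob V\<rbrakk>
      \<Longrightarrow> assoc V Y Z X \<cdot> (swp V X (Y \<otimes> Z) \<cdot> assoc V X Y Z)
        = (\<iota> Y \<boxtimes> swp V X Z) \<cdot> (assoc V Y X Z \<cdot> (swp V X Y \<boxtimes> \<iota> Z))"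
    and ihom_in: "\<lbrakk>X \<in> Ob V; Y \<in> Ob V\<rbrakk> \<Longrightarrow> X \<Rrightarrow> Y \<in> Ob V"
    and evl_in: "\<lbrakk>X \<in> Ob V; Y \<in> Ob V\<rbrakk> \<Longrightarrow> evl V X Y \<in> Hom V ((X \<Rrightarrow> Y) \<otimes> X) Y"
    and evl_universal: "\<lbrakk>W \<in> Ob V; X \<in> Ob V; Y \<in> Ob V; f \<in> Hom V (W \<otimes> X) Y\<rbrakk>
      \<Longrightarrow> \<exists>!h. h \<in> Hom V W (X \<Rrightarrow> Y) \<and> evl V X Y \<cdot> (h \<boxtimes> \<iota> X) = f"


section \<open>Enriched categories\<close>

text \<open>\<open>vcmp C X Y Z : C(Y,Z) \<otimes> C(X,Y) \<rightarrow> C(X,Z)\<close> and \<open>vid C X : \<one> \<rightarrow> C(X,X)\<close>.\<close>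

record ('a, 'o, 'm) vcat =
  vob  :: "'a set"
  vhom :: "'a \<Rightarrow> 'a \<Rightarrow> 'o"
  vcmp :: "'a \<Rightarrow> 'a \<Rightarrow> 'a \<Rightarrow> 'm"
  vid  :: "'a \<Rightarrow> 'm"

text \<open>\<open>fhom F X Y : C(X,Y) \<rightarrow> D(F X, F Y)\<close>.\<close>

record ('a, 'b, 'm) vfun =
  fob  :: "'a \<Rightarrow> 'b"
  fhom :: "'a \<Rightarrow> 'a \<Rightarrow> 'm"

context symmetric_monoidal_closed
begin

definition curry_ar :: "'o \<Rightarrow> 'o \<Rightarrow> 'o \<Rightarrow> 'm \<Rightarrow> 'm" where
  "curry_ar W X Y f = (THE h. h \<in> Hom V W (X \<Rrightarrow> Y) \<and> evl V X Y \<cdot> (h \<boxtimes> \<iota> X) = f)"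

definition assoc_inv :: "'o \<Rightarrow> 'o \<Rightarrow> 'o \<Rightarrow> 'm" where
  "assoc_inv X Y Z = inv_ar V ((X \<otimes> Y) \<otimes> Z) (X \<otimes> (Y \<otimes> Z)) (assoc V X Y Z)"

definition lun_inv :: "'o \<Rightarrow> 'm" where
  "lun_inv X = inv_ar V (\<one> \<otimes> X) X (lun V X)"

definition run_inv :: "'o \<Rightarrow> 'm" where
  "run_inv X = inv_ar V (X \<otimes> \<one>) X (run V X)"

text \<open>The canonical isomorphism \<open>(W \<otimes> X) \<otimes> (Y \<otimes> Z) \<rightarrow> (W \<otimes> Y) \<otimes> (X \<otimes> Z)\<close>.\<close>

definition mid4 :: "'o \<Rightarrow> 'o \<Rightarrow> 'o \<Rightarrow> 'o \<Rightarrow> 'm" where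
  "mid4 W X Y Z =
     assoc_inv W Y (X \<otimes> Z)
     \<cdot> (\<iota> W \<boxtimes> (assoc V Y X Z \<cdot> (swp V X Y \<boxtimes> \<iota> Z) \<cdot> assoc_inv X Y Z))
     \<cdot> assoc V W X (Y \<otimes> Z)"

text \<open>The arrow \<open>\<one> \<rightarrow> X \<Rrightarrow> Y\<close> corresponding to \<open>f : X \<rightarrow> Y\<close>.\<close>

definition elt :: "'o \<Rightarrow> 'o \<Rightarrow> 'm \<Rightarrow> 'm" where
  "elt X Y f = curry_ar \<one> X Y (f \<cdot> lun V X)"

definition vcategory :: "('a, 'o, 'm) vcat \<Rightarrow> bool" where
  "vcategory C \<longleftrightarrow>
    (\<forall>X\<in>vob C. \<forall>Y\<in>vob C. vhom C X Y \<in> Ob V) \<and>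
    (\<forall>X\<in>vob C. \<forall>Y\<in>vob C. \<forall>Z\<in>vob C.
      vcmp C X Y Z \<in> Hom V (vhom C Y Z \<otimes> vhom C X Y) (vhom C X Z)) \<and>
    (\<forall>X\<in>vob C. vid C X \<in> Hom V \<one> (vhom C X X)) \<and>
    (\<forall>W\<in>vob C. \<forall>X\<in>vob C. \<forall>Y\<in>vob C. \<forall>Z\<in>vob C.
      vcmp C W X Z \<cdot> (vcmp C X Y Z \<boxtimes> \<iota> (vhom C W X))
      = vcmp C W Y Z \<cdot> (\<iota> (vhom C Y Z) \<boxtimes> vcmp C W X Y)
        \<cdot> assoc V (vhom C Y Z) (vhom C X Y) (vhom C W X)) \<and>
    (\<forall>X\<in>vob C. \<forall>Y\<in>vob C.
      vcmp C X Y Y \<cdot> (vid C Y \<boxtimes> \<iota> (vhom C X Y)) = lun V (vhom C X Y)) \<and>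
    (\<forall>X\<in>vob C. \<forall>Y\<in>vob C.
      vcmp C X X Y \<cdot> (\<iota> (vhom C X Y) \<boxtimes> vid C X) = run V (vhom C X Y))"

definition vop :: "('a, 'o, 'm) vcat \<Rightarrow> ('a, 'o, 'm) vcat" where
  "vop C = \<lparr>vob = vob C, vhom = (\<lambda>X Y. vhom C Y X),
    vcmp = (\<lambda>X Y Z. vcmp C Z Y X \<cdot> swp V (vhom C Z Y) (vhom C Y X)),
    vid = vid C\<rparr>"

definition vtensor :: "('a, 'o, 'm) vcat \<Rightarrow> ('b, 'o, 'm) vcat \<Rightarrow> ('a \<times> 'b, 'o, 'm) vcat" where
  "vtensor C D = \<lparr>vob = vob C \<times> vob D,
    vhom = (\<lambda>(X, Y) (X', Y'). vhom C X X' \<otimes> vhom D Y Y'),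
    vcmp = (\<lambda>(X, Y) (X', Y') (X'', Y'').
      (vcmp C X X' X'' \<boxtimes> vcmp D Y Y' Y'')
      \<cdot> mid4 (vhom C X' X'') (vhom D Y' Y'') (vhom C X X') (vhom D Y Y')),
    vid = (\<lambda>(X, Y). (vid C X \<boxtimes> vid D Y) \<cdot> lun_inv \<one>)\<rparr>"

text \<open>The self-enrichment of \<open>V\<close>, restricted to a set of objects.\<close>

definition vself_on :: "'o set \<Rightarrow> ('o, 'o, 'm) vcat" where
  "vself_on S = \<lparr>vob = S, vhom = (\<lambda>X Y. X \<Rrightarrow> Y),
    vcmp = (\<lambda>X Y Z. curry_ar ((Y \<Rrightarrow> Z) \<otimes> (X \<Rrightarrow> Y)) X Z
      (evl V Y Z \<cdot> (\<iota> (Y \<Rrightarrow> Z) \<boxtimes> evl V X Y) \<cdot> assoc V (Y \<Rrightarrow> Z) (X \<Rrightarrow> Y) X)),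
    vid = (\<lambda>X. elt X X (\<iota> X))\<rparr>"

abbreviation VV :: "('o, 'o, 'm) vcat" where
  "VV \<equiv> vself_on (Ob V)"

text \<open>Structure maps are required to be \<open>undefined\<close> outside the domain, so that equality of
  enriched functors (and below of transformations and theories) is equality of records.\<close>

definition vfunctor :: "('a, 'o, 'm) vcat \<Rightarrow> ('b, 'o, 'm) vcat \<Rightarrow> ('a, 'b, 'm) vfun \<Rightarrow> bool" where
  "vfunctor C D F \<longleftrightarrow> vcategory C \<and> vcategory D \<and>
    fob F \<in> vob C \<rightarrow>\<^sub>E vob D \<and>
    case_prod (fhom F) \<in> extensional (vob C \<times> vob C) \<and>
    (\<forall>X\<in>vob C. \<forall>Y\<in>vob C. fhom F X Y \<in> Hom V (vhom C X Y) (vhom D (fob F X) (fob F Y))) \<and>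
    (\<forall>X\<in>vob C. fhom F X X \<cdot> vid C X = vid D (fob F X)) \<and>
    (\<forall>X\<in>vob C. \<forall>Y\<in>vob C. \<forall>Z\<in>vob C.
      fhom F X Z \<cdot> vcmp C X Y Z
      = vcmp D (fob F X) (fob F Y) (fob F Z) \<cdot> (fhom F Y Z \<boxtimes> fhom F X Y))"

definition mk_vfun :: "'a set \<Rightarrow> ('a \<Rightarrow> 'b) \<Rightarrow> ('a \<Rightarrow> 'a \<Rightarrow> 'm) \<Rightarrow> ('a, 'b, 'm) vfun" where
  "mk_vfun S f h = \<lparr>fob = restrict f S,
    fhom = (\<lambda>X Y. if X \<in> S \<and> Y \<in> S then h X Y else undefined)\<rparr>"

definition vfun_id :: "('a, 'o, 'm) vcat \<Rightarrow> ('a, 'a, 'm) vfun" where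
  "vfun_id C = mk_vfun (vob C) (\<lambda>X. X) (\<lambda>X Y. \<iota> (vhom C X Y))"

text \<open>\<open>vfun_cmp S G F\<close> is the composite \<open>G F\<close>, where \<open>S\<close> is the set of objects of the domain
  of \<open>F\<close>.\<close>

definition vfun_cmp :: "'a set \<Rightarrow> ('b, 'c, 'm) vfun \<Rightarrow> ('a, 'b, 'm) vfun \<Rightarrow> ('a, 'c, 'm) vfun" where
  "vfun_cmp S G F = mk_vfun S (\<lambda>X. fob G (fob F X))
    (\<lambda>X Y. fhom G (fob F X) (fob F Y) \<cdot> fhom F X Y)"

definition vfun_tensor :: "'a set \<Rightarrow> 'b set \<Rightarrow> ('a, 'c, 'm) vfun \<Rightarrow> ('b, 'd, 'm) vfun
    \<Rightarrow> ('a \<times> 'b, 'c \<times> 'd, 'm) vfun" where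
  "vfun_tensor S S' F G = mk_vfun (S \<times> S') (\<lambda>(X, Y). (fob F X, fob G Y))
    (\<lambda>(X, Y) (X', Y'). fhom F X X' \<boxtimes> fhom G Y Y')"

text \<open>The enriched functors \<open>F(-,Y)\<close> and \<open>F(X,-)\<close> obtained from an enriched functor \<open>F\<close> on
  \<open>vtensor C D\<close>.\<close>

definition fix_right :: "('a, 'o, 'm) vcat \<Rightarrow> ('b, 'o, 'm) vcat \<Rightarrow> ('a \<times> 'b, 'c, 'm) vfun \<Rightarrow> 'b
    \<Rightarrow> ('a, 'c, 'm) vfun" where
  "fix_right C D F Y = mk_vfun (vob C) (\<lambda>X. fob F (X, Y))
    (\<lambda>X X'. fhom F (X, Y) (X', Y) \<cdot> (\<iota> (vhom C X X') \<boxtimes> vid D Y) \<cdot> run_inv (vhom C X X'))"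

definition fix_left :: "('a, 'o, 'm) vcat \<Rightarrow> ('b, 'o, 'm) vcat \<Rightarrow> ('a \<times> 'b, 'c, 'm) vfun \<Rightarrow> 'a
    \<Rightarrow> ('b, 'c, 'm) vfun" where
  "fix_left C D F X = mk_vfun (vob D) (\<lambda>Y. fob F (X, Y))
    (\<lambda>Y Y'. fhom F (X, Y) (X, Y') \<cdot> (vid C X \<boxtimes> \<iota> (vhom D Y Y')) \<cdot> lun_inv (vhom D Y Y'))"

text \<open>\<open>\<V>\<close>-natural transformations \<open>F \<Rightarrow> G : C \<rightarrow> D\<close>, with components \<open>\<one> \<rightarrow> D(F X, G X)\<close>.\<close>

definition vnat :: "('a, 'o, 'm) vcat \<Rightarrow> ('b, 'o, 'm) vcat \<Rightarrow> ('a, 'b, 'm) vfun \<Rightarrow> ('a, 'b, 'm) vfun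
    \<Rightarrow> ('a \<Rightarrow> 'm) \<Rightarrow> bool" where
  "vnat C D F G t \<longleftrightarrow>
    (\<forall>X\<in>vob C. t X \<in> Hom V \<one> (vhom D (fob F X) (fob G X))) \<and>
    (\<forall>X\<in>vob C. \<forall>Y\<in>vob C.
      vcmp D (fob F X) (fob F Y) (fob G Y) \<cdot> (t Y \<boxtimes> fhom F X Y) \<cdot> lun_inv (vhom C X Y)
      = vcmp D (fob F X) (fob G X) (fob G Y) \<cdot> (fhom G X Y \<boxtimes> t X) \<cdot> run_inv (vhom C X Y))"

text \<open>For functors into \<open>V\<close> the components are taken to be arrows \<open>F X \<rightarrow> G X\<close> of \<open>V\<close>, via the
  identification of \<open>V\<close> with the underlying category of its self-enrichment.\<close>

definition vnat_V :: "('a, 'o, 'm) vcat \<Rightarrow> ('a, 'o, 'm) vfun \<Rightarrow> ('a, 'o, 'm) vfun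
    \<Rightarrow> ('a \<Rightarrow> 'm) set" where
  "vnat_V C F G = {t \<in> extensional (vob C).
    (\<forall>X\<in>vob C. t X \<in> Hom V (fob F X) (fob G X)) \<and>
    vnat C VV F G (\<lambda>X. elt (fob F X) (fob G X) (t X))}"

text \<open>Composition in the underlying category of \<open>C\<close>, whose arrows \<open>X \<rightarrow> Y\<close> are the arrows
  \<open>\<one> \<rightarrow> C(X,Y)\<close>.\<close>

definition elt_cmp :: "('a, 'o, 'm) vcat \<Rightarrow> 'a \<Rightarrow> 'a \<Rightarrow> 'a \<Rightarrow> 'm \<Rightarrow> 'm \<Rightarrow> 'm" where
  "elt_cmp C X Y Z g f = vcmp C X Y Z \<cdot> (g \<boxtimes> f) \<cdot> lun_inv \<one>"

text \<open>The arrow \<open>C(f,g) : C(X,Y) \<rightarrow> C(X',Y')\<close> for \<open>f : \<one> \<rightarrow> C(X',X)\<close> and \<open>g : \<one> \<rightarrow> C(Y,Y')\<close>.\<close>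

definition hom_map :: "('a, 'o, 'm) vcat \<Rightarrow> 'a \<Rightarrow> 'a \<Rightarrow> 'a \<Rightarrow> 'a \<Rightarrow> 'm \<Rightarrow> 'm \<Rightarrow> 'm" where
  "hom_map C X Y X' Y' f g =
    (vcmp C X' X Y' \<cdot> (\<iota> (vhom C X Y') \<boxtimes> f) \<cdot> run_inv (vhom C X Y'))
    \<cdot> (vcmp C X Y Y' \<cdot> (g \<boxtimes> \<iota> (vhom C X Y)) \<cdot> lun_inv (vhom C X Y))"

text \<open>The representable \<open>\<V>\<close>-functor \<open>C(X,-) : C \<rightarrow> V\<close>.\<close>

definition representable :: "('a, 'o, 'm) vcat \<Rightarrow> 'a \<Rightarrow> ('a, 'o, 'm) vfun" where
  "representable C X = mk_vfun (vob C) (\<lambda>Y. vhom C X Y)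
    (\<lambda>Y Y'. curry_ar (vhom C Y Y') (vhom C X Y) (vhom C X Y') (vcmp C X Y Y'))"

definition has_left_adjoint :: "('a, 'o, 'm) vcat \<Rightarrow> ('b, 'o, 'm) vcat \<Rightarrow> ('a, 'b, 'm) vfun \<Rightarrow> bool" where
  "has_left_adjoint C D G \<longleftrightarrow> (\<exists>F eta eps.
    vfunctor D C F \<and> vfunctor C D G \<and>
    vnat D D (vfun_id D) (vfun_cmp (vob D) G F) eta \<and>
    vnat C C (vfun_cmp (vob C) F G) (vfun_id C) eps \<and>
    (\<forall>A\<in>vob C. elt_cmp D (fob G A) (fob G (fob F (fob G A))) (fob G A)
      (fhom G (fob F (fob G A)) A \<cdot> eps A) (eta (fob G A)) = vid D (fob G A)) \<and>
    (\<forall>X\<in>vob D. elt_cmp C (fob F X) (fob F (fob G (fob F X))) (fob F X)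
      (eps (fob F X)) (fhom F X (fob G (fob F X)) \<cdot> eta X) = vid C (fob F X)))"


subsection \<open>Powers\<close>

text \<open>\<open>P\<close> with \<open>k : J \<rightarrow> C(P,X)\<close> is a power of \<open>X\<close> by \<open>J\<close> if the maps \<open>C(Y,P) \<rightarrow> J \<Rrightarrow> C(Y,X)\<close>
  induced by \<open>k\<close> and composition are invertible.\<close>

definition is_power :: "('a, 'o, 'm) vcat \<Rightarrow> 'o \<Rightarrow> 'a \<Rightarrow> 'a \<Rightarrow> 'm \<Rightarrow> bool" where
  "is_power C J X P k \<longleftrightarrow> P \<in> vob C \<and> k \<in> Hom V J (vhom C P X) \<and>
    (\<forall>Y\<in>vob C. is_iso V (vhom C Y P) (J \<Rrightarrow> vhom C Y X)
      (curry_ar (vhom C Y P) J (vhom C Y X)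
        (vcmp C Y P X \<cdot> (k \<boxtimes> \<iota> (vhom C Y P)) \<cdot> swp V (vhom C Y P) J)))"

definition preserves_powers :: "'o set \<Rightarrow> ('a, 'o, 'm) vcat \<Rightarrow> ('b, 'o, 'm) vcat
    \<Rightarrow> ('a, 'b, 'm) vfun \<Rightarrow> bool" where
  "preserves_powers S C D F \<longleftrightarrow> (\<forall>J\<in>S. \<forall>X\<in>vob C. \<forall>P k.
    is_power C J X P k \<longrightarrow> is_power D J (fob F X) (fob F P) (fhom F P X \<cdot> k))"


subsection \<open>Objects of transformations\<close>

text \<open>\<open>(E, p)\<close> is the end of \<open>VV(A -, B -)\<close> for \<open>A, B : C \<rightarrow> V\<close>, i.e. the hom-object
  \<open>[C, V](A, B)\<close>: \<open>p\<close> is a universal family of arrows \<open>E \<rightarrow> A X \<Rrightarrow> B X\<close> that is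
  \<open>\<V>\<close>-natural in \<open>X\<close>.  As \<open>V\<close> is closed, the universal property in the ordinary category \<open>V\<close> is
  the right one.\<close>

definition is_wedge :: "('a, 'o, 'm) vcat \<Rightarrow> ('a, 'o, 'm) vfun \<Rightarrow> ('a, 'o, 'm) vfun
    \<Rightarrow> 'o \<Rightarrow> ('a \<Rightarrow> 'm) \<Rightarrow> bool" where
  "is_wedge C A B E p \<longleftrightarrow> E \<in> Ob V \<and>
    (\<forall>X\<in>vob C. p X \<in> Hom V E (fob A X \<Rrightarrow> fob B X)) \<and>
    (\<forall>X\<in>vob C. \<forall>Y\<in>vob C.
      vcmp VV (fob A X) (fob B X) (fob B Y) \<cdot> (fhom B X Y \<boxtimes> p X)
      = vcmp VV (fob A X) (fob A Y) (fob B Y) \<cdot> (p Y \<boxtimes> fhom A X Y) \<cdot> swp V (vhom C X Y) E)"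

definition is_end :: "('a, 'o, 'm) vcat \<Rightarrow> ('a, 'o, 'm) vfun \<Rightarrow> ('a, 'o, 'm) vfun
    \<Rightarrow> 'o \<Rightarrow> ('a \<Rightarrow> 'm) \<Rightarrow> bool" where
  "is_end C A B E p \<longleftrightarrow> is_wedge C A B E p \<and>
    (\<forall>E' p'. is_wedge C A B E' p' \<longrightarrow>
      (\<exists>!h. h \<in> Hom V E' E \<and> (\<forall>X\<in>vob C. p X \<cdot> h = p' X)))"

definition chosen_end :: "('a, 'o, 'm) vcat \<Rightarrow> ('a, 'o, 'm) vfun \<Rightarrow> ('a, 'o, 'm) vfun
    \<Rightarrow> 'o \<times> ('a \<Rightarrow> 'm)" where
  "chosen_end C A B = (SOME e. is_end C A B (fst e) (snd e))"

abbreviation end_ob :: "('a, 'o, 'm) vcat \<Rightarrow> ('a, 'o, 'm) vfun \<Rightarrow> ('a, 'o, 'm) vfun \<Rightarrow> 'o" where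
  "end_ob C A B \<equiv> fst (chosen_end C A B)"

abbreviation end_proj :: "('a, 'o, 'm) vcat \<Rightarrow> ('a, 'o, 'm) vfun \<Rightarrow> ('a, 'o, 'm) vfun \<Rightarrow> 'a \<Rightarrow> 'm" where
  "end_proj C A B \<equiv> snd (chosen_end C A B)"

definition end_lift :: "('a, 'o, 'm) vcat \<Rightarrow> ('a, 'o, 'm) vfun \<Rightarrow> ('a, 'o, 'm) vfun
    \<Rightarrow> 'o \<Rightarrow> ('a \<Rightarrow> 'm) \<Rightarrow> 'm" where
  "end_lift C A B W w =
    (THE h. h \<in> Hom V W (end_ob C A B) \<and> (\<forall>X\<in>vob C. end_proj C A B X \<cdot> h = w X))"

text \<open>The full sub-\<open>\<V>\<close>-category of \<open>[C, V]\<close> on a set \<open>S\<close> of functors; it exists if the ends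
  defining its hom-objects exist.\<close>

definition vfun_cat_exists :: "('a, 'o, 'm) vcat \<Rightarrow> ('a, 'o, 'm) vfun set \<Rightarrow> bool" where
  "vfun_cat_exists C S \<longleftrightarrow> (\<forall>A\<in>S. \<forall>B\<in>S. \<exists>E p. is_end C A B E p)"

definition vfun_cat :: "('a, 'o, 'm) vcat \<Rightarrow> ('a, 'o, 'm) vfun set
    \<Rightarrow> (('a, 'o, 'm) vfun, 'o, 'm) vcat" where
  "vfun_cat C S = \<lparr>vob = S, vhom = (\<lambda>A B. end_ob C A B),
    vcmp = (\<lambda>A B D. end_lift C A D (end_ob C B D \<otimes> end_ob C A B)
      (\<lambda>X. vcmp VV (fob A X) (fob B X) (fob D X) \<cdot> (end_proj C B D X \<boxtimes> end_proj C A B X))),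
    vid = (\<lambda>A. end_lift C A A \<one> (\<lambda>X. vid VV (fob A X)))\<rparr>"

text \<open>The arrow \<open>\<one> \<rightarrow> [C, V](A, B)\<close> corresponding to \<open>t : A \<Rightarrow> B\<close>.\<close>

definition vnat_elt :: "('a, 'o, 'm) vcat \<Rightarrow> ('a, 'o, 'm) vfun \<Rightarrow> ('a, 'o, 'm) vfun
    \<Rightarrow> ('a \<Rightarrow> 'm) \<Rightarrow> 'm" where
  "vnat_elt C A B t = end_lift C A B \<one> (\<lambda>X. elt (fob A X) (fob B X) (t X))"

end


section \<open>Theories and algebras for a system of arities\<close>

record ('o, 'm) jtheory =
  tcat :: "('o, 'o, 'm) vcat"
  tstr :: "('o, 'o, 'm) vfun"

locale arity_system = symmetric_monoidal_closed V
  for V :: "('o, 'm) smc" (structure) +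
  fixes \<J> :: "'o set"
  assumes finite_limits: "has_finite_limits V"
    and arities_sub: "\<J> \<subseteq> Ob V"
    and arities_unt: "\<one> \<in> \<J>"
    and arities_tens: "\<lbrakk>J \<in> \<J>; K \<in> \<J>\<rbrakk> \<Longrightarrow> J \<otimes> K \<in> \<J>"
begin

definition is_theory :: "('o, 'm) jtheory \<Rightarrow> bool" where
  "is_theory T \<longleftrightarrow> vcategory (tcat T) \<and> vob (tcat T) = \<J> \<and>
    case_prod (vhom (tcat T)) \<in> extensional (\<J> \<times> \<J>) \<and>
    (\<lambda>(X, Y, Z). vcmp (tcat T) X Y Z) \<in> extensional (\<J> \<times> \<J> \<times> \<J>) \<and>
    vid (tcat T) \<in> extensional \<J> \<and>
    vfunctor (vop (vself_on \<J>)) (tcat T) (tstr T) \<and>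
    (\<forall>J\<in>\<J>. fob (tstr T) J = J) \<and>
    preserves_powers \<J> (vop (vself_on \<J>)) (tcat T) (tstr T)"

definition Th :: "(('o, 'm) jtheory, ('o, 'o, 'm) vfun) cat" where
  "Th = \<lparr>Ob = {T. is_theory T},
    Hom = (\<lambda>T U. {M. vfunctor (tcat T) (tcat U) M \<and> vfun_cmp \<J> M (tstr T) = tstr U}),
    ident = (\<lambda>T. vfun_id (tcat T)),
    cmp = vfun_cmp \<J>\<rparr>"

definition algs :: "('o, 'm) jtheory \<Rightarrow> ('o, 'o, 'm) vfun set" where
  "algs T = {A. vfunctor (tcat T) VV A \<and> preserves_powers \<J> (tcat T) VV A}"

text \<open>\<open>T\<close>-\<open>Alg\<close> as a \<open>\<V>\<close>-category, and its underlying ordinary category.\<close>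

definition AlgV :: "('o, 'm) jtheory \<Rightarrow> (('o, 'o, 'm) vfun, 'o, 'm) vcat" where
  "AlgV T = vfun_cat (tcat T) (algs T)"

definition Alg0 :: "('o, 'm) jtheory \<Rightarrow> (('o, 'o, 'm) vfun, 'o \<Rightarrow> 'm) cat" where
  "Alg0 T = \<lparr>Ob = algs T, Hom = vnat_V (tcat T),
    ident = (\<lambda>A. \<lambda>K\<in>\<J>. \<iota> (fob A K)),
    cmp = (\<lambda>h f. \<lambda>K\<in>\<J>. h K \<cdot> f K)\<rparr>"

text \<open>The \<open>\<V>\<close>-functor \<open>G\<^sup>T\<close>, evaluation at \<open>\<one>\<close>.\<close>

definition eval_unt :: "('o, 'm) jtheory \<Rightarrow> (('o, 'o, 'm) vfun, 'o, 'm) vfun" where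
  "eval_unt T = mk_vfun (algs T) (\<lambda>A. fob A \<one>) (\<lambda>A B. end_proj (tcat T) A B \<one>)"

definition is_amenable :: bool where
  "is_amenable \<longleftrightarrow> (\<forall>T. is_theory T \<longrightarrow>
    vfun_cat_exists (tcat T) (algs T) \<and> has_left_adjoint (AlgV T) VV (eval_unt T))"

text \<open>For \<open>M : T \<rightarrow> U\<close>, the functor \<open>M\<^sup>* : U\<close>-\<open>Alg \<rightarrow> T\<close>-\<open>Alg\<close>: on algebras, on
  homomorphisms, and as a \<open>\<V>\<close>-functor.\<close>

definition alg_pull :: "('o, 'o, 'm) vfun \<Rightarrow> ('o, 'o, 'm) vfun \<Rightarrow> ('o, 'o, 'm) vfun" where
  "alg_pull M A = vfun_cmp \<J> A M"

definition alg_pull_ar :: "('o, 'o, 'm) vfun \<Rightarrow> ('o \<Rightarrow> 'm) \<Rightarrow> ('o \<Rightarrow> 'm)" where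
  "alg_pull_ar M f = (\<lambda>K\<in>\<J>. f (fob M K))"

definition alg_pullV :: "('o, 'm) jtheory \<Rightarrow> ('o, 'm) jtheory \<Rightarrow> ('o, 'o, 'm) vfun
    \<Rightarrow> (('o, 'o, 'm) vfun, ('o, 'o, 'm) vfun, 'm) vfun" where
  "alg_pullV T U M = mk_vfun (algs U) (alg_pull M)
    (\<lambda>A B. end_lift (tcat T) (alg_pull M A) (alg_pull M B) (end_ob (tcat U) A B)
      (\<lambda>K. end_proj (tcat U) A B (fob M K)))"


subsection \<open>Bifold algebras\<close>

abbreviation at_right :: "('o, 'm) jtheory \<Rightarrow> ('o, 'm) jtheory \<Rightarrow> ('o \<times> 'o, 'o, 'm) vfun
    \<Rightarrow> 'o \<Rightarrow> ('o, 'o, 'm) vfun" where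
  "at_right T U D K \<equiv> fix_right (tcat T) (tcat U) D K"

abbreviation at_left :: "('o, 'm) jtheory \<Rightarrow> ('o, 'm) jtheory \<Rightarrow> ('o \<times> 'o, 'o, 'm) vfun
    \<Rightarrow> 'o \<Rightarrow> ('o, 'o, 'm) vfun" where
  "at_left T U D J \<equiv> fix_left (tcat T) (tcat U) D J"

definition balgs :: "('o, 'm) jtheory \<Rightarrow> ('o, 'm) jtheory \<Rightarrow> ('o \<times> 'o, 'o, 'm) vfun set" where
  "balgs T U = {D. vfunctor (vtensor (tcat T) (tcat U)) VV D \<and>
    (\<forall>K\<in>\<J>. preserves_powers \<J> (tcat T) VV (at_right T U D K)) \<and>
    (\<forall>J\<in>\<J>. preserves_powers \<J> (tcat U) VV (at_left T U D J))}"

definition balg_hom :: "('o, 'm) jtheory \<Rightarrow> ('o, 'm) jtheory \<Rightarrow> ('o \<times> 'o, 'o, 'm) vfun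
    \<Rightarrow> ('o \<times> 'o, 'o, 'm) vfun \<Rightarrow> ('o \<times> 'o \<Rightarrow> 'm) set" where
  "balg_hom T U D D' = vnat_V (vtensor (tcat T) (tcat U)) D D'"

definition balg_pull :: "('o, 'o, 'm) vfun \<Rightarrow> ('o, 'o, 'm) vfun \<Rightarrow> ('o \<times> 'o, 'o, 'm) vfun
    \<Rightarrow> ('o \<times> 'o, 'o, 'm) vfun" where
  "balg_pull Ml Mr D = vfun_cmp (\<J> \<times> \<J>) D (vfun_tensor \<J> \<J> Ml Mr)"

definition balg_pull_ar :: "('o, 'o, 'm) vfun \<Rightarrow> ('o, 'o, 'm) vfun \<Rightarrow> ('o \<times> 'o \<Rightarrow> 'm)
    \<Rightarrow> ('o \<times> 'o \<Rightarrow> 'm)" where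
  "balg_pull_ar Ml Mr g = (\<lambda>(J, K)\<in>\<J> \<times> \<J>. g (fob Ml J, fob Mr K))"

text \<open>The \<open>\<V>\<close>-functor \<open>U \<rightarrow> T\<close>-\<open>Alg\<close>, \<open>K \<mapsto> D(-,K)\<close>, corresponding to a \<open>(T, U)\<close>-algebra \<open>D\<close>.\<close>

definition balg_transpose :: "('o, 'm) jtheory \<Rightarrow> ('o, 'm) jtheory \<Rightarrow> ('o \<times> 'o, 'o, 'm) vfun
    \<Rightarrow> ('o, ('o, 'o, 'm) vfun, 'm) vfun" where
  "balg_transpose T U D = mk_vfun \<J> (\<lambda>K. at_right T U D K)
    (\<lambda>K K'. end_lift (tcat T) (at_right T U D K) (at_right T U D K') (vhom (tcat U) K K')
      (\<lambda>J. fhom (at_left T U D J) K K'))"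

text \<open>The \<open>U\<close>-algebra \<open>Hom\<^sub>T(A, D) = T\<close>-\<open>Alg(A, D(-,?))\<close>.\<close>

definition HomAlg :: "('o, 'm) jtheory \<Rightarrow> ('o, 'm) jtheory \<Rightarrow> ('o, 'o, 'm) vfun
    \<Rightarrow> ('o \<times> 'o, 'o, 'm) vfun \<Rightarrow> ('o, 'o, 'm) vfun" where
  "HomAlg T U A D = vfun_cmp \<J> (representable (AlgV T) A) (balg_transpose T U D)"

text \<open>The action of the \<open>\<V>\<close>-functor \<open>Hom\<^sub>T\<close> on arrows of the underlying categories.
  For \<open>f : A' \<rightarrow> A\<close> and \<open>g : D \<rightarrow> D'\<close>, the homomorphism
  \<open>Hom\<^sub>T(f, g) : Hom\<^sub>T(A, D) \<rightarrow> Hom\<^sub>T(A', D')\<close> with components \<open>T\<close>-\<open>Alg(f, g(-,K))\<close>.\<close>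

definition HomAlg_ar :: "('o, 'm) jtheory \<Rightarrow> ('o, 'm) jtheory
    \<Rightarrow> ('o, 'o, 'm) vfun \<Rightarrow> ('o \<times> 'o, 'o, 'm) vfun
    \<Rightarrow> ('o, 'o, 'm) vfun \<Rightarrow> ('o \<times> 'o, 'o, 'm) vfun
    \<Rightarrow> ('o \<Rightarrow> 'm) \<Rightarrow> ('o \<times> 'o \<Rightarrow> 'm) \<Rightarrow> ('o \<Rightarrow> 'm)" where
  "HomAlg_ar T U A D A' D' f g = (\<lambda>K\<in>\<J>.
    hom_map (AlgV T) A (at_right T U D K) A' (at_right T U D' K)
      (vnat_elt (tcat T) A' A f)
      (vnat_elt (tcat T) (at_right T U D K) (at_right T U D' K) (\<lambda>J\<in>\<J>. g (J, K))))"

text \<open>For \<open>Ml : T2 \<rightarrow> T1\<close> and \<open>Mr : U2 \<rightarrow> U1\<close>, the homomorphism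
  \<open>Mr\<^sup>* Hom\<^bsub>T1\<^esub>(A, D) \<rightarrow> Hom\<^bsub>T2\<^esub>(Ml\<^sup>* A, M\<^sup>* D)\<close> whose component at \<open>K\<close> is the action of the
  \<open>\<V>\<close>-functor \<open>Ml\<^sup>*\<close> on the hom-object \<open>T1\<close>-\<open>Alg(A, D(-, Mr K))\<close>.\<close>

definition hom_comparison :: "('o, 'm) jtheory \<Rightarrow> ('o, 'm) jtheory \<Rightarrow> ('o, 'm) jtheory
    \<Rightarrow> ('o, 'o, 'm) vfun \<Rightarrow> ('o, 'o, 'm) vfun
    \<Rightarrow> ('o, 'o, 'm) vfun \<Rightarrow> ('o \<times> 'o, 'o, 'm) vfun \<Rightarrow> ('o \<Rightarrow> 'm)" where
  "hom_comparison T1 U1 T2 Ml Mr A D =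
    (\<lambda>K\<in>\<J>. fhom (alg_pullV T2 T1 Ml) A (at_right T1 U1 D (fob Mr K)))"


subsection \<open>The categories of algebras and of bifold algebras over varying theories\<close>

definition Alg :: "(('o, 'm) jtheory \<times> ('o, 'o, 'm) vfun, ('o, 'o, 'm) vfun \<times> ('o \<Rightarrow> 'm)) cat" where
  "Alg = \<lparr>Ob = {(T, A). T \<in> Ob Th \<and> A \<in> algs T},
    Hom = (\<lambda>(T1, A1) (T2, A2).
      {(M, f). M \<in> Hom Th T2 T1 \<and> f \<in> Hom (Alg0 T2) (alg_pull M A1) A2}),
    ident = (\<lambda>(T, A). (ident Th T, ident (Alg0 T) A)),
    cmp = (\<lambda>(N, h) (M, f). (cmp Th M N, \<lambda>K\<in>\<J>. h K \<cdot> alg_pull_ar N f K))\<rparr>"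

definition AlgStar :: "(('o, 'm) jtheory \<times> ('o, 'o, 'm) vfun, ('o, 'o, 'm) vfun \<times> ('o \<Rightarrow> 'm)) cat" where
  "AlgStar = \<lparr>Ob = {(T, A). T \<in> Ob Th \<and> A \<in> algs T},
    Hom = (\<lambda>(T1, A1) (T2, A2).
      {(M, f). M \<in> Hom Th T2 T1 \<and> f \<in> Hom (Alg0 T2) A2 (alg_pull M A1)}),
    ident = (\<lambda>(T, A). (ident Th T, ident (Alg0 T) A)),
    cmp = (\<lambda>(N, h) (M, f). (cmp Th M N, \<lambda>K\<in>\<J>. alg_pull_ar N f K \<cdot> h K))\<rparr>"

definition BAlg :: "(('o, 'm) jtheory \<times> ('o, 'm) jtheory \<times> ('o \<times> 'o, 'o, 'm) vfun,
    (('o, 'o, 'm) vfun \<times> ('o, 'o, 'm) vfun) \<times> ('o \<times> 'o \<Rightarrow> 'm)) cat" where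
  "BAlg = \<lparr>Ob = {(T, U, D). T \<in> Ob Th \<and> U \<in> Ob Th \<and> D \<in> balgs T U},
    Hom = (\<lambda>(T1, U1, D1) (T2, U2, D2).
      {((Ml, Mr), g). Ml \<in> Hom Th T2 T1 \<and> Mr \<in> Hom Th U2 U1 \<and>
        g \<in> balg_hom T2 U2 (balg_pull Ml Mr D1) D2}),
    ident = (\<lambda>(T, U, D). ((ident Th T, ident Th U), \<lambda>X\<in>\<J> \<times> \<J>. \<iota> (fob D X))),
    cmp = (\<lambda>((Nl, Nr), h) ((Ml, Mr), g).
      ((cmp Th Ml Nl, cmp Th Mr Nr), \<lambda>X\<in>\<J> \<times> \<J>. h X \<cdot> balg_pull_ar Nl Nr g X))\<rparr>"

text \<open>The forgetful functors to the opposite of \<open>Th\<close>, sending \<open>(T, A)\<close> and \<open>(T, U, D)\<close> to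
  \<open>T\<close>.\<close>

definition P_fctr :: "(('o, 'm) jtheory \<times> ('o, 'o, 'm) vfun, ('o, 'o, 'm) vfun \<times> ('o \<Rightarrow> 'm),
    ('o, 'm) jtheory, ('o, 'o, 'm) vfun) fctr" where
  "P_fctr = \<lparr>onOb = (\<lambda>(T, A). T), onAr = (\<lambda>_ _ (M, f). M)\<rparr>"

definition L_fctr :: "(('o, 'm) jtheory \<times> ('o, 'm) jtheory \<times> ('o \<times> 'o, 'o, 'm) vfun,
    (('o, 'o, 'm) vfun \<times> ('o, 'o, 'm) vfun) \<times> ('o \<times> 'o \<Rightarrow> 'm),
    ('o, 'm) jtheory, ('o, 'o, 'm) vfun) fctr" where
  "L_fctr = \<lparr>onOb = (\<lambda>(T, U, D). T), onAr = (\<lambda>_ _ ((Ml, Mr), g). Ml)\<rparr>"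

text \<open>An object \<open>(T, U, A, D)\<close> is encoded as \<open>((T, A), (T, U, D))\<close>, an arrow
  \<open>((Ml, Mr), f, g)\<close> as \<open>((Ml, f), ((Ml, Mr), g))\<close>.\<close>

definition AlgStar_BAlg where
  "AlgStar_BAlg = pullback_cat AlgStar BAlg P_fctr L_fctr"

end

locale amenable_arity_system = arity_system +
  assumes amenable: "is_amenable"

end

theory Submission
  imports Defs
begin

text \<open>
  Maps into \<open>V\<close>-valued hom-objects are compared after uncurrying, and maps into a hom-object
  \<open>T\<close>-\<open>Alg(A, B)\<close>, which is an end, after composition with the projections \<open>p\<^sub>X\<close> to
  \<open>A X \<Rrightarrow> B X\<close>.  In this form the homomorphism \<open>\<psi>\<close> of a morphism \<open>(M, f, g)\<close> is determined by
  \<open>p\<^sub>X \<cdot> \<psi>\<^sub>K = (f\<^sub>X \<Rrightarrow> g\<^sub>X\<^sub>K) \<cdot> p\<^sub>X\<close>, because morphisms of theories are the identity on objects, and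
  functoriality is visible.  The substantial points are that \<open>Hom\<^sub>T(A, D)\<close> is an algebra (powers in
  \<open>T\<close>-\<open>Alg\<close> are pointwise) and that pulling back along a morphism of theories preserves algebras
  (every object \<open>X\<close> of a theory has the power \<open>J \<otimes> X\<close> coming from the structure functor).  The
  enriched category axioms for \<open>V\<close> and for \<open>T\<close>-\<open>Alg\<close> come with amenability: a left adjoint of
  \<open>G\<^sup>T\<close> is in particular an enriched functor between them.
\<close>

section \<open>Typed arrows and coherence\<close>

text \<open>Only the pentagon, the triangle and the hexagon are axioms. The unit laws for
  \<open>lun\<close>, \<open>run\<close> and \<open>swp\<close> are derived from them by Kelly's
  argument, and of the interchange \<open>mid4\<close> only naturality and instances with units are
  established. These suffice because a functor of two variables is handled through its partial
  functors, each of which inserts an identity in the other variable. That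
  \<open>vtensor (tcat T) (tcat U)\<close> is an enriched category is taken from the bifold algebras
  themselves: an enriched functor on a tensor product includes this property of its domain. This is
  why lemmas on pulling back bifold algebras carry further bifold algebras over the other theories
  as hypotheses. Universal properties are used on generalised elements
  \<open>W \<rightarrow> C(X,Y)\<close>: a power is unique lifting along \<open>k\<close>, and an
  end is a jointly monic family of projections with lifts of wedges.\<close>

text \<open>Arrows bundled with a domain and a codomain, which the raw arrows do not determine.  The
  operations on them are total, so that typing conditions reduce to computing \<open>tdom\<close> and \<open>tcod\<close>;
  \<open>arr\<close> is well-typedness.\<close>

datatype ('o, 'm) tar = Tar (tdom: 'o) (tval: 'm) (tcod: 'o)

lemma tar_eqI: "tdom a = tdom b \<Longrightarrow> tcod a = tcod b \<Longrightarrow> tval a = tval b \<Longrightarrow> a = b"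
  by (cases a; cases b) simp

context category
begin

lemma is_inverse_unique:
  assumes "X \<in> Ob C" "Y \<in> Ob C" "is_inverse C X Y f g" "is_inverse C X Y f g'"
  shows "g = g'"
proof -
  have "g = \<iota> X \<cdot> g" using assms by (simp add: is_inverse_def ident_left)
  also have "\<dots> = (g' \<cdot> f) \<cdot> g" using assms by (simp add: is_inverse_def)
  also have "\<dots> = g' \<cdot> (f \<cdot> g)" using assms cmp_assoc[of Y X Y X g f g'] by (simp add: is_inverse_def)
  also have "\<dots> = g'" using assms by (simp add: is_inverse_def ident_right)
  finally show ?thesis .
qed

lemma inv_ar:
  assumes "X \<in> Ob C" "Y \<in> Ob C" "is_iso C X Y f"
  shows "is_inverse C X Y f (inv_ar C X Y f)"
  using assms is_inverse_unique unfolding inv_ar_def is_iso_def by (metis theI)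

end

section \<open>Composition of typed arrows and the structural isomorphisms\<close>

context symmetric_monoidal_closed
begin

definition arr :: "('o, 'm) tar \<Rightarrow> bool" where
  "arr a \<longleftrightarrow> tdom a \<in> Ob V \<and> tcod a \<in> Ob V \<and> tval a \<in> Hom V (tdom a) (tcod a)"

definition seq :: "('o, 'm) tar \<Rightarrow> ('o, 'm) tar \<Rightarrow> ('o, 'm) tar"  (infixr "\<odot>" 76) where
  "g \<odot> f = Tar (tdom f) (tval g \<cdot> tval f) (tcod g)"

definition ten :: "('o, 'm) tar \<Rightarrow> ('o, 'm) tar \<Rightarrow> ('o, 'm) tar"  (infixr "\<star>" 75) where
  "f \<star> g = Tar (tdom f \<otimes> tdom g) (tval f \<boxtimes> tval g) (tcod f \<otimes> tcod g)"

definition Idt :: "'o \<Rightarrow> ('o, 'm) tar" where "Idt X = Tar X (\<iota> X) X"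

definition Al :: "'o \<Rightarrow> 'o \<Rightarrow> 'o \<Rightarrow> ('o, 'm) tar" where
  "Al X Y Z = Tar ((X \<otimes> Y) \<otimes> Z) (assoc V X Y Z) (X \<otimes> (Y \<otimes> Z))"

definition Ali :: "'o \<Rightarrow> 'o \<Rightarrow> 'o \<Rightarrow> ('o, 'm) tar" where
  "Ali X Y Z = Tar (X \<otimes> (Y \<otimes> Z)) (assoc_inv X Y Z) ((X \<otimes> Y) \<otimes> Z)"

definition Lu :: "'o \<Rightarrow> ('o, 'm) tar" where "Lu X = Tar (\<one> \<otimes> X) (lun V X) X"
definition Lui :: "'o \<Rightarrow> ('o, 'm) tar" where "Lui X = Tar X (lun_inv X) (\<one> \<otimes> X)"
definition Ru :: "'o \<Rightarrow> ('o, 'm) tar" where "Ru X = Tar (X \<otimes> \<one>) (run V X) X"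
definition Rui :: "'o \<Rightarrow> ('o, 'm) tar" where "Rui X = Tar X (run_inv X) (X \<otimes> \<one>)"
definition Sw :: "'o \<Rightarrow> 'o \<Rightarrow> ('o, 'm) tar" where "Sw X Y = Tar (X \<otimes> Y) (swp V X Y) (Y \<otimes> X)"
definition Ev :: "'o \<Rightarrow> 'o \<Rightarrow> ('o, 'm) tar" where "Ev X Y = Tar ((X \<Rrightarrow> Y) \<otimes> X) (evl V X Y) Y"

lemmas tar_defs = arr_def seq_def ten_def Idt_def Al_def Ali_def Lu_def Lui_def Ru_def Rui_def
  Sw_def Ev_def

lemma tdom_simps [simp]:
  "tdom (g \<odot> f) = tdom f" "tdom (f \<star> g) = tdom f \<otimes> tdom g" "tdom (Idt X) = X"
  "tdom (Al X Y Z) = (X \<otimes> Y) \<otimes> Z" "tdom (Ali X Y Z) = X \<otimes> Y \<otimes> Z"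
  "tdom (Lu X) = \<one> \<otimes> X" "tdom (Lui X) = X" "tdom (Ru X) = X \<otimes> \<one>" "tdom (Rui X) = X"
  "tdom (Sw X Y) = X \<otimes> Y" "tdom (Ev X Y) = (X \<Rrightarrow> Y) \<otimes> X"
  by (simp_all add: tar_defs)

lemma tcod_simps [simp]:
  "tcod (g \<odot> f) = tcod g" "tcod (f \<star> g) = tcod f \<otimes> tcod g" "tcod (Idt X) = X"
  "tcod (Al X Y Z) = X \<otimes> Y \<otimes> Z" "tcod (Ali X Y Z) = (X \<otimes> Y) \<otimes> Z"
  "tcod (Lu X) = X" "tcod (Lui X) = \<one> \<otimes> X" "tcod (Ru X) = X" "tcod (Rui X) = X \<otimes> \<one>"
  "tcod (Sw X Y) = Y \<otimes> X" "tcod (Ev X Y) = Y"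
  by (simp_all add: tar_defs)

lemma tval_simps:
  "tval (g \<odot> f) = tval g \<cdot> tval f" "tval (f \<star> g) = tval f \<boxtimes> tval g" "tval (Idt X) = \<iota> X"
  "tval (Al X Y Z) = assoc V X Y Z" "tval (Ali X Y Z) = assoc_inv X Y Z"
  "tval (Lu X) = lun V X" "tval (Lui X) = lun_inv X" "tval (Ru X) = run V X" "tval (Rui X) = run_inv X"
  "tval (Sw X Y) = swp V X Y" "tval (Ev X Y) = evl V X Y"
  by (simp_all add: tar_defs)

declare unt_in [simp] tens_in [simp] ihom_in [simp]

lemma arr_dom: "arr f \<Longrightarrow> tdom f \<in> Ob V" and arr_cod: "arr f \<Longrightarrow> tcod f \<in> Ob V"
  by (simp_all add: arr_def)

lemma arr_Tar: "arr (Tar X f Y) \<longleftrightarrow> X \<in> Ob V \<and> Y \<in> Ob V \<and> f \<in> Hom V X Y"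
  by (simp add: arr_def)

lemma arr_tval: "arr f \<Longrightarrow> tdom f = X \<Longrightarrow> tcod f = Y \<Longrightarrow> tval f \<in> Hom V X Y"
  by (auto simp: arr_def)

lemma arr_seq [simp]: "arr g \<Longrightarrow> arr f \<Longrightarrow> tdom g = tcod f \<Longrightarrow> arr (g \<odot> f)"
  using cmp_in[of "tdom f" "tcod f" "tcod g"] by (simp add: arr_def tval_simps)

lemma arr_ten [simp]: "arr f \<Longrightarrow> arr g \<Longrightarrow> arr (f \<star> g)"
  by (simp add: arr_def tval_simps tensA_in)

lemma inverses:
  shows "\<lbrakk>X \<in> Ob V; Y \<in> Ob V; Z \<in> Ob V\<rbrakk> \<Longrightarrow>
      is_inverse V ((X \<otimes> Y) \<otimes> Z) (X \<otimes> (Y \<otimes> Z)) (assoc V X Y Z) (assoc_inv X Y Z)"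
    and "X \<in> Ob V \<Longrightarrow> is_inverse V (\<one> \<otimes> X) X (lun V X) (lun_inv X)"
    and "X \<in> Ob V \<Longrightarrow> is_inverse V (X \<otimes> \<one>) X (run V X) (run_inv X)"
  by (simp_all add: assoc_inv_def lun_inv_def run_inv_def inv_ar assoc_iso lun_iso run_iso)

lemma arr_structure [simp]:
  "X \<in> Ob V \<Longrightarrow> arr (Idt X)"
  "\<lbrakk>X \<in> Ob V; Y \<in> Ob V; Z \<in> Ob V\<rbrakk> \<Longrightarrow> arr (Al X Y Z)"
  "\<lbrakk>X \<in> Ob V; Y \<in> Ob V; Z \<in> Ob V\<rbrakk> \<Longrightarrow> arr (Ali X Y Z)"
  "X \<in> Ob V \<Longrightarrow> arr (Lu X)" "X \<in> Ob V \<Longrightarrow> arr (Lui X)"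
  "X \<in> Ob V \<Longrightarrow> arr (Ru X)" "X \<in> Ob V \<Longrightarrow> arr (Rui X)"
  "\<lbrakk>X \<in> Ob V; Y \<in> Ob V\<rbrakk> \<Longrightarrow> arr (Sw X Y)"
  "\<lbrakk>X \<in> Ob V; Y \<in> Ob V\<rbrakk> \<Longrightarrow> arr (Ev X Y)"
  using inverses by (simp_all add: arr_def tval_simps ident_in swp_in evl_in is_inverse_def)

lemma seq_assoc [simp]:
  "\<lbrakk>arr h; arr g; arr f; tdom h = tcod g; tdom g = tcod f\<rbrakk> \<Longrightarrow> (h \<odot> g) \<odot> f = h \<odot> g \<odot> f"
  using cmp_assoc[of "tdom f" "tcod f" "tcod g" "tcod h"]
  by (auto intro!: tar_eqI simp: tval_simps arr_def)

lemma Idt_seq [simp]: "arr f \<Longrightarrow> tcod f = X \<Longrightarrow> Idt X \<odot> f = f"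
  and seq_Idt [simp]: "arr f \<Longrightarrow> tdom f = X \<Longrightarrow> f \<odot> Idt X = f"
  by (auto intro!: tar_eqI simp: tval_simps arr_def ident_left ident_right)

lemma Idt_ten_Idt [simp]: "X \<in> Ob V \<Longrightarrow> Y \<in> Ob V \<Longrightarrow> Idt X \<star> Idt Y = Idt (X \<otimes> Y)"
  by (auto intro!: tar_eqI simp: tval_simps tensA_ident)

lemma ten_seq [simp]:
  "\<lbrakk>arr f; arr f'; arr g; arr g'; tdom f' = tcod f; tdom g' = tcod g\<rbrakk>
    \<Longrightarrow> (f' \<star> g') \<odot> (f \<star> g) = (f' \<odot> f) \<star> (g' \<odot> g)"
  by (auto intro!: tar_eqI simp: tval_simps arr_def tensA_cmp)

lemma Al_natural:
  "\<lbrakk>arr f; arr g; arr h; tcod f = X; tcod g = Y; tcod h = Z\<rbrakk>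
    \<Longrightarrow> Al X Y Z \<odot> ((f \<star> g) \<star> h) = (f \<star> g \<star> h) \<odot> Al (tdom f) (tdom g) (tdom h)"
  by (auto intro!: tar_eqI simp: tval_simps arr_def assoc_natural)

lemma Lu_natural: "\<lbrakk>arr f; tcod f = X\<rbrakk> \<Longrightarrow> Lu X \<odot> (Idt \<one> \<star> f) = f \<odot> Lu (tdom f)"
  and Ru_natural: "\<lbrakk>arr f; tcod f = X\<rbrakk> \<Longrightarrow> Ru X \<odot> (f \<star> Idt \<one>) = f \<odot> Ru (tdom f)"
  by (auto intro!: tar_eqI simp: tval_simps arr_def lun_natural run_natural)

lemma Sw_natural:
  "\<lbrakk>arr f; arr g; tcod f = X; tcod g = Y\<rbrakk> \<Longrightarrow> Sw X Y \<odot> (f \<star> g) = (g \<star> f) \<odot> Sw (tdom f) (tdom g)"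
  by (auto intro!: tar_eqI simp: tval_simps arr_def swp_natural)

lemma Pentagon:
  "\<lbrakk>W \<in> Ob V; X \<in> Ob V; Y \<in> Ob V; Z \<in> Ob V\<rbrakk>
    \<Longrightarrow> Al W X (Y \<otimes> Z) \<odot> Al (W \<otimes> X) Y Z
      = (Idt W \<star> Al X Y Z) \<odot> Al W (X \<otimes> Y) Z \<odot> (Al W X Y \<star> Idt Z)"
  by (auto intro!: tar_eqI simp: tval_simps pentagon)

lemma Triangle: "\<lbrakk>X \<in> Ob V; Y \<in> Ob V\<rbrakk> \<Longrightarrow> (Idt X \<star> Lu Y) \<odot> Al X \<one> Y = Ru X \<star> Idt Y"
  by (auto intro!: tar_eqI simp: tval_simps triangle)

lemma Hexagon:
  "\<lbrakk>X \<in> Ob V; Y \<in> Ob V; Z \<in> Ob V\<rbrakk>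
    \<Longrightarrow> Al Y Z X \<odot> Sw X (Y \<otimes> Z) \<odot> Al X Y Z
      = (Idt Y \<star> Sw X Z) \<odot> Al Y X Z \<odot> (Sw X Y \<star> Idt Z)"
  by (auto intro!: tar_eqI simp: tval_simps hexagon)

declare arr_dom [simp] arr_cod [simp]

text \<open>The simplifier nests \<open>\<odot>\<close> to the right, so the left side
  \<open>a \<odot> b\<close> of a known equation is not a subterm of
  \<open>a \<odot> b \<odot> x\<close>. This form and \<open>reassoc2\<close> apply such an equation
  at the head of a longer composite.\<close>

lemma reassoc:
  assumes "a \<odot> b = c" "arr a" "arr b" "arr x" "tdom a = tcod b" "tdom b = tcod x"
  shows "a \<odot> b \<odot> x = c \<odot> x"
  using assms seq_assoc by metis

lemma reassoc2:
  assumes "a \<odot> b = c \<odot> d" "arr a" "arr b" "arr c" "arr d" "arr x"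
    "tdom a = tcod b" "tdom b = tcod x" "tdom c = tcod d" "tdom d = tdom b"
  shows "a \<odot> b \<odot> x = c \<odot> d \<odot> x"
  using assms seq_assoc by metis

lemma ten_seq' [simp]:
  "\<lbrakk>arr f; arr f'; arr g; arr g'; arr h; tdom f' = tcod f; tdom g' = tcod g; tdom f \<otimes> tdom g = tcod h\<rbrakk>
    \<Longrightarrow> (f' \<star> g') \<odot> (f \<star> g) \<odot> h = ((f' \<odot> f) \<star> (g' \<odot> g)) \<odot> h"
  by (rule reassoc) auto

lemma structure_inverses [simp]:
  "\<lbrakk>X \<in> Ob V; Y \<in> Ob V; Z \<in> Ob V\<rbrakk> \<Longrightarrow> Al X Y Z \<odot> Ali X Y Z = Idt (X \<otimes> Y \<otimes> Z)"
  "\<lbrakk>X \<in> Ob V; Y \<in> Ob V; Z \<in> Ob V\<rbrakk> \<Longrightarrow> Ali X Y Z \<odot> Al X Y Z = Idt ((X \<otimes> Y) \<otimes> Z)"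
  "X \<in> Ob V \<Longrightarrow> Lu X \<odot> Lui X = Idt X" "X \<in> Ob V \<Longrightarrow> Lui X \<odot> Lu X = Idt (\<one> \<otimes> X)"
  "X \<in> Ob V \<Longrightarrow> Ru X \<odot> Rui X = Idt X" "X \<in> Ob V \<Longrightarrow> Rui X \<odot> Ru X = Idt (X \<otimes> \<one>)"
  "\<lbrakk>X \<in> Ob V; Y \<in> Ob V\<rbrakk> \<Longrightarrow> Sw Y X \<odot> Sw X Y = Idt (X \<otimes> Y)"
  using inverses by (auto intro!: tar_eqI simp: tval_simps is_inverse_def swp_swp)

lemma structure_inverses' [simp]:
  "\<lbrakk>X \<in> Ob V; Y \<in> Ob V; Z \<in> Ob V; arr f; tcod f = X \<otimes> Y \<otimes> Z\<rbrakk> \<Longrightarrow> Al X Y Z \<odot> Ali X Y Z \<odot> f = f"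
  "\<lbrakk>X \<in> Ob V; Y \<in> Ob V; Z \<in> Ob V; arr f; tcod f = (X \<otimes> Y) \<otimes> Z\<rbrakk> \<Longrightarrow> Ali X Y Z \<odot> Al X Y Z \<odot> f = f"
  "\<lbrakk>X \<in> Ob V; arr f; tcod f = X\<rbrakk> \<Longrightarrow> Lu X \<odot> Lui X \<odot> f = f"
  "\<lbrakk>X \<in> Ob V; arr f; tcod f = \<one> \<otimes> X\<rbrakk> \<Longrightarrow> Lui X \<odot> Lu X \<odot> f = f"
  "\<lbrakk>X \<in> Ob V; arr f; tcod f = X\<rbrakk> \<Longrightarrow> Ru X \<odot> Rui X \<odot> f = f"
  "\<lbrakk>X \<in> Ob V; arr f; tcod f = X \<otimes> \<one>\<rbrakk> \<Longrightarrow> Rui X \<odot> Ru X \<odot> f = f"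
  "\<lbrakk>X \<in> Ob V; Y \<in> Ob V; arr f; tcod f = X \<otimes> Y\<rbrakk> \<Longrightarrow> Sw Y X \<odot> Sw X Y \<odot> f = f"
  by (subst reassoc, (rule structure_inverses | simp)+)+

lemma seq_cancel_right:
  assumes "f \<odot> e = g \<odot> e" "e \<odot> e' = Idt X" "arr f" "arr g" "arr e" "arr e'"
    "tdom f = tcod e" "tdom g = tcod e" "tdom f = X" "tdom e = tcod e'"
  shows "f = g"
  using assms by (metis seq_assoc seq_Idt)

lemma seq_cancel_left:
  assumes "m \<odot> f = m \<odot> g" "m' \<odot> m = Idt X" "arr f" "arr g" "arr m" "arr m'"
    "tcod f = tdom m" "tcod g = tdom m" "tcod f = X" "tdom m' = tcod m"
  shows "f = g"
  using assms by (metis seq_assoc Idt_seq)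

lemma Ali_natural:
  assumes "arr f" "arr g" "arr h" "tcod f = X" "tcod g = Y" "tcod h = Z"
  shows "Ali X Y Z \<odot> (f \<star> g \<star> h) = ((f \<star> g) \<star> h) \<odot> Ali (tdom f) (tdom g) (tdom h)"
proof -
  have "Ali X Y Z \<odot> (f \<star> g \<star> h) = Ali X Y Z \<odot> ((f \<star> g \<star> h) \<odot> Al (tdom f) (tdom g) (tdom h)) \<odot> Ali (tdom f) (tdom g) (tdom h)"
    using assms by simp
  also have "(f \<star> g \<star> h) \<odot> Al (tdom f) (tdom g) (tdom h) = Al X Y Z \<odot> ((f \<star> g) \<star> h)"
    using assms by (simp add: Al_natural)
  finally show ?thesis using assms by auto
qed

lemma Lui_natural:
  assumes "arr f" "tcod f = X"
  shows "Lui X \<odot> f = (Idt \<one> \<star> f) \<odot> Lui (tdom f)"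
proof -
  have "Lui X \<odot> f = Lui X \<odot> (f \<odot> Lu (tdom f)) \<odot> Lui (tdom f)"
    using assms by simp
  also have "f \<odot> Lu (tdom f) = Lu X \<odot> (Idt \<one> \<star> f)"
    using assms by (simp add: Lu_natural)
  finally show ?thesis using assms by auto
qed

lemma Rui_natural:
  assumes "arr f" "tcod f = X"
  shows "Rui X \<odot> f = (f \<star> Idt \<one>) \<odot> Rui (tdom f)"
proof -
  have "Rui X \<odot> f = Rui X \<odot> (f \<odot> Ru (tdom f)) \<odot> Rui (tdom f)"
    using assms by simp
  also have "f \<odot> Ru (tdom f) = Ru X \<odot> (f \<star> Idt \<one>)"
    using assms by (simp add: Ru_natural)
  finally show ?thesis using assms by auto
qed

section \<open>Unit coherence\<close>

text \<open>\<open>Lu\<close> is a natural isomorphism from tensoring with \<open>\<one>\<close> to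
  the identity, so an equation loses nothing when tensored with \<open>\<one>\<close>. The unit laws
  are proved in that form, where pentagon and triangle have room to apply.\<close>

lemma unit_ten_faithful:
  assumes "arr f" "arr g" "tdom f = tdom g" "tcod f = tcod g" "Idt \<one> \<star> f = Idt \<one> \<star> g"
  shows "f = g"
proof -
  have "f \<odot> Lu (tdom f) = g \<odot> Lu (tdom f)"
    using Lu_natural[of f "tcod f"] Lu_natural[of g "tcod g"] assms by simp
  then show ?thesis
    by (rule seq_cancel_right[where e' = "Lui (tdom f)"]) (use assms in auto)
qed

lemma ten_unit_faithful:
  assumes "arr f" "arr g" "tdom f = tdom g" "tcod f = tcod g" "f \<star> Idt \<one> = g \<star> Idt \<one>"
  shows "f = g"
proof -
  have "f \<odot> Ru (tdom f) = g \<odot> Ru (tdom f)"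
    using Ru_natural[of f "tcod f"] Ru_natural[of g "tcod g"] assms by simp
  then show ?thesis
    by (rule seq_cancel_right[where e' = "Rui (tdom f)"]) (use assms in auto)
qed

text \<open>Kelly's argument: after tensoring with \<open>\<one>\<close> and composing with the
  isomorphism \<open>?e\<close>, the pentagon for \<open>\<one>, \<one>, X, Y\<close> and two
  triangles bring both sides to the same composite.\<close>

lemma Lu_ten:
  assumes [simp]: "X \<in> Ob V" "Y \<in> Ob V"
  shows "Lu (X \<otimes> Y) \<odot> Al \<one> X Y = Lu X \<star> Idt Y"
proof (rule unit_ten_faithful)
  let ?e = "Al \<one> (\<one> \<otimes> X) Y \<odot> (Al \<one> \<one> X \<star> Idt Y)"
  have "(Idt \<one> \<star> Lu (X \<otimes> Y) \<odot> Al \<one> X Y) \<odot> ?e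
      = (Idt \<one> \<star> Lu (X \<otimes> Y)) \<odot> (Idt \<one> \<star> Al \<one> X Y) \<odot> ?e"
    by simp
  also have "(Idt \<one> \<star> Al \<one> X Y) \<odot> ?e = Al \<one> \<one> (X \<otimes> Y) \<odot> Al (\<one> \<otimes> \<one>) X Y"
    by (simp only: Pentagon assms unt_in)
  also have "(Idt \<one> \<star> Lu (X \<otimes> Y)) \<odot> \<dots> = (Ru \<one> \<star> Idt (X \<otimes> Y)) \<odot> Al (\<one> \<otimes> \<one>) X Y"
    by (rule reassoc) (simp_all add: Triangle)
  also have "\<dots> = Al \<one> X Y \<odot> ((Ru \<one> \<star> Idt X) \<star> Idt Y)"
    by (simp add: Al_natural)
  also have "\<dots> = Al \<one> X Y \<odot> (((Idt \<one> \<star> Lu X) \<odot> Al \<one> \<one> X) \<star> Idt Y)"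
    by (simp add: Triangle)
  also have "\<dots> = Al \<one> X Y \<odot> ((Idt \<one> \<star> Lu X) \<star> Idt Y) \<odot> (Al \<one> \<one> X \<star> Idt Y)"
    by simp
  also have "\<dots> = (Idt \<one> \<star> Lu X \<star> Idt Y) \<odot> ?e"
    using Al_natural[of "Idt \<one>" "Lu X" "Idt Y" \<one> X Y] by (subst reassoc2) auto
  finally show "Idt \<one> \<star> Lu (X \<otimes> Y) \<odot> Al \<one> X Y = Idt \<one> \<star> Lu X \<star> Idt Y"
    by (rule seq_cancel_right[where e' = "(Ali \<one> \<one> X \<star> Idt Y) \<odot> Ali \<one> (\<one> \<otimes> X) Y"]) auto
qed auto

text \<open>The mirror image of the previous argument, with the pentagon for
  \<open>X, Y, \<one>, \<one>\<close> and tensoring on the right.\<close>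

lemma Ru_ten:
  assumes [simp]: "X \<in> Ob V" "Y \<in> Ob V"
  shows "(Idt X \<star> Ru Y) \<odot> Al X Y \<one> = Ru (X \<otimes> Y)"
proof (rule ten_unit_faithful)
  have "Al X Y \<one> \<odot> (Ru (X \<otimes> Y) \<star> Idt \<one>) = Al X Y \<one> \<odot> (Idt (X \<otimes> Y) \<star> Lu \<one>) \<odot> Al (X \<otimes> Y) \<one> \<one>"
    by (simp add: Triangle)
  also have "\<dots> = (Idt X \<star> Idt Y \<star> Lu \<one>) \<odot> Al X Y (\<one> \<otimes> \<one>) \<odot> Al (X \<otimes> Y) \<one> \<one>"
    using Al_natural[of "Idt X" "Idt Y" "Lu \<one>" X Y \<one>] by (subst reassoc2) auto
  also have "Al X Y (\<one> \<otimes> \<one>) \<odot> Al (X \<otimes> Y) \<one> \<one>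
      = (Idt X \<star> Al Y \<one> \<one>) \<odot> Al X (Y \<otimes> \<one>) \<one> \<odot> (Al X Y \<one> \<star> Idt \<one>)"
    by (simp only: Pentagon assms unt_in)
  also have "(Idt X \<star> Idt Y \<star> Lu \<one>) \<odot> \<dots> = (Idt X \<star> (Idt Y \<star> Lu \<one>) \<odot> Al Y \<one> \<one>) \<odot> Al X (Y \<otimes> \<one>) \<one> \<odot> (Al X Y \<one> \<star> Idt \<one>)"
    by simp
  also have "\<dots> = ((Idt X \<star> Ru Y \<star> Idt \<one>) \<odot> Al X (Y \<otimes> \<one>) \<one>) \<odot> (Al X Y \<one> \<star> Idt \<one>)"
    by (simp add: Triangle)
  also have "(Idt X \<star> Ru Y \<star> Idt \<one>) \<odot> Al X (Y \<otimes> \<one>) \<one> = Al X Y \<one> \<odot> ((Idt X \<star> Ru Y) \<star> Idt \<one>)"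
    by (simp add: Al_natural)
  finally have "Al X Y \<one> \<odot> (Ru (X \<otimes> Y) \<star> Idt \<one>) = Al X Y \<one> \<odot> ((Idt X \<star> Ru Y) \<odot> Al X Y \<one> \<star> Idt \<one>)"
    by simp
  then have "Ru (X \<otimes> Y) \<star> Idt \<one> = (Idt X \<star> Ru Y) \<odot> Al X Y \<one> \<star> Idt \<one>"
    by (rule seq_cancel_left[where m' = "Ali X Y \<one>"]) auto
  then show "(Idt X \<star> Ru Y) \<odot> Al X Y \<one> \<star> Idt \<one> = Ru (X \<otimes> Y) \<star> Idt \<one>" ..
qed auto

text \<open>Naturality of \<open>Lu\<close> at the arrow \<open>Lu \<one>\<close>, with
  \<open>Lu \<one>\<close> cancelled, gives
  \<open>Idt \<one> \<star> Lu \<one> = Lu (\<one> \<otimes> \<one>)\<close>. Composed with the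
  associativity, this arrow is computed both by \<open>Lu_ten\<close> and by the triangle.\<close>

lemma Lu_unt: "Lu \<one> = Ru \<one>"
proof (rule ten_unit_faithful)
  have "Lu \<one> \<odot> (Idt \<one> \<star> Lu \<one>) = Lu \<one> \<odot> Lu (\<one> \<otimes> \<one>)"
    by (simp add: Lu_natural)
  then have "Idt \<one> \<star> Lu \<one> = Lu (\<one> \<otimes> \<one>)"
    by (rule seq_cancel_left[where m' = "Lui \<one>"]) auto
  then show "Lu \<one> \<star> Idt \<one> = Ru \<one> \<star> Idt \<one>"
    using Lu_ten[of \<one> \<one>] Triangle[of \<one> \<one>] by simp
qed auto

text \<open>The hexagon for \<open>X, \<one>, \<one>\<close> contains this equation tensored with
  \<open>\<one>\<close>, behind a factor \<open>Sw X \<one>\<close> that is invertible and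
  cancels.\<close>

lemma Lu_Sw:
  assumes [simp]: "X \<in> Ob V"
  shows "Lu X \<odot> Sw X \<one> = Ru X"
proof (rule ten_unit_faithful)
  have "Sw X \<one> \<odot> (Ru X \<star> Idt \<one>) = Sw X \<one> \<odot> (Idt X \<star> Lu \<one>) \<odot> Al X \<one> \<one>"
    by (simp add: Triangle)
  also have "\<dots> = (Lu \<one> \<star> Idt X) \<odot> Sw X (\<one> \<otimes> \<one>) \<odot> Al X \<one> \<one>"
    using Sw_natural[of "Idt X" "Lu \<one>" X \<one>] by (subst reassoc2) auto
  also have "\<dots> = Lu (\<one> \<otimes> X) \<odot> Al \<one> \<one> X \<odot> Sw X (\<one> \<otimes> \<one>) \<odot> Al X \<one> \<one>"
    by (subst Lu_ten[symmetric]) auto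
  also have "Al \<one> \<one> X \<odot> Sw X (\<one> \<otimes> \<one>) \<odot> Al X \<one> \<one>
      = (Idt \<one> \<star> Sw X \<one>) \<odot> Al \<one> X \<one> \<odot> (Sw X \<one> \<star> Idt \<one>)"
    by (simp only: Hexagon assms unt_in)
  also have "Lu (\<one> \<otimes> X) \<odot> \<dots> = Sw X \<one> \<odot> Lu (X \<otimes> \<one>) \<odot> Al \<one> X \<one> \<odot> (Sw X \<one> \<star> Idt \<one>)"
    using Lu_natural[of "Sw X \<one>"] by (subst reassoc2) auto
  also have "Lu (X \<otimes> \<one>) \<odot> Al \<one> X \<one> \<odot> (Sw X \<one> \<star> Idt \<one>) = Lu X \<odot> Sw X \<one> \<star> Idt \<one>"
    by (subst reassoc[OF Lu_ten]) auto
  finally have "Ru X \<star> Idt \<one> = Lu X \<odot> Sw X \<one> \<star> Idt \<one>"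
    by (rule seq_cancel_left[where m' = "Sw \<one> X"]) auto
  then show "Lu X \<odot> Sw X \<one> \<star> Idt \<one> = Ru X \<star> Idt \<one>" ..
qed auto

lemma Ru_Sw:
  assumes [simp]: "X \<in> Ob V"
  shows "Ru X \<odot> Sw \<one> X = Lu X"
  by (simp add: Lu_Sw[symmetric])

lemma Sw_unt:
  assumes [simp]: "X \<in> Ob V"
  shows "Sw \<one> X = Rui X \<odot> Lu X"
  by (simp add: Ru_Sw[symmetric])

section \<open>Interchange of tensor factors\<close>

text \<open>The interchange of the first two factors of a triple bracketed to the right. It is the
  middle part of \<open>mid4\<close>, and the hexagon takes a simple form in terms of it.\<close>

definition Sg :: "'o \<Rightarrow> 'o \<Rightarrow> 'o \<Rightarrow> ('o, 'm) tar" where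
  "Sg X Y Z = Al Y X Z \<odot> (Sw X Y \<star> Idt Z) \<odot> Ali X Y Z"

lemma Sg_simps [simp]:
  "tdom (Sg X Y Z) = X \<otimes> Y \<otimes> Z" "tcod (Sg X Y Z) = Y \<otimes> X \<otimes> Z"
  "\<lbrakk>X \<in> Ob V; Y \<in> Ob V; Z \<in> Ob V\<rbrakk> \<Longrightarrow> arr (Sg X Y Z)"
  by (auto simp: Sg_def)

lemma Sg_Sg [simp]:
  assumes [simp]: "X \<in> Ob V" "Y \<in> Ob V" "Z \<in> Ob V"
  shows "Sg Y X Z \<odot> Sg X Y Z = Idt (X \<otimes> Y \<otimes> Z)"
  by (simp add: Sg_def)

lemma Sg_natural:
  assumes [simp]: "arr f" "arr g" "arr h" and tc [simp]: "tcod f = X" "tcod g = Y" "tcod h = Z"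
  shows "Sg X Y Z \<odot> (f \<star> g \<star> h) = (g \<star> f \<star> h) \<odot> Sg (tdom f) (tdom g) (tdom h)"
proof -
  have [simp]: "X \<in> Ob V" "Y \<in> Ob V" "Z \<in> Ob V"
    using arr_cod assms by blast+
  have "Sg X Y Z \<odot> (f \<star> g \<star> h) = Al Y X Z \<odot> (Sw X Y \<odot> (f \<star> g) \<star> h) \<odot> Ali (tdom f) (tdom g) (tdom h)"
    by (simp add: Sg_def Ali_natural)
  also have "\<dots> = Al Y X Z \<odot> ((g \<star> f) \<star> h) \<odot> (Sw (tdom f) (tdom g) \<star> Idt (tdom h)) \<odot> Ali (tdom f) (tdom g) (tdom h)"
    by (simp add: Sw_natural)
  also have "\<dots> = (g \<star> f \<star> h) \<odot> Sg (tdom f) (tdom g) (tdom h)"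
    unfolding Sg_def by (subst reassoc2[OF Al_natural]) auto
  finally show ?thesis .
qed

text \<open>The hexagon solved for the symmetry past a tensor product: pass \<open>Y\<close>, then
  \<open>Z\<close>. Squares pasted side by side are carried past a common arrow in these two
  moves.\<close>

lemma Sw_ten_right:
  assumes [simp]: "X \<in> Ob V" "Y \<in> Ob V" "Z \<in> Ob V"
  shows "Sw X (Y \<otimes> Z) = Ali Y Z X \<odot> (Idt Y \<star> Sw X Z) \<odot> Sg X Y Z"
proof -
  have "Sw X (Y \<otimes> Z) = Ali Y Z X \<odot> (Al Y Z X \<odot> Sw X (Y \<otimes> Z) \<odot> Al X Y Z) \<odot> Ali X Y Z"
    by simp
  also have "Al Y Z X \<odot> Sw X (Y \<otimes> Z) \<odot> Al X Y Z
      = (Idt Y \<star> Sw X Z) \<odot> Al Y X Z \<odot> (Sw X Y \<star> Idt Z)"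
    by (rule Hexagon) auto
  finally show ?thesis by (simp add: Sg_def)
qed

lemma Sw_Sg:
  assumes [simp]: "X \<in> Ob V" "Y \<in> Ob V" "Z \<in> Ob V"
  shows "Sw Y (X \<otimes> Z) \<odot> Sg X Y Z = Ali X Z Y \<odot> (Idt X \<star> Sw Y Z)"
  by (simp add: Sw_ten_right)

lemma Al_Rui_ten:
  assumes [simp]: "X \<in> Ob V" "Y \<in> Ob V"
  shows "Al X \<one> Y \<odot> (Rui X \<star> Idt Y) = Idt X \<star> Lui Y"
  by (rule seq_cancel_left[where m = "Idt X \<star> Lu Y" and m' = "Idt X \<star> Lui Y"])
    (auto simp: reassoc[OF Triangle])

lemma Ali_Lui:
  assumes [simp]: "X \<in> Ob V" "Y \<in> Ob V"
  shows "Ali X \<one> Y \<odot> (Idt X \<star> Lui Y) = Rui X \<star> Idt Y"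
  by (simp add: Al_Rui_ten[symmetric])

lemma Sg_unt_left:
  assumes [simp]: "Y \<in> Ob V" "Z \<in> Ob V"
  shows "Sg \<one> Y Z = (Idt Y \<star> Lui Z) \<odot> Lu (Y \<otimes> Z)"
proof -
  have B: "(Lu Y \<star> Idt Z) \<odot> Ali \<one> Y Z = Lu (Y \<otimes> Z)"
    by (simp add: Lu_ten[symmetric])
  have "Sg \<one> Y Z = Al Y \<one> Z \<odot> (Rui Y \<star> Idt Z) \<odot> (Lu Y \<star> Idt Z) \<odot> Ali \<one> Y Z"
    by (simp add: Sg_def Sw_unt)
  then show ?thesis using B by (simp add: reassoc[OF Al_Rui_ten])
qed

text \<open>\<open>Sg \<one> X Z\<close> is inverse to \<open>Sg X \<one> Z\<close>, so its explicit
  form determines this one.\<close>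

lemma Sg_unt_middle:
  assumes [simp]: "X \<in> Ob V" "Z \<in> Ob V"
  shows "Sg X \<one> Z = Lui (X \<otimes> Z) \<odot> (Idt X \<star> Lu Z)"
proof (rule seq_cancel_left[where m = "Sg \<one> X Z" and m' = "Sg X \<one> Z"])
  show "Sg \<one> X Z \<odot> Sg X \<one> Z = Sg \<one> X Z \<odot> Lui (X \<otimes> Z) \<odot> (Idt X \<star> Lu Z)"
    by simp (simp add: Sg_unt_left)
qed auto

lemma Sg_unt_right:
  assumes [simp]: "X \<in> Ob V" "Y \<in> Ob V"
  shows "(Idt Y \<star> Ru X) \<odot> Sg X Y \<one> = Sw X Y \<odot> (Idt X \<star> Ru Y)"
proof -
  have "(Idt Y \<star> Ru X) \<odot> Sg X Y \<one> = Ru (Y \<otimes> X) \<odot> (Sw X Y \<star> Idt \<one>) \<odot> Ali X Y \<one>"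
    unfolding Sg_def by (subst reassoc[OF Ru_ten]) auto
  also have "\<dots> = Sw X Y \<odot> Ru (X \<otimes> Y) \<odot> Ali X Y \<one>"
    by (subst reassoc2[OF Ru_natural]) auto
  also have "Ru (X \<otimes> Y) \<odot> Ali X Y \<one> = Idt X \<star> Ru Y"
    by (simp add: Ru_ten[symmetric])
  finally show ?thesis .
qed

definition Mid :: "'o \<Rightarrow> 'o \<Rightarrow> 'o \<Rightarrow> 'o \<Rightarrow> ('o, 'm) tar" where
  "Mid W X Y Z = Ali W Y (X \<otimes> Z) \<odot> (Idt W \<star> Sg X Y Z) \<odot> Al W X (Y \<otimes> Z)"

lemma Mid_simps [simp]:
  "tdom (Mid W X Y Z) = (W \<otimes> X) \<otimes> (Y \<otimes> Z)" "tcod (Mid W X Y Z) = (W \<otimes> Y) \<otimes> (X \<otimes> Z)"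
  "\<lbrakk>W \<in> Ob V; X \<in> Ob V; Y \<in> Ob V; Z \<in> Ob V\<rbrakk> \<Longrightarrow> arr (Mid W X Y Z)"
  by (auto simp: Mid_def)

lemma Tar_mid4:
  assumes [simp]: "W \<in> Ob V" "X \<in> Ob V" "Y \<in> Ob V" "Z \<in> Ob V"
  shows "Tar ((W \<otimes> X) \<otimes> (Y \<otimes> Z)) (mid4 W X Y Z) ((W \<otimes> Y) \<otimes> (X \<otimes> Z)) = Mid W X Y Z"
proof -
  \<comment> \<open>The raw \<open>\<cdot>\<close> associates to the left and \<open>\<odot>\<close>
    to the right, so the composite is rebracketed to the shape of \<open>mid4\<close> before its
    value is read off. The same device recurs where other raw definitions are matched.\<close>
  have "Mid W X Y Z
      = (Ali W Y (X \<otimes> Z) \<odot> (Idt W \<star> (Al Y X Z \<odot> (Sw X Y \<star> Idt Z)) \<odot> Ali X Y Z)) \<odot> Al W X (Y \<otimes> Z)"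
    by (simp add: Mid_def Sg_def)
  then have "tval (Mid W X Y Z) = mid4 W X Y Z"
    by (simp only: tval_simps mid4_def)
  then show ?thesis
    by (auto intro!: tar_eqI)
qed

lemma Mid_natural:
  assumes [simp]: "arr e" "arr f" "arr g" "arr h"
    and tc [simp]: "tcod e = W" "tcod f = X" "tcod g = Y" "tcod h = Z"
  shows "Mid W X Y Z \<odot> ((e \<star> f) \<star> (g \<star> h))
    = ((e \<star> g) \<star> (f \<star> h)) \<odot> Mid (tdom e) (tdom f) (tdom g) (tdom h)"
proof -
  have [simp]: "W \<in> Ob V" "X \<in> Ob V" "Y \<in> Ob V" "Z \<in> Ob V"
    using arr_cod assms by blast+
  have "Mid W X Y Z \<odot> ((e \<star> f) \<star> (g \<star> h))
      = Ali W Y (X \<otimes> Z) \<odot> (e \<star> Sg X Y Z \<odot> (f \<star> g \<star> h)) \<odot> Al (tdom e) (tdom f) (tdom g \<otimes> tdom h)"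
    by (simp add: Mid_def Al_natural)
  also have "\<dots> = Ali W Y (X \<otimes> Z) \<odot> (e \<star> g \<star> f \<star> h) \<odot> (Idt (tdom e) \<star> Sg (tdom f) (tdom g) (tdom h)) \<odot> Al (tdom e) (tdom f) (tdom g \<otimes> tdom h)"
    by (simp add: Sg_natural)
  also have "\<dots> = ((e \<star> g) \<star> (f \<star> h)) \<odot> Mid (tdom e) (tdom f) (tdom g) (tdom h)"
    unfolding Mid_def by (subst reassoc2[OF Ali_natural]) auto
  finally show ?thesis .
qed

lemma Al_Lui:
  assumes [simp]: "X \<in> Ob V" "Y \<in> Ob V"
  shows "Al \<one> X Y \<odot> (Lui X \<star> Idt Y) = Lui (X \<otimes> Y)"
  by (rule seq_cancel_left[where m = "Lu (X \<otimes> Y)" and m' = "Lui (X \<otimes> Y)"])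
    (auto simp: reassoc[OF Lu_ten])

lemma Ali_Rui:
  assumes [simp]: "X \<in> Ob V" "Y \<in> Ob V"
  shows "Ali X Y \<one> \<odot> (Idt X \<star> Rui Y) = Rui (X \<otimes> Y)"
proof -
  have "Idt X \<star> Rui Y = Al X Y \<one> \<odot> Rui (X \<otimes> Y)"
    by (rule seq_cancel_left[where m = "Idt X \<star> Ru Y" and m' = "Idt X \<star> Rui Y"])
      (auto simp: reassoc[OF Ru_ten])
  then show ?thesis by simp
qed

lemma Mid_unt_second:
  assumes [simp]: "W \<in> Ob V" "Y \<in> Ob V" "Z \<in> Ob V"
  shows "Mid W \<one> Y Z = (Idt (W \<otimes> Y) \<star> Lui Z) \<odot> Ali W Y Z \<odot> (Ru W \<star> Idt (Y \<otimes> Z))"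
proof -
  have "Mid W \<one> Y Z = Ali W Y (\<one> \<otimes> Z) \<odot> (Idt W \<star> Idt Y \<star> Lui Z) \<odot> (Idt W \<star> Lu (Y \<otimes> Z)) \<odot> Al W \<one> (Y \<otimes> Z)"
    by (simp add: Mid_def Sg_unt_left)
  also have "(Idt W \<star> Lu (Y \<otimes> Z)) \<odot> Al W \<one> (Y \<otimes> Z) = Ru W \<star> Idt (Y \<otimes> Z)"
    by (rule Triangle) auto
  also have "Ali W Y (\<one> \<otimes> Z) \<odot> (Idt W \<star> Idt Y \<star> Lui Z) \<odot> \<dots>
      = (Idt (W \<otimes> Y) \<star> Lui Z) \<odot> Ali W Y Z \<odot> (Ru W \<star> Idt (Y \<otimes> Z))"
    by (subst reassoc2[OF Ali_natural]) auto
  finally show ?thesis .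
qed

lemma Mid_unt_third:
  assumes [simp]: "W \<in> Ob V" "X \<in> Ob V" "Z \<in> Ob V"
  shows "Mid W X \<one> Z = (Rui W \<star> Idt (X \<otimes> Z)) \<odot> Al W X Z \<odot> (Idt (W \<otimes> X) \<star> Lu Z)"
proof -
  have "Mid W X \<one> Z = Ali W \<one> (X \<otimes> Z) \<odot> (Idt W \<star> Lui (X \<otimes> Z)) \<odot> (Idt W \<star> Idt X \<star> Lu Z) \<odot> Al W X (\<one> \<otimes> Z)"
    by (simp add: Mid_def Sg_unt_middle)
  also have "(Idt W \<star> Idt X \<star> Lu Z) \<odot> Al W X (\<one> \<otimes> Z) = Al W X Z \<odot> ((Idt W \<star> Idt X) \<star> Lu Z)"
    by (subst Al_natural) auto
  finally show ?thesis by (simp add: reassoc[OF Ali_Lui])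
qed

text \<open>Units enter the interchange when partial functors are composed, through the identities
  that these insert. Units in places two and three serve \<open>D(-,Y')\<close> after
  \<open>D(X,-)\<close>, one and four serve the opposite order, and the two remaining patterns serve
  the functoriality of a single partial functor.\<close>

lemma Mid_unt_second_third:
  assumes [simp]: "X \<in> Ob V" "Y \<in> Ob V"
  shows "Mid X \<one> \<one> Y \<odot> (Rui X \<star> Lui Y) = Rui X \<star> Lui Y"
proof -
  have "(Idt (X \<otimes> \<one>) \<star> Lui Y) \<odot> (Rui X \<star> Idt Y) = Rui X \<star> Lui Y"
    by simp
  then show ?thesis by (simp add: Mid_unt_second Ali_Lui)
qed

lemma Mid_unt_second_fourth:
  assumes [simp]: "X \<in> Ob V" "Y \<in> Ob V"
  shows "Mid X \<one> Y \<one> \<odot> (Rui X \<star> Rui Y) = (Idt (X \<otimes> Y) \<star> Lui \<one>) \<odot> Rui (X \<otimes> Y)"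
  by (simp add: Mid_unt_second Ali_Rui)

lemma Rui_unt: "Rui \<one> = Lui \<one>"
  by (rule seq_cancel_left[where m = "Lu \<one>" and m' = "Lui \<one>"]) (simp_all, simp add: Lu_unt)

lemma Mid_unt_first_third:
  assumes [simp]: "X \<in> Ob V" "Y \<in> Ob V"
  shows "Mid \<one> X \<one> Y \<odot> (Lui X \<star> Lui Y) = (Lui \<one> \<star> Idt (X \<otimes> Y)) \<odot> Lui (X \<otimes> Y)"
  by (simp add: Mid_unt_third Al_Lui Rui_unt)

text \<open>Here the two factors that are not units stand in the middle and do change places, so a
  symmetry survives. It becomes the symmetry in the wedge condition.\<close>

lemma Mid_unt_first_fourth:
  assumes [simp]: "X \<in> Ob V" "Y \<in> Ob V"
  shows "Mid \<one> Y X \<one> \<odot> (Lui Y \<star> Rui X) = (Lui X \<star> Rui Y) \<odot> Sw Y X"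
proof -
  have A: "Sg Y X \<one> \<odot> (Idt Y \<star> Rui X) = (Idt X \<star> Rui Y) \<odot> Sw Y X"
    by (rule seq_cancel_left[where m = "Idt X \<star> Ru Y" and m' = "Idt X \<star> Rui Y"])
      (auto simp: reassoc[OF Sg_unt_right])
  have B: "Ali \<one> X (Y \<otimes> \<one>) \<odot> Lui (X \<otimes> Y \<otimes> \<one>) = Lui X \<star> Idt (Y \<otimes> \<one>)"
    by (simp add: Al_Lui[symmetric])
  have "Mid \<one> Y X \<one> \<odot> (Lui Y \<star> Rui X)
      = Ali \<one> X (Y \<otimes> \<one>) \<odot> (Idt \<one> \<star> Sg Y X \<one>) \<odot> (Al \<one> Y (X \<otimes> \<one>) \<odot> (Lui Y \<star> Idt (X \<otimes> \<one>))) \<odot> (Idt Y \<star> Rui X)"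
    by (simp add: Mid_def)
  also have "\<dots> = Ali \<one> X (Y \<otimes> \<one>) \<odot> (Idt \<one> \<star> Sg Y X \<one>) \<odot> Lui (Y \<otimes> X \<otimes> \<one>) \<odot> (Idt Y \<star> Rui X)"
    by (subst Al_Lui) auto
  also have "\<dots> = Ali \<one> X (Y \<otimes> \<one>) \<odot> Lui (X \<otimes> Y \<otimes> \<one>) \<odot> Sg Y X \<one> \<odot> (Idt Y \<star> Rui X)"
    using Lui_natural[of "Sg Y X \<one>"] by (subst reassoc2) auto
  also have "\<dots> = (Lui X \<star> Idt (Y \<otimes> \<one>)) \<odot> (Idt X \<star> Rui Y) \<odot> Sw Y X"
    by (simp add: reassoc[OF B] A)
  finally show ?thesis by simp
qed

end

section \<open>Enriched categories and functors\<close>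

context symmetric_monoidal_closed
begin

section \<open>Currying and composition of internal homs\<close>

definition Uc :: "'o \<Rightarrow> 'o \<Rightarrow> ('o, 'm) tar \<Rightarrow> ('o, 'm) tar" where
  "Uc X Y a = Ev X Y \<odot> (a \<star> Idt X)"

definition Cu :: "'o \<Rightarrow> 'o \<Rightarrow> 'o \<Rightarrow> ('o, 'm) tar \<Rightarrow> ('o, 'm) tar" where
  "Cu W X Y f = Tar W (curry_ar W X Y (tval f)) (X \<Rrightarrow> Y)"

lemma Uc_simps [simp]:
  "tdom (Uc X Y a) = tdom a \<otimes> X" "tcod (Uc X Y a) = Y"
  "\<lbrakk>arr a; tcod a = X \<Rrightarrow> Y; X \<in> Ob V; Y \<in> Ob V\<rbrakk> \<Longrightarrow> arr (Uc X Y a)"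
  by (auto simp: Uc_def)

lemma Cu_simps [simp]: "tdom (Cu W X Y f) = W" "tcod (Cu W X Y f) = X \<Rrightarrow> Y"
  by (auto simp: Cu_def)

lemma Cu_props:
  assumes "arr f" "tdom f = W \<otimes> X" "tcod f = Y" "W \<in> Ob V" "X \<in> Ob V"
  shows "arr (Cu W X Y f)" "Uc X Y (Cu W X Y f) = f"
proof -
  have "Y \<in> Ob V" "tval f \<in> Hom V (W \<otimes> X) Y" using assms arr_cod[of f] arr_tval[of f] by auto
  have "\<exists>!h. h \<in> Hom V W (X \<Rrightarrow> Y) \<and> evl V X Y \<cdot> (h \<boxtimes> \<iota> X) = tval f"
    by (rule evl_universal) fact+
  then have "curry_ar W X Y (tval f) \<in> Hom V W (X \<Rrightarrow> Y) \<and>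
      evl V X Y \<cdot> (curry_ar W X Y (tval f) \<boxtimes> \<iota> X) = tval f"
    unfolding curry_ar_def by (rule theI')
  then show "arr (Cu W X Y f)" "Uc X Y (Cu W X Y f) = f"
    using assms \<open>Y \<in> Ob V\<close> by (auto intro!: tar_eqI simp: Cu_def arr_Tar Uc_def tval_simps)
qed

lemma arr_Cu [simp]:
  "\<lbrakk>arr f; tdom f = W \<otimes> X; tcod f = Y; W \<in> Ob V; X \<in> Ob V\<rbrakk> \<Longrightarrow> arr (Cu W X Y f)"
  and Uc_Cu [simp]:
  "\<lbrakk>arr f; tdom f = W \<otimes> X; tcod f = Y; W \<in> Ob V; X \<in> Ob V\<rbrakk> \<Longrightarrow> Uc X Y (Cu W X Y f) = f"
  by (simp_all add: Cu_props)

lemma Uc_inject: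
  assumes "Uc X Y a = Uc X Y b" "arr a" "arr b" "tdom a = tdom b" "tcod a = X \<Rrightarrow> Y" "tcod b = X \<Rrightarrow> Y"
    "X \<in> Ob V" "Y \<in> Ob V"
  shows "a = b"
proof -
  have "\<exists>!h. h \<in> Hom V (tdom a) (X \<Rrightarrow> Y) \<and> evl V X Y \<cdot> (h \<boxtimes> \<iota> X) = tval (Uc X Y a)"
    by (rule evl_universal) (use assms in \<open>auto intro: arr_tval\<close>)
  moreover have "tval a \<in> Hom V (tdom a) (X \<Rrightarrow> Y) \<and> evl V X Y \<cdot> (tval a \<boxtimes> \<iota> X) = tval (Uc X Y a)"
    using assms(2-) by (auto intro: arr_tval simp: Uc_def tval_simps)
  moreover have "tval b \<in> Hom V (tdom a) (X \<Rrightarrow> Y) \<and> evl V X Y \<cdot> (tval b \<boxtimes> \<iota> X) = tval (Uc X Y a)"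
    unfolding assms(1) using assms(2-) by (auto intro: arr_tval simp: Uc_def tval_simps)
  ultimately have "tval a = tval b" by blast
  then show ?thesis using assms by (auto intro: tar_eqI)
qed

lemma Uc_seq:
  "\<lbrakk>arr a; arr h; tcod a = X \<Rrightarrow> Y; tdom a = tcod h; X \<in> Ob V; Y \<in> Ob V\<rbrakk>
    \<Longrightarrow> Uc X Y (a \<odot> h) = Uc X Y a \<odot> (h \<star> Idt X)"
  by (simp add: Uc_def)

text \<open>Composition in the self-enrichment. It is kept apart from
  \<open>vcmp (vself_on S)\<close> because its value does not depend on \<open>S\<close>: one arrow
  serves both \<open>VV\<close> and the arities.\<close>

definition Mv :: "'o \<Rightarrow> 'o \<Rightarrow> 'o \<Rightarrow> ('o, 'm) tar" where
  "Mv X Y Z = Cu ((Y \<Rrightarrow> Z) \<otimes> (X \<Rrightarrow> Y)) X Z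
    (Ev Y Z \<odot> (Idt (Y \<Rrightarrow> Z) \<star> Ev X Y) \<odot> Al (Y \<Rrightarrow> Z) (X \<Rrightarrow> Y) X)"

lemma Mv_simps [simp]:
  "tdom (Mv X Y Z) = (Y \<Rrightarrow> Z) \<otimes> (X \<Rrightarrow> Y)" "tcod (Mv X Y Z) = X \<Rrightarrow> Z"
  "\<lbrakk>X \<in> Ob V; Y \<in> Ob V; Z \<in> Ob V\<rbrakk> \<Longrightarrow> arr (Mv X Y Z)"
  by (auto simp: Mv_def)

lemma Uc_Mv_generic:
  "\<lbrakk>X \<in> Ob V; Y \<in> Ob V; Z \<in> Ob V\<rbrakk>
    \<Longrightarrow> Uc X Z (Mv X Y Z) = Ev Y Z \<odot> (Idt (Y \<Rrightarrow> Z) \<star> Ev X Y) \<odot> Al (Y \<Rrightarrow> Z) (X \<Rrightarrow> Y) X"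
  by (simp add: Mv_def)

lemma Uc_Mv:
  assumes [simp]: "X \<in> Ob V" "Y \<in> Ob V" "Z \<in> Ob V" "arr b" "arr a"
    and tc [simp]: "tcod b = Y \<Rrightarrow> Z" "tcod a = X \<Rrightarrow> Y"
  shows "Uc X Z (Mv X Y Z \<odot> (b \<star> a)) = Uc Y Z b \<odot> (Idt (tdom b) \<star> Uc X Y a) \<odot> Al (tdom b) (tdom a) X"
proof -
  have "Uc X Z (Mv X Y Z \<odot> (b \<star> a)) = Uc X Z (Mv X Y Z) \<odot> ((b \<star> a) \<star> Idt X)"
    by (rule Uc_seq) auto
  also have "\<dots> = Ev Y Z \<odot> (b \<star> Uc X Y a) \<odot> Al (tdom b) (tdom a) X"
    unfolding Uc_def[of X Y a] by (simp add: Uc_Mv_generic Al_natural)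
  also have "\<dots> = Uc Y Z b \<odot> (Idt (tdom b) \<star> Uc X Y a) \<odot> Al (tdom b) (tdom a) X"
    by (simp add: Uc_def)
  finally show ?thesis .
qed

definition Elt :: "('o, 'm) tar \<Rightarrow> ('o, 'm) tar" where
  "Elt f = Cu \<one> (tdom f) (tcod f) (f \<odot> Lu (tdom f))"

lemma Elt_simps [simp]:
  "tdom (Elt f) = \<one>" "tcod (Elt f) = tdom f \<Rrightarrow> tcod f" "arr f \<Longrightarrow> arr (Elt f)"
  by (auto simp: Elt_def)

lemma Uc_Elt: "arr f \<Longrightarrow> tdom f = X \<Longrightarrow> tcod f = Y \<Longrightarrow> Uc X Y (Elt f) = f \<odot> Lu X"
  by (auto simp: Elt_def)

lemma Tar_elt: "Tar \<one> (elt X Y f) (X \<Rrightarrow> Y) = Elt (Tar X f Y)"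
  by (simp add: Elt_def Cu_def elt_def tval_simps)

text \<open>Composing with the name of an arrow uncurries to composing with the arrow. Together with
  its counterpart on the other side, this removes names from naturality conditions and from
  \<open>hom_map\<close>.\<close>

lemma Uc_Mv_Elt_left:
  assumes [simp]: "X \<in> Ob V" "Y \<in> Ob V" "Z \<in> Ob V" "arr g" "arr a"
    and tc [simp]: "tdom g = Y" "tcod g = Z" "tcod a = X \<Rrightarrow> Y"
  shows "Uc X Z (Mv X Y Z \<odot> (Elt g \<star> a) \<odot> Lui (tdom a)) = g \<odot> Uc X Y a"
proof -
  have "Uc X Z (Mv X Y Z \<odot> (Elt g \<star> a) \<odot> Lui (tdom a))
      = Uc X Z (Mv X Y Z \<odot> (Elt g \<star> a)) \<odot> (Lui (tdom a) \<star> Idt X)"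
    by (subst Uc_seq[symmetric]) auto
  also have "\<dots> = g \<odot> Lu Y \<odot> (Idt \<one> \<star> Uc X Y a) \<odot> Al \<one> (tdom a) X \<odot> (Lui (tdom a) \<star> Idt X)"
    by (simp add: Uc_Mv Uc_Elt)
  also have "\<dots> = g \<odot> Uc X Y a \<odot> Lu (tdom a \<otimes> X) \<odot> Al \<one> (tdom a) X \<odot> (Lui (tdom a) \<star> Idt X)"
    using Lu_natural[of "Uc X Y a"] by (subst reassoc2) auto
  also have "\<dots> = g \<odot> Uc X Y a"
    by (subst reassoc[OF Lu_ten]) auto
  finally show ?thesis .
qed

lemma Uc_Mv_Elt_right:
  assumes [simp]: "X \<in> Ob V" "Y \<in> Ob V" "Z \<in> Ob V" "arr b" "arr f"
    and tc [simp]: "tdom f = X" "tcod f = Y" "tcod b = Y \<Rrightarrow> Z"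
  shows "Uc X Z (Mv X Y Z \<odot> (b \<star> Elt f) \<odot> Rui (tdom b)) = Uc Y Z b \<odot> (Idt (tdom b) \<star> f)"
proof -
  have "Uc X Z (Mv X Y Z \<odot> (b \<star> Elt f) \<odot> Rui (tdom b))
      = Uc X Z (Mv X Y Z \<odot> (b \<star> Elt f)) \<odot> (Rui (tdom b) \<star> Idt X)"
    by (subst Uc_seq[symmetric]) auto
  also have "\<dots> = Uc Y Z b \<odot> (Idt (tdom b) \<star> f \<odot> Lu X) \<odot> Al (tdom b) \<one> X \<odot> (Rui (tdom b) \<star> Idt X)"
    by (simp add: Uc_Mv Uc_Elt)
  also have "Al (tdom b) \<one> X \<odot> (Rui (tdom b) \<star> Idt X) = Idt (tdom b) \<star> Lui X"
    by (rule Al_Rui_ten) auto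
  finally show ?thesis by simp
qed

section \<open>Enriched categories and functors in typed form\<close>

definition tcmp :: "('a, 'o, 'm) vcat \<Rightarrow> 'a \<Rightarrow> 'a \<Rightarrow> 'a \<Rightarrow> ('o, 'm) tar" where
  "tcmp C X Y Z = Tar (vhom C Y Z \<otimes> vhom C X Y) (vcmp C X Y Z) (vhom C X Z)"

definition tid :: "('a, 'o, 'm) vcat \<Rightarrow> 'a \<Rightarrow> ('o, 'm) tar" where
  "tid C X = Tar \<one> (vid C X) (vhom C X X)"

definition tfh :: "('a, 'o, 'm) vcat \<Rightarrow> ('b, 'o, 'm) vcat \<Rightarrow> ('a, 'b, 'm) vfun \<Rightarrow> 'a \<Rightarrow> 'a \<Rightarrow> ('o, 'm) tar" where
  "tfh C D F X Y = Tar (vhom C X Y) (fhom F X Y) (vhom D (fob F X) (fob F Y))"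

lemma tcmp_simps [simp]:
  "tdom (tcmp C X Y Z) = vhom C Y Z \<otimes> vhom C X Y" "tcod (tcmp C X Y Z) = vhom C X Z"
  "tval (tcmp C X Y Z) = vcmp C X Y Z"
  by (auto simp: tcmp_def)

lemma tid_simps [simp]: "tdom (tid C X) = \<one>" "tcod (tid C X) = vhom C X X" "tval (tid C X) = vid C X"
  by (auto simp: tid_def)

lemma tfh_simps [simp]:
  "tdom (tfh C D F X Y) = vhom C X Y" "tcod (tfh C D F X Y) = vhom D (fob F X) (fob F Y)"
  "tval (tfh C D F X Y) = fhom F X Y"
  by (auto simp: tfh_def)

lemma vcategory_simps [simp]:
  assumes "vcategory C"
  shows "\<lbrakk>X \<in> vob C; Y \<in> vob C\<rbrakk> \<Longrightarrow> vhom C X Y \<in> Ob V"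
    and "\<lbrakk>X \<in> vob C; Y \<in> vob C; Z \<in> vob C\<rbrakk> \<Longrightarrow> arr (tcmp C X Y Z)"
    and "X \<in> vob C \<Longrightarrow> arr (tid C X)"
  using assms unfolding vcategory_def by (auto simp: tcmp_def tid_def arr_Tar)

lemma vcategory_laws:
  assumes "vcategory C"
  shows "\<lbrakk>W \<in> vob C; X \<in> vob C; Y \<in> vob C; Z \<in> vob C\<rbrakk> \<Longrightarrow>
      tcmp C W X Z \<odot> (tcmp C X Y Z \<star> Idt (vhom C W X))
      = tcmp C W Y Z \<odot> (Idt (vhom C Y Z) \<star> tcmp C W X Y) \<odot> Al (vhom C Y Z) (vhom C X Y) (vhom C W X)"
    and "\<lbrakk>X \<in> vob C; Y \<in> vob C\<rbrakk> \<Longrightarrow> tcmp C X Y Y \<odot> (tid C Y \<star> Idt (vhom C X Y)) = Lu (vhom C X Y)"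
    and "\<lbrakk>X \<in> vob C; Y \<in> vob C\<rbrakk> \<Longrightarrow> tcmp C X X Y \<odot> (Idt (vhom C X Y) \<star> tid C X) = Ru (vhom C X Y)"
proof -
  assume X: "W \<in> vob C" "X \<in> vob C" "Y \<in> vob C" "Z \<in> vob C"
  have "tcmp C W X Z \<odot> (tcmp C X Y Z \<star> Idt (vhom C W X))
      = (tcmp C W Y Z \<odot> (Idt (vhom C Y Z) \<star> tcmp C W X Y)) \<odot> Al (vhom C Y Z) (vhom C X Y) (vhom C W X)"
    using assms X unfolding vcategory_def by (intro tar_eqI) (auto simp: tval_simps)
  then show "tcmp C W X Z \<odot> (tcmp C X Y Z \<star> Idt (vhom C W X))
      = tcmp C W Y Z \<odot> (Idt (vhom C Y Z) \<star> tcmp C W X Y) \<odot> Al (vhom C Y Z) (vhom C X Y) (vhom C W X)"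
    using assms X by simp
qed (use assms in \<open>auto simp: vcategory_def tval_simps intro!: tar_eqI\<close>)

text \<open>Associativity on generalised elements \<open>k\<close>, \<open>g\<close>,
  \<open>h\<close>, the form in which composites of several factors are rearranged.\<close>

lemma tcmp_assoc:
  assumes C [simp]: "vcategory C" "W \<in> vob C" "X \<in> vob C" "Y \<in> vob C" "Z \<in> vob C"
    and [simp]: "arr k" "arr g" "arr h"
    and tc [simp]: "tcod k = vhom C Y Z" "tcod g = vhom C X Y" "tcod h = vhom C W X"
  shows "tcmp C W X Z \<odot> (tcmp C X Y Z \<odot> (k \<star> g) \<star> h)
    = tcmp C W Y Z \<odot> (k \<star> tcmp C W X Y \<odot> (g \<star> h)) \<odot> Al (tdom k) (tdom g) (tdom h)"
proof -
  have "tcmp C W X Z \<odot> (tcmp C X Y Z \<odot> (k \<star> g) \<star> h)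
      = tcmp C W X Z \<odot> (tcmp C X Y Z \<star> Idt (vhom C W X)) \<odot> ((k \<star> g) \<star> h)"
    by simp
  also have "\<dots> = (tcmp C W Y Z \<odot> (Idt (vhom C Y Z) \<star> tcmp C W X Y) \<odot> Al (vhom C Y Z) (vhom C X Y) (vhom C W X)) \<odot> ((k \<star> g) \<star> h)"
    by (subst reassoc[OF vcategory_laws(1)]) auto
  also have "\<dots> = tcmp C W Y Z \<odot> (k \<star> tcmp C W X Y \<odot> (g \<star> h)) \<odot> Al (tdom k) (tdom g) (tdom h)"
    by (simp add: Al_natural)
  finally show ?thesis .
qed

lemma tcmp_assoc':
  assumes C [simp]: "vcategory C" "W \<in> vob C" "X \<in> vob C" "Y \<in> vob C" "Z \<in> vob C"
    and [simp]: "arr k" "arr g" "arr h"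
    and tc [simp]: "tcod k = vhom C Y Z" "tcod g = vhom C X Y" "tcod h = vhom C W X"
  shows "tcmp C W Y Z \<odot> (k \<star> tcmp C W X Y \<odot> (g \<star> h))
    = tcmp C W X Z \<odot> (tcmp C X Y Z \<odot> (k \<star> g) \<star> h) \<odot> Ali (tdom k) (tdom g) (tdom h)"
  using tcmp_assoc[OF assms, THEN arg_cong, of "\<lambda>a. a \<odot> Ali (tdom k) (tdom g) (tdom h)"]
  by simp

lemma tcmp_tid_left:
  assumes [simp]: "vcategory C" "X \<in> vob C" "Y \<in> vob C" "arr h" and tc [simp]: "tcod h = vhom C X Y"
  shows "tcmp C X Y Y \<odot> (tid C Y \<star> h) = h \<odot> Lu (tdom h)"
proof -
  have "tcmp C X Y Y \<odot> (tid C Y \<star> h) = tcmp C X Y Y \<odot> (tid C Y \<star> Idt (vhom C X Y)) \<odot> (Idt \<one> \<star> h)"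
    by simp
  also have "\<dots> = h \<odot> Lu (tdom h)"
    by (subst reassoc[OF vcategory_laws(2)]) (auto simp: Lu_natural)
  finally show ?thesis .
qed

lemma tcmp_tid_right:
  assumes [simp]: "vcategory C" "X \<in> vob C" "Y \<in> vob C" "arr h" and tc [simp]: "tcod h = vhom C X Y"
  shows "tcmp C X X Y \<odot> (h \<star> tid C X) = h \<odot> Ru (tdom h)"
proof -
  have "tcmp C X X Y \<odot> (h \<star> tid C X) = tcmp C X X Y \<odot> (Idt (vhom C X Y) \<star> tid C X) \<odot> (h \<star> Idt \<one>)"
    by simp
  also have "\<dots> = h \<odot> Ru (tdom h)"
    by (subst reassoc[OF vcategory_laws(3)]) (auto simp: Ru_natural)
  finally show ?thesis .
qed

lemma vself_on_simps [simp]: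
  "vob (vself_on S) = S" "vhom (vself_on S) X Y = (X \<Rrightarrow> Y)"
  by (simp_all add: vself_on_def)

lemma tid_vself_on: "X \<in> Ob V \<Longrightarrow> tid (vself_on S) X = Elt (Idt X)"
  by (auto simp: tid_def Tar_elt Idt_def vself_on_def)

lemma tcmp_vself_on:
  assumes [simp]: "X \<in> Ob V" "Y \<in> Ob V" "Z \<in> Ob V"
  shows "tcmp (vself_on S) X Y Z = Mv X Y Z"
proof -
  have "Mv X Y Z = Cu ((Y \<Rrightarrow> Z) \<otimes> (X \<Rrightarrow> Y)) X Z
      ((Ev Y Z \<odot> (Idt (Y \<Rrightarrow> Z) \<star> Ev X Y)) \<odot> Al (Y \<Rrightarrow> Z) (X \<Rrightarrow> Y) X)"
    by (simp add: Mv_def)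
  then show ?thesis
    by (simp only: tcmp_def Cu_def vself_on_def vcat.simps tval_simps)
qed

lemma vfunctor_vcategory:
  assumes "vfunctor C D F"
  shows "vcategory C" "vcategory D"
  using assms by (simp_all add: vfunctor_def)

lemma vfunctor_fob: "vfunctor C D F \<Longrightarrow> X \<in> vob C \<Longrightarrow> fob F X \<in> vob D"
  by (auto simp: vfunctor_def)

lemma vfunctor_arr:
  assumes "vfunctor C D F" "X \<in> vob C" "Y \<in> vob C"
  shows "arr (tfh C D F X Y)"
proof -
  have "vcategory C" "vcategory D" "fob F X \<in> vob D" "fob F Y \<in> vob D"
    using assms(2,3) vfunctor_vcategory[OF assms(1)] vfunctor_fob[OF assms(1)] by auto
  then show ?thesis
    using assms(2,3) by (simp add: tfh_def arr_Tar) (use assms(1) in \<open>simp add: vfunctor_def\<close>)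
qed

lemmas vfunctor_simps = vfunctor_vcategory vfunctor_fob vfunctor_arr

lemma vfunctor_tid:
  "vfunctor C D F \<Longrightarrow> X \<in> vob C \<Longrightarrow> tfh C D F X X \<odot> tid C X = tid D (fob F X)"
  by (auto intro!: tar_eqI simp: tval_simps vfunctor_def)

lemma vfunctor_tcmp:
  "\<lbrakk>vfunctor C D F; X \<in> vob C; Y \<in> vob C; Z \<in> vob C\<rbrakk>
    \<Longrightarrow> tfh C D F X Z \<odot> tcmp C X Y Z
      = tcmp D (fob F X) (fob F Y) (fob F Z) \<odot> (tfh C D F Y Z \<star> tfh C D F X Y)"
  by (auto intro!: tar_eqI simp: tval_simps vfunctor_def)

lemma vfunctorI:
  assumes "vcategory C" "vcategory D" "\<And>X. X \<in> vob C \<Longrightarrow> fob F X \<in> vob D"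
    and "fob F \<in> extensional (vob C)" "case_prod (fhom F) \<in> extensional (vob C \<times> vob C)"
    and "\<And>X Y. \<lbrakk>X \<in> vob C; Y \<in> vob C\<rbrakk> \<Longrightarrow> arr (tfh C D F X Y)"
    and "\<And>X. X \<in> vob C \<Longrightarrow> tfh C D F X X \<odot> tid C X = tid D (fob F X)"
    and "\<And>X Y Z. \<lbrakk>X \<in> vob C; Y \<in> vob C; Z \<in> vob C\<rbrakk> \<Longrightarrow> tfh C D F X Z \<odot> tcmp C X Y Z
      = tcmp D (fob F X) (fob F Y) (fob F Z) \<odot> (tfh C D F Y Z \<star> tfh C D F X Y)"
  shows "vfunctor C D F"
proof -
  have "fhom F X Y \<in> Hom V (vhom C X Y) (vhom D (fob F X) (fob F Y))" if "X \<in> vob C" "Y \<in> vob C" for X Y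
    using assms(6)[OF that] by (simp add: tfh_def arr_Tar)
  moreover have "fhom F X X \<cdot> vid C X = vid D (fob F X)" if "X \<in> vob C" for X
    using assms(7)[OF that, THEN arg_cong, of tval] by (simp add: tval_simps)
  moreover have "fhom F X Z \<cdot> vcmp C X Y Z
      = vcmp D (fob F X) (fob F Y) (fob F Z) \<cdot> (fhom F Y Z \<boxtimes> fhom F X Y)"
    if "X \<in> vob C" "Y \<in> vob C" "Z \<in> vob C" for X Y Z
    using assms(8)[OF that, THEN arg_cong, of tval] by (simp add: tval_simps)
  ultimately show ?thesis using assms(1-5) by (auto simp: vfunctor_def PiE_def)
qed

lemma mk_vfun_simps:
  "X \<in> S \<Longrightarrow> fob (mk_vfun S f h) X = f X"
  "X \<in> S \<Longrightarrow> Y \<in> S \<Longrightarrow> fhom (mk_vfun S f h) X Y = h X Y"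
  "fob (mk_vfun S f h) \<in> extensional S"
  "case_prod (fhom (mk_vfun S f h)) \<in> extensional (S \<times> S)"
  by (auto simp: mk_vfun_def extensional_def)

lemma vfun_eqI:
  fixes F G :: "('a, 'b, 'm) vfun"
  assumes "fob F \<in> extensional S" "fob G \<in> extensional S"
    "case_prod (fhom F) \<in> extensional (S \<times> S)" "case_prod (fhom G) \<in> extensional (S \<times> S)"
    "\<And>X. X \<in> S \<Longrightarrow> fob F X = fob G X"
    "\<And>X Y. X \<in> S \<Longrightarrow> Y \<in> S \<Longrightarrow> fhom F X Y = fhom G X Y"
  shows "F = G"
proof -
  have "fob F = fob G" using assms by (meson extensionalityI)
  moreover have "case_prod (fhom F) = case_prod (fhom G)"
    using assms by (intro extensionalityI[where A = "S \<times> S"]) auto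
  then have "fhom F = fhom G" by (simp add: fun_eq_iff)
  ultimately show ?thesis by (cases F; cases G) simp
qed

lemma vfunctor_ext:
  "vfunctor C D F \<Longrightarrow> fob F \<in> extensional (vob C)"
  "vfunctor C D F \<Longrightarrow> case_prod (fhom F) \<in> extensional (vob C \<times> vob C)"
  by (auto simp: vfunctor_def PiE_def)

lemma vfun_cmp_simps:
  "X \<in> S \<Longrightarrow> fob (vfun_cmp S G F) X = fob G (fob F X)"
  "\<lbrakk>X \<in> S; Y \<in> S\<rbrakk> \<Longrightarrow> fhom (vfun_cmp S G F) X Y = fhom G (fob F X) (fob F Y) \<cdot> fhom F X Y"
  "fob (vfun_cmp S G F) \<in> extensional S"
  "case_prod (fhom (vfun_cmp S G F)) \<in> extensional (S \<times> S)"
  by (simp_all add: vfun_cmp_def mk_vfun_simps)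

text \<open>The raw composite forgets the intermediate hom-object, so \<open>D\<close> occurs on the
  right only and is supplied where the equation is used.\<close>

lemma tfh_vfun_cmp:
  "\<lbrakk>X \<in> S; Y \<in> S\<rbrakk> \<Longrightarrow> tfh C E (vfun_cmp S G F) X Y = tfh D E G (fob F X) (fob F Y) \<odot> tfh C D F X Y"
  by (auto intro!: tar_eqI simp: tval_simps vfun_cmp_simps)

lemma vfunctor_cmp:
  assumes F: "vfunctor C D F" and G: "vfunctor D E G" and S: "S = vob C"
  shows "vfunctor C E (vfun_cmp S G F)"
proof -
  note [simp] = vfunctor_simps[OF G] vfunctor_simps[OF F] vfun_cmp_simps(1)
  show ?thesis unfolding S
  proof (rule vfunctorI)
    fix X assume X: "X \<in> vob C"
    show "tfh C E (vfun_cmp (vob C) G F) X X \<odot> tid C X = tid E (fob (vfun_cmp (vob C) G F) X)"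
      using X by (simp add: tfh_vfun_cmp[where D = D] vfunctor_tid[OF F] vfunctor_tid[OF G])
  next
    fix X Y Z assume X [simp]: "X \<in> vob C" "Y \<in> vob C" "Z \<in> vob C"
    have "tfh C E (vfun_cmp (vob C) G F) X Z \<odot> tcmp C X Y Z
        = tfh D E G (fob F X) (fob F Z) \<odot> tcmp D (fob F X) (fob F Y) (fob F Z) \<odot> (tfh C D F Y Z \<star> tfh C D F X Y)"
      by (simp add: tfh_vfun_cmp[where D = D] vfunctor_tcmp[OF F])
    also have "\<dots> = tcmp E (fob G (fob F X)) (fob G (fob F Y)) (fob G (fob F Z)) \<odot>
        (tfh C E (vfun_cmp (vob C) G F) Y Z \<star> tfh C E (vfun_cmp (vob C) G F) X Y)"
      by (subst reassoc[OF vfunctor_tcmp[OF G]]) (simp_all add: tfh_vfun_cmp[where D = D])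
    finally show "tfh C E (vfun_cmp (vob C) G F) X Z \<odot> tcmp C X Y Z
      = tcmp E (fob (vfun_cmp (vob C) G F) X) (fob (vfun_cmp (vob C) G F) Y) (fob (vfun_cmp (vob C) G F) Z) \<odot>
        (tfh C E (vfun_cmp (vob C) G F) Y Z \<star> tfh C E (vfun_cmp (vob C) G F) X Y)"
      by simp
  qed (auto simp: vfun_cmp_simps tfh_vfun_cmp[where D = D])
qed

lemma vfun_cmp_assoc:
  assumes "vfunctor B C F" "vfunctor C D G" "vfunctor D E H" "S = vob B" "S' = vob C"
  shows "vfun_cmp S (vfun_cmp S' H G) F = vfun_cmp S H (vfun_cmp S G F)"
proof (rule vfun_eqI)
  fix X Y assume X: "X \<in> S" "Y \<in> S"
  let ?F = "tfh B C F X Y" and ?G = "tfh C D G (fob F X) (fob F Y)"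
    and ?H = "tfh D E H (fob G (fob F X)) (fob G (fob F Y))"
  have "arr ?F" "arr ?G" "arr ?H"
    using X assms(4,5) vfunctor_fob[OF assms(1)] vfunctor_fob[OF assms(2)] vfunctor_arr[OF assms(1)]
      vfunctor_arr[OF assms(2)] vfunctor_arr[OF assms(3)] by auto
  then have "tval ((?H \<odot> ?G) \<odot> ?F) = tval (?H \<odot> ?G \<odot> ?F)" by simp
  then show "fhom (vfun_cmp S (vfun_cmp S' H G) F) X Y = fhom (vfun_cmp S H (vfun_cmp S G F)) X Y"
    using X assms vfunctor_fob[OF assms(1)] by (simp add: vfun_cmp_simps tval_simps)
qed (use assms vfunctor_fob[OF assms(1)] in \<open>auto simp: vfun_cmp_simps\<close>)

lemma vfun_id_simps:
  "X \<in> vob C \<Longrightarrow> fob (vfun_id C) X = X"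
  "fob (vfun_id C) \<in> extensional (vob C)"
  "case_prod (fhom (vfun_id C)) \<in> extensional (vob C \<times> vob C)"
  by (simp_all add: vfun_id_def mk_vfun_simps)

lemma tfh_vfun_id: "X \<in> vob C \<Longrightarrow> Y \<in> vob C \<Longrightarrow> tfh C C (vfun_id C) X Y = Idt (vhom C X Y)"
  by (auto intro!: tar_eqI simp: tval_simps vfun_id_def mk_vfun_simps)

lemma vfunctor_id: "vcategory C \<Longrightarrow> vfunctor C C (vfun_id C)"
  by (rule vfunctorI) (simp_all add: tfh_vfun_id vfun_id_simps)

lemma vfun_id_cmp:
  assumes F: "vfunctor C D F"
  shows "vfun_cmp (vob C) (vfun_id D) F = F"
proof (rule vfun_eqI)
  fix X Y assume X [simp]: "X \<in> vob C" "Y \<in> vob C"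
  note [simp] = vfunctor_simps[OF F]
  have "tfh C D (vfun_cmp (vob C) (vfun_id D) F) X Y = tfh C D F X Y"
    by (simp add: tfh_vfun_cmp[where D = D] tfh_vfun_id)
  then show "fhom (vfun_cmp (vob C) (vfun_id D) F) X Y = fhom F X Y"
    by (metis tfh_simps(3))
qed (use vfunctor_fob[OF F] vfunctor_ext[OF F] in \<open>auto simp: vfun_cmp_simps vfun_id_def mk_vfun_simps\<close>)

lemma vfun_cmp_id:
  assumes F: "vfunctor C D F"
  shows "vfun_cmp (vob C) F (vfun_id C) = F"
proof (rule vfun_eqI)
  fix X Y assume X [simp]: "X \<in> vob C" "Y \<in> vob C"
  note [simp] = vfunctor_simps[OF F]
  have "tfh C D (vfun_cmp (vob C) F (vfun_id C)) X Y = tfh C D F X Y"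
    using tfh_vfun_cmp[of X "vob C" Y C D F "vfun_id C" C]
    by (simp add: tfh_vfun_id) (simp add: vfun_id_def mk_vfun_simps)
  then show "fhom (vfun_cmp (vob C) F (vfun_id C)) X Y = fhom F X Y"
    by (metis tfh_simps(3))
qed (use vfunctor_ext[OF F] in \<open>auto simp: vfun_cmp_simps vfun_id_def mk_vfun_simps\<close>)

section \<open>Functors into the base category as actions\<close>

text \<open>The covariant action \<open>C(X,Y) \<otimes> F X \<rightarrow> F Y\<close> of a functor
  into \<open>VV\<close>, in terms of which naturality is an ordinary square and a representable
  acts by composition.\<close>

definition act :: "('a, 'o, 'm) vcat \<Rightarrow> ('a, 'o, 'm) vfun \<Rightarrow> 'a \<Rightarrow> 'a \<Rightarrow> ('o, 'm) tar" where
  "act C F X Y = Uc (fob F X) (fob F Y) (tfh C VV F X Y)"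

lemma act_simps [simp]:
  "tdom (act C F X Y) = vhom C X Y \<otimes> fob F X" "tcod (act C F X Y) = fob F Y"
  by (auto simp: act_def)

lemma arr_act: "vfunctor C VV F \<Longrightarrow> X \<in> vob C \<Longrightarrow> Y \<in> vob C \<Longrightarrow> arr (act C F X Y)"
  using vfunctor_fob[of C VV F] vfunctor_arr[of C VV F] by (auto simp: act_def)

lemma vfunctor_Ob: "vfunctor C VV F \<Longrightarrow> X \<in> vob C \<Longrightarrow> fob F X \<in> Ob V"
  using vfunctor_fob[of C VV F] by simp

lemmas V_functor_simps = vfunctor_vcategory vfunctor_Ob vfunctor_arr arr_act

text \<open>Each side of the square in \<open>vnat\<close> is an arrow into an internal hom.
  Uncurrying is injective and strips the names \<open>elt\<close>, which leaves the square of
  actions.\<close>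

lemma vnat_V_iff:
  assumes F: "vfunctor C VV F" and G: "vfunctor C VV G"
  shows "t \<in> vnat_V C F G \<longleftrightarrow> t \<in> extensional (vob C) \<and>
    (\<forall>X\<in>vob C. arr (Tar (fob F X) (t X) (fob G X))) \<and>
    (\<forall>X\<in>vob C. \<forall>Y\<in>vob C. Tar (fob F Y) (t Y) (fob G Y) \<odot> act C F X Y
      = act C G X Y \<odot> (Idt (vhom C X Y) \<star> Tar (fob F X) (t X) (fob G X)))"
    (is "_ \<longleftrightarrow> _ \<and> ?arr \<and> ?nat")
proof -
  note [simp] = V_functor_simps[OF G] V_functor_simps[OF F]
  let ?t = "\<lambda>X. Tar (fob F X) (t X) (fob G X)"
  have arr: "?arr \<longleftrightarrow> (\<forall>X\<in>vob C. t X \<in> Hom V (fob F X) (fob G X))"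
    by (simp add: arr_Tar)
  have nat: "vnat C VV F G (\<lambda>X. elt (fob F X) (fob G X) (t X)) \<longleftrightarrow> ?nat" if ?arr
  proof -
    have [simp]: "arr (?t X)" if "X \<in> vob C" for X using \<open>?arr\<close> that by blast
    have 1: "elt (fob F X) (fob G X) (t X) \<in> Hom V \<one> (fob F X \<Rrightarrow> fob G X)" if "X \<in> vob C" for X
    proof -
      have "arr (Elt (?t X))" using that by simp
      then show ?thesis by (simp only: Tar_elt[symmetric] arr_Tar)
    qed
    have 2: "(vcmp VV (fob F X) (fob F Y) (fob G Y) \<cdot> (elt (fob F Y) (fob G Y) (t Y) \<boxtimes> fhom F X Y) \<cdot> lun_inv (vhom C X Y)
      = vcmp VV (fob F X) (fob G X) (fob G Y) \<cdot> (fhom G X Y \<boxtimes> elt (fob F X) (fob G X) (t X)) \<cdot> run_inv (vhom C X Y))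
      \<longleftrightarrow> ?t Y \<odot> act C F X Y = act C G X Y \<odot> (Idt (vhom C X Y) \<star> ?t X)" (is "?l = ?r \<longleftrightarrow> _")
      if X [simp]: "X \<in> vob C" "Y \<in> vob C" for X Y
    proof -
      let ?L = "Mv (fob F X) (fob F Y) (fob G Y) \<odot> (Elt (?t Y) \<star> tfh C VV F X Y) \<odot> Lui (vhom C X Y)"
        and ?R = "Mv (fob F X) (fob G X) (fob G Y) \<odot> (tfh C VV G X Y \<star> Elt (?t X)) \<odot> Rui (vhom C X Y)"
      have "?L = (tcmp VV (fob F X) (fob F Y) (fob G Y) \<odot> (Tar \<one> (elt (fob F Y) (fob G Y) (t Y)) (fob F Y \<Rrightarrow> fob G Y) \<star> tfh C VV F X Y)) \<odot> Lui (vhom C X Y)"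
        by (simp add: tcmp_vself_on Tar_elt)
      then have L: "tval ?L = ?l" by (simp only: tval_simps tcmp_simps tfh_simps tar.sel)
      have "?R = (tcmp VV (fob F X) (fob G X) (fob G Y) \<odot> (tfh C VV G X Y \<star> Tar \<one> (elt (fob F X) (fob G X) (t X)) (fob F X \<Rrightarrow> fob G X))) \<odot> Rui (vhom C X Y)"
        by (simp add: tcmp_vself_on Tar_elt)
      then have R: "tval ?R = ?r" by (simp only: tval_simps tcmp_simps tfh_simps tar.sel)
      have "?l = ?r \<longleftrightarrow> ?L = ?R"
        unfolding L[symmetric] R[symmetric] by (auto intro: tar_eqI)
      also have "\<dots> \<longleftrightarrow> Uc (fob F X) (fob G Y) ?L = Uc (fob F X) (fob G Y) ?R"
      proof
        assume "Uc (fob F X) (fob G Y) ?L = Uc (fob F X) (fob G Y) ?R"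
        then show "?L = ?R" by (rule Uc_inject) auto
      qed simp
      also have "Uc (fob F X) (fob G Y) ?L = ?t Y \<odot> act C F X Y"
        unfolding act_def using Uc_Mv_Elt_left[of "fob F X" "fob F Y" "fob G Y" "?t Y" "tfh C VV F X Y"] by simp
      also have "Uc (fob F X) (fob G Y) ?R = act C G X Y \<odot> (Idt (vhom C X Y) \<star> ?t X)"
        unfolding act_def using Uc_Mv_Elt_right[of "fob F X" "fob G X" "fob G Y" "tfh C VV G X Y" "?t X"] by simp
      finally show ?thesis .
    qed
    show ?thesis using 1 2 by (simp add: vnat_def)
  qed
  show ?thesis using arr nat by (auto simp: vnat_V_def)
qed

end

section \<open>Functors of two variables\<close>

context symmetric_monoidal_closed
begin

lemma vtensor_simps [simp]:
  "vob (vtensor C D) = vob C \<times> vob D"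
  "vhom (vtensor C D) (X, Y) (X', Y') = vhom C X X' \<otimes> vhom D Y Y'"
  by (simp_all add: vtensor_def)

lemma tid_vtensor:
  "tid (vtensor C D) (X, Y) = (tid C X \<star> tid D Y) \<odot> Lui \<one>"
  by (rule tar_eqI) (auto simp: tval_simps, simp add: vtensor_def)

lemma tcmp_vtensor:
  assumes "vcategory C" "vcategory D" "X \<in> vob C" "X' \<in> vob C" "X'' \<in> vob C"
    "Y \<in> vob D" "Y' \<in> vob D" "Y'' \<in> vob D"
  shows "tcmp (vtensor C D) (X, Y) (X', Y') (X'', Y'')
    = (tcmp C X X' X'' \<star> tcmp D Y Y' Y'') \<odot> Mid (vhom C X' X'') (vhom D Y' Y'') (vhom C X X') (vhom D Y Y')"
proof -
  have "Tar ((vhom C X' X'' \<otimes> vhom D Y' Y'') \<otimes> (vhom C X X' \<otimes> vhom D Y Y'))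
      (mid4 (vhom C X' X'') (vhom D Y' Y'') (vhom C X X') (vhom D Y Y'))
      ((vhom C X' X'' \<otimes> vhom C X X') \<otimes> (vhom D Y' Y'' \<otimes> vhom D Y Y'))
      = Mid (vhom C X' X'') (vhom D Y' Y'') (vhom C X X') (vhom D Y Y')"
    using assms by (intro Tar_mid4) auto
  then have "tval (Mid (vhom C X' X'') (vhom D Y' Y'') (vhom C X X') (vhom D Y Y'))
      = mid4 (vhom C X' X'') (vhom D Y' Y'') (vhom C X X') (vhom D Y Y')"
    by (metis tar.sel(2))
  then show ?thesis
    by (intro tar_eqI) (auto simp: tval_simps, simp add: vtensor_def)
qed

end

text \<open>The factors are assumed to be enriched categories separately, since functoriality of
  \<open>D\<close> says this of their tensor product only.\<close>

locale vbifunctor = symmetric_monoidal_closed V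
  for V :: "('o, 'm) smc" (structure) +
  fixes C :: "('a, 'o, 'm) vcat" and E :: "('b, 'o, 'm) vcat" and B :: "('c, 'o, 'm) vcat"
    and D :: "('a \<times> 'b, 'c, 'm) vfun"
  assumes C [simp]: "vcategory C" and E [simp]: "vcategory E" and D: "vfunctor (vtensor C E) B D"
begin

abbreviation dd :: "'a \<Rightarrow> 'b \<Rightarrow> 'a \<Rightarrow> 'b \<Rightarrow> ('o, 'm) tar" where
  "dd X Y X' Y' \<equiv> tfh (vtensor C E) B D (X, Y) (X', Y')"

abbreviation rr :: "'b \<Rightarrow> 'a \<Rightarrow> 'a \<Rightarrow> ('o, 'm) tar" where
  "rr Y X X' \<equiv> tfh C B (fix_right C E D Y) X X'"

abbreviation ll :: "'a \<Rightarrow> 'b \<Rightarrow> 'b \<Rightarrow> ('o, 'm) tar" where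
  "ll X Y Y' \<equiv> tfh E B (fix_left C E D X) Y Y'"

lemma B [simp]: "vcategory B"
  using D by (rule vfunctor_vcategory)

lemma D_in [simp]: "\<lbrakk>X \<in> vob C; Y \<in> vob E\<rbrakk> \<Longrightarrow> fob D (X, Y) \<in> vob B"
  using vfunctor_fob[OF D] by simp

lemma arr_dd [simp]:
  "\<lbrakk>X \<in> vob C; Y \<in> vob E; X' \<in> vob C; Y' \<in> vob E\<rbrakk> \<Longrightarrow> arr (dd X Y X' Y')"
  using vfunctor_arr[OF D] by simp

lemma fix_simps [simp]:
  "X \<in> vob C \<Longrightarrow> fob (fix_right C E D Y) X = fob D (X, Y)"
  "Y \<in> vob E \<Longrightarrow> fob (fix_left C E D X) Y = fob D (X, Y)"
  by (simp_all add: fix_right_def fix_left_def mk_vfun_simps)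

lemma rr_eq:
  assumes [simp]: "X \<in> vob C" "Y \<in> vob E" "X' \<in> vob C"
  shows "rr Y X X' = dd X Y X' Y \<odot> (Idt (vhom C X X') \<star> tid E Y) \<odot> Rui (vhom C X X')"
proof -
  have "tval (rr Y X X') = tval ((dd X Y X' Y \<odot> (Idt (vhom C X X') \<star> tid E Y)) \<odot> Rui (vhom C X X'))"
    by (simp add: fix_right_def mk_vfun_simps tval_simps del: seq_assoc)
  then show ?thesis by (intro tar_eqI) auto
qed

lemma ll_eq:
  assumes [simp]: "X \<in> vob C" "Y \<in> vob E" "Y' \<in> vob E"
  shows "ll X Y Y' = dd X Y X Y' \<odot> (tid C X \<star> Idt (vhom E Y Y')) \<odot> Lui (vhom E Y Y')"
proof -
  have "tval (ll X Y Y') = tval ((dd X Y X Y' \<odot> (tid C X \<star> Idt (vhom E Y Y'))) \<odot> Lui (vhom E Y Y'))"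
    by (simp add: fix_left_def mk_vfun_simps tval_simps del: seq_assoc)
  then show ?thesis by (intro tar_eqI) auto
qed

lemma arr_rr [simp]: "\<lbrakk>X \<in> vob C; Y \<in> vob E; X' \<in> vob C\<rbrakk> \<Longrightarrow> arr (rr Y X X')"
  by (simp add: rr_eq)

lemma arr_ll [simp]: "\<lbrakk>X \<in> vob C; Y \<in> vob E; Y' \<in> vob E\<rbrakk> \<Longrightarrow> arr (ll X Y Y')"
  by (simp add: ll_eq)

lemma dd_tid:
  assumes [simp]: "X \<in> vob C" "Y \<in> vob E"
  shows "dd X Y X Y \<odot> (tid C X \<star> tid E Y) \<odot> Lui \<one> = tid B (fob D (X, Y))"
  using vfunctor_tid[OF D, of "(X, Y)"] by (simp add: tid_vtensor)

text \<open>Functoriality of \<open>D\<close> on tensor pairs of generalised elements, obtained by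
  moving the pairs through \<open>Mid\<close>. Putting identities for some of the four arrows yields
  the laws of the partial functors.\<close>

lemma dd_tcmp:
  assumes [simp]: "X \<in> vob C" "X' \<in> vob C" "X'' \<in> vob C" "Y \<in> vob E" "Y' \<in> vob E" "Y'' \<in> vob E"
    and [simp]: "arr a" "arr b" "arr a'" "arr b'"
    and tc [simp]: "tcod a = vhom C X' X''" "tcod b = vhom E Y' Y''" "tcod a' = vhom C X X'" "tcod b' = vhom E Y Y'"
  shows "tcmp B (fob D (X, Y)) (fob D (X', Y')) (fob D (X'', Y''))
      \<odot> (dd X' Y' X'' Y'' \<odot> (a \<star> b) \<star> dd X Y X' Y' \<odot> (a' \<star> b'))
    = dd X Y X'' Y'' \<odot> (tcmp C X X' X'' \<odot> (a \<star> a') \<star> tcmp E Y Y' Y'' \<odot> (b \<star> b'))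
      \<odot> Mid (tdom a) (tdom b) (tdom a') (tdom b')"
proof -
  have "tcmp B (fob D (X, Y)) (fob D (X', Y')) (fob D (X'', Y''))
      \<odot> (dd X' Y' X'' Y'' \<odot> (a \<star> b) \<star> dd X Y X' Y' \<odot> (a' \<star> b'))
    = (tcmp B (fob D (X, Y)) (fob D (X', Y')) (fob D (X'', Y'')) \<odot> (dd X' Y' X'' Y'' \<star> dd X Y X' Y'))
      \<odot> ((a \<star> b) \<star> (a' \<star> b'))"
    by simp
  also have "\<dots> = (dd X Y X'' Y'' \<odot> tcmp (vtensor C E) (X, Y) (X', Y') (X'', Y'')) \<odot> ((a \<star> b) \<star> (a' \<star> b'))"
    using vfunctor_tcmp[OF D, of "(X, Y)" "(X', Y')" "(X'', Y'')"] by simp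
  also have "\<dots> = dd X Y X'' Y'' \<odot> (tcmp C X X' X'' \<star> tcmp E Y Y' Y'')
      \<odot> Mid (vhom C X' X'') (vhom E Y' Y'') (vhom C X X') (vhom E Y Y') \<odot> ((a \<star> b) \<star> (a' \<star> b'))"
    by (simp add: tcmp_vtensor)
  also have "\<dots> = dd X Y X'' Y'' \<odot> (tcmp C X X' X'' \<odot> (a \<star> a') \<star> tcmp E Y Y' Y'' \<odot> (b \<star> b'))
      \<odot> Mid (tdom a) (tdom b) (tdom a') (tdom b')"
    by (simp add: Mid_natural)
  finally show ?thesis .
qed

text \<open>The inserted identities make one composition in each variable trivial, so
  \<open>D\<close> is recovered from its partial functors. The opposite order in
  \<open>ll_rr\<close> gives the same arrow up to the symmetry, and this agreement makes the family
  \<open>ll\<close> a wedge.\<close>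

lemma rr_ll:
  assumes [simp]: "X \<in> vob C" "X' \<in> vob C" "Y \<in> vob E" "Y' \<in> vob E"
  shows "tcmp B (fob D (X, Y)) (fob D (X, Y')) (fob D (X', Y')) \<odot> (rr Y' X X' \<star> ll X Y Y') = dd X Y X' Y'"
proof -
  let ?h = "vhom C X X'" and ?k = "vhom E Y Y'"
  have "tcmp B (fob D (X, Y)) (fob D (X, Y')) (fob D (X', Y')) \<odot> (rr Y' X X' \<star> ll X Y Y')
     = (tcmp B (fob D (X, Y)) (fob D (X, Y')) (fob D (X', Y'))
        \<odot> (dd X Y' X' Y' \<odot> (Idt ?h \<star> tid E Y') \<star> dd X Y X Y' \<odot> (tid C X \<star> Idt ?k))) \<odot> (Rui ?h \<star> Lui ?k)"
    by (simp add: rr_eq ll_eq)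
  also have "\<dots> = dd X Y X' Y' \<odot> (Ru ?h \<star> Lu ?k) \<odot> Mid ?h \<one> \<one> ?k \<odot> (Rui ?h \<star> Lui ?k)"
    by (subst dd_tcmp) (auto simp: tcmp_tid_left tcmp_tid_right)
  also have "\<dots> = dd X Y X' Y'"
    by (simp add: Mid_unt_second_third)
  finally show ?thesis .
qed

lemma ll_rr:
  assumes [simp]: "X \<in> vob C" "X' \<in> vob C" "Y \<in> vob E" "Y' \<in> vob E"
  shows "tcmp B (fob D (X, Y)) (fob D (X', Y)) (fob D (X', Y')) \<odot> (ll X' Y Y' \<star> rr Y X X')
    = dd X Y X' Y' \<odot> Sw (vhom E Y Y') (vhom C X X')"
proof -
  let ?h = "vhom C X X'" and ?k = "vhom E Y Y'"
  have "tcmp B (fob D (X, Y)) (fob D (X', Y)) (fob D (X', Y')) \<odot> (ll X' Y Y' \<star> rr Y X X')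
     = (tcmp B (fob D (X, Y)) (fob D (X', Y)) (fob D (X', Y'))
        \<odot> (dd X' Y X' Y' \<odot> (tid C X' \<star> Idt ?k) \<star> dd X Y X' Y \<odot> (Idt ?h \<star> tid E Y))) \<odot> (Lui ?k \<star> Rui ?h)"
    by (simp add: rr_eq ll_eq)
  also have "\<dots> = dd X Y X' Y' \<odot> (Lu ?h \<star> Ru ?k) \<odot> Mid \<one> ?k ?h \<one> \<odot> (Lui ?k \<star> Rui ?h)"
    by (subst dd_tcmp) (auto simp: tcmp_tid_left tcmp_tid_right)
  also have "\<dots> = dd X Y X' Y' \<odot> Sw ?k ?h"
    by (simp add: Mid_unt_first_fourth)
  finally show ?thesis .
qed

lemma ll_rr_commute:
  assumes [simp]: "X \<in> vob C" "X' \<in> vob C" "Y \<in> vob E" "Y' \<in> vob E"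
  shows "tcmp B (fob D (X, Y)) (fob D (X', Y)) (fob D (X', Y')) \<odot> (ll X' Y Y' \<star> rr Y X X')
    = (tcmp B (fob D (X, Y)) (fob D (X, Y')) (fob D (X', Y')) \<odot> (rr Y' X X' \<star> ll X Y Y'))
      \<odot> Sw (vhom E Y Y') (vhom C X X')"
  by (simp only: ll_rr rr_ll assms)

lemma vfunctor_fix_right:
  assumes [simp]: "Y \<in> vob E"
  shows "vfunctor C B (fix_right C E D Y)"
proof (rule vfunctorI)
  fix X assume X [simp]: "X \<in> vob C"
  have "rr Y X X \<odot> tid C X = dd X Y X Y \<odot> (Idt (vhom C X X) \<star> tid E Y) \<odot> (tid C X \<star> Idt \<one>) \<odot> Rui \<one>"
    by (simp add: rr_eq Rui_natural)
  also have "\<dots> = tid B (fob D (X, Y))"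
    by (simp add: Rui_unt dd_tid)
  finally show "rr Y X X \<odot> tid C X = tid B (fob (fix_right C E D Y) X)" by simp
next
  fix X X' X'' assume X [simp]: "X \<in> vob C" "X' \<in> vob C" "X'' \<in> vob C"
  let ?h = "vhom C X' X''" and ?k = "vhom C X X'"
  have "rr Y X X'' \<odot> tcmp C X X' X'' = dd X Y X'' Y \<odot> (tcmp C X X' X'' \<star> tid E Y) \<odot> Rui (?h \<otimes> ?k)"
    by (simp add: rr_eq Rui_natural)
  \<comment> \<open>The identity in the second variable is about to be split as a composite of two
    identities; \<open>Lu \<one>\<close> and the unit instance of \<open>Mid\<close> prepare the
    shape of \<open>dd_tcmp\<close>.\<close>
  also have "\<dots> = dd X Y X'' Y \<odot> (tcmp C X X' X'' \<star> tid E Y \<odot> Lu \<one>) \<odot> Mid ?h \<one> ?k \<one> \<odot> (Rui ?h \<star> Rui ?k)"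
    by (simp add: Mid_unt_second_fourth)
  also have "\<dots> = dd X Y X'' Y \<odot> ((tcmp C X X' X'' \<odot> (Idt ?h \<star> Idt ?k) \<star> tcmp E Y Y Y \<odot> (tid E Y \<star> tid E Y))
      \<odot> Mid ?h \<one> ?k \<one>) \<odot> (Rui ?h \<star> Rui ?k)"
    by (simp add: tcmp_tid_left)
  also have "\<dots> = (dd X Y X'' Y \<odot> (tcmp C X X' X'' \<odot> (Idt ?h \<star> Idt ?k) \<star> tcmp E Y Y Y \<odot> (tid E Y \<star> tid E Y))
      \<odot> Mid ?h \<one> ?k \<one>) \<odot> (Rui ?h \<star> Rui ?k)"
    by simp
  also have "\<dots> = tcmp B (fob D (X, Y)) (fob D (X', Y)) (fob D (X'', Y)) \<odot> (rr Y X' X'' \<star> rr Y X X')"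
    using dd_tcmp[of X X' X'' Y Y Y "Idt ?h" "tid E Y" "Idt ?k" "tid E Y", symmetric]
    by (simp add: rr_eq)
  finally show "rr Y X X'' \<odot> tcmp C X X' X'' = tcmp B (fob (fix_right C E D Y) X)
      (fob (fix_right C E D Y) X') (fob (fix_right C E D Y) X'') \<odot> (rr Y X' X'' \<star> rr Y X X')"
    by simp
qed (simp_all, simp_all add: fix_right_def mk_vfun_simps)

lemma vfunctor_fix_left:
  assumes [simp]: "X \<in> vob C"
  shows "vfunctor E B (fix_left C E D X)"
proof (rule vfunctorI)
  fix Y assume Y [simp]: "Y \<in> vob E"
  have "ll X Y Y \<odot> tid E Y = dd X Y X Y \<odot> (tid C X \<star> Idt (vhom E Y Y)) \<odot> (Idt \<one> \<star> tid E Y) \<odot> Lui \<one>"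
    by (simp add: ll_eq Lui_natural)
  also have "\<dots> = tid B (fob D (X, Y))"
    by (simp add: dd_tid)
  finally show "ll X Y Y \<odot> tid E Y = tid B (fob (fix_left C E D X) Y)" by simp
next
  fix Y Y' Y'' assume X [simp]: "Y \<in> vob E" "Y' \<in> vob E" "Y'' \<in> vob E"
  let ?h = "vhom E Y' Y''" and ?k = "vhom E Y Y'"
  have "ll X Y Y'' \<odot> tcmp E Y Y' Y'' = dd X Y X Y'' \<odot> (tid C X \<star> tcmp E Y Y' Y'') \<odot> Lui (?h \<otimes> ?k)"
    by (simp add: ll_eq Lui_natural)
  also have "\<dots> = dd X Y X Y'' \<odot> (tid C X \<odot> Lu \<one> \<star> tcmp E Y Y' Y'') \<odot> Mid \<one> ?h \<one> ?k \<odot> (Lui ?h \<star> Lui ?k)"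
    by (simp add: Mid_unt_first_third)
  also have "\<dots> = (dd X Y X Y'' \<odot> (tcmp C X X X \<odot> (tid C X \<star> tid C X) \<star> tcmp E Y Y' Y'' \<odot> (Idt ?h \<star> Idt ?k))
      \<odot> Mid \<one> ?h \<one> ?k) \<odot> (Lui ?h \<star> Lui ?k)"
    by (simp add: tcmp_tid_left)
  also have "\<dots> = tcmp B (fob D (X, Y)) (fob D (X, Y')) (fob D (X, Y'')) \<odot> (ll X Y' Y'' \<star> ll X Y Y')"
    using dd_tcmp[of X X X Y Y' Y'' "tid C X" "Idt ?h" "tid C X" "Idt ?k", symmetric]
    by (simp add: ll_eq)
  finally show "ll X Y Y'' \<odot> tcmp E Y Y' Y'' = tcmp B (fob (fix_left C E D X) Y)
      (fob (fix_left C E D X) Y') (fob (fix_left C E D X) Y'') \<odot> (ll X Y' Y'' \<star> ll X Y Y')"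
    by simp
qed (simp_all, simp_all add: fix_left_def mk_vfun_simps)

end

context symmetric_monoidal_closed
begin

text \<open>The action of \<open>D(-,Y)\<close> is that of \<open>D\<close> preceded by the
  insertion of the identity of \<open>Y\<close>, and the insertion slides past \<open>t\<close> by
  functoriality of \<open>\<otimes>\<close>.\<close>

lemma vnat_V_fix_right:
  assumes C [simp]: "vcategory C" and E [simp]: "vcategory E" and D: "vfunctor (vtensor C E) VV D"
    and D': "vfunctor (vtensor C E) VV D'" and t: "t \<in> vnat_V (vtensor C E) D D'" and Y [simp]: "Y \<in> vob E"
  shows "(\<lambda>X\<in>vob C. t (X, Y)) \<in> vnat_V C (fix_right C E D Y) (fix_right C E D' Y)"
proof -
  interpret D: vbifunctor V C E VV D by unfold_locales (auto simp: D)
  interpret D': vbifunctor V C E VV D' by unfold_locales (auto simp: D')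
  let ?t = "\<lambda>X Y. Tar (fob D (X, Y)) (t (X, Y)) (fob D' (X, Y))"
  have arr [simp]: "arr (?t X Y)" if "X \<in> vob C" "Y \<in> vob E" for X Y
    using t that by (simp add: vnat_V_iff D D')
  have nat: "?t X' Y' \<odot> act (vtensor C E) D (X, Y) (X', Y')
      = act (vtensor C E) D' (X, Y) (X', Y') \<odot> (Idt (vhom C X X' \<otimes> vhom E Y Y') \<star> ?t X Y)"
    if "X \<in> vob C" "Y \<in> vob E" "X' \<in> vob C" "Y' \<in> vob E" for X Y X' Y'
    using t that by (simp add: vnat_V_iff D D')
  note [simp] = arr_act[OF D] arr_act[OF D'] D.D_in[simplified] D'.D_in[simplified]
  have "?t X' Y \<odot> act C (fix_right C E D Y) X X' = act C (fix_right C E D' Y) X X' \<odot> (Idt (vhom C X X') \<star> ?t X Y)"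
    if X [simp]: "X \<in> vob C" "X' \<in> vob C" for X X'
  proof -
    let ?u = "(Idt (vhom C X X') \<star> tid E Y) \<odot> Rui (vhom C X X')"
    have D_act: "act C (fix_right C E D Y) X X' = act (vtensor C E) D (X, Y) (X', Y) \<odot> (?u \<star> Idt (fob D (X, Y)))"
      unfolding act_def by (subst D.rr_eq) (simp_all add: Uc_seq)
    have D'_act: "act C (fix_right C E D' Y) X X' = act (vtensor C E) D' (X, Y) (X', Y) \<odot> (?u \<star> Idt (fob D' (X, Y)))"
      unfolding act_def by (subst D'.rr_eq) (simp_all add: Uc_seq)
    show ?thesis unfolding D_act D'_act
      by (subst reassoc2[OF nat]) auto
  qed
  then show ?thesis
    by (subst vnat_V_iff) (auto simp: D.vfunctor_fix_right D'.vfunctor_fix_right)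
qed

lemma act_fix_left:
  assumes C [simp]: "vcategory C" and E [simp]: "vcategory E" and D: "vfunctor (vtensor C E) VV D"
    and X [simp]: "X \<in> vob C" and Y [simp]: "Y \<in> vob E" "Y' \<in> vob E"
  shows "act E (fix_left C E D X) Y Y'
    = act (vtensor C E) D (X, Y) (X, Y') \<odot> ((tid C X \<star> Idt (vhom E Y Y')) \<odot> Lui (vhom E Y Y') \<star> Idt (fob D (X, Y)))"
proof -
  interpret D: vbifunctor V C E VV D by unfold_locales (auto simp: D)
  note [simp] = D.D_in[simplified]
  show ?thesis
    unfolding act_def by (subst D.ll_eq) (simp_all add: Uc_seq)
qed

lemma vnat_V_fix_left:
  assumes C [simp]: "vcategory C" and E [simp]: "vcategory E" and D: "vfunctor (vtensor C E) VV D"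
    and D': "vfunctor (vtensor C E) VV D'" and t: "t \<in> vnat_V (vtensor C E) D D'" and X [simp]: "X \<in> vob C"
  shows "(\<lambda>Y\<in>vob E. t (X, Y)) \<in> vnat_V E (fix_left C E D X) (fix_left C E D' X)"
proof -
  interpret D: vbifunctor V C E VV D by unfold_locales (auto simp: D)
  interpret D': vbifunctor V C E VV D' by unfold_locales (auto simp: D')
  let ?t = "\<lambda>X Y. Tar (fob D (X, Y)) (t (X, Y)) (fob D' (X, Y))"
  have arr [simp]: "arr (?t X Y)" if "X \<in> vob C" "Y \<in> vob E" for X Y
    using t that by (simp add: vnat_V_iff D D')
  have nat: "?t X' Y' \<odot> act (vtensor C E) D (X, Y) (X', Y')
      = act (vtensor C E) D' (X, Y) (X', Y') \<odot> (Idt (vhom C X X' \<otimes> vhom E Y Y') \<star> ?t X Y)"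
    if "X \<in> vob C" "Y \<in> vob E" "X' \<in> vob C" "Y' \<in> vob E" for X Y X' Y'
    using t that by (simp add: vnat_V_iff D D')
  note [simp] = arr_act[OF D] arr_act[OF D'] D.D_in[simplified] D'.D_in[simplified]
  have "?t X Y' \<odot> act E (fix_left C E D X) Y Y' = act E (fix_left C E D' X) Y Y' \<odot> (Idt (vhom E Y Y') \<star> ?t X Y)"
    if Y [simp]: "Y \<in> vob E" "Y' \<in> vob E" for Y Y'
    by (simp add: act_fix_left D D') (subst reassoc2[OF nat]; simp)
  then show ?thesis
    by (subst vnat_V_iff) (auto simp: D.vfunctor_fix_left D'.vfunctor_fix_left)
qed

section \<open>Representable functors\<close>

lemma representable_simps:
  "Y \<in> vob C \<Longrightarrow> fob (representable C X) Y = vhom C X Y"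
  "fob (representable C X) \<in> extensional (vob C)"
  "case_prod (fhom (representable C X)) \<in> extensional (vob C \<times> vob C)"
  by (simp_all add: representable_def mk_vfun_simps)

lemma tfh_representable:
  "\<lbrakk>Y \<in> vob C; Y' \<in> vob C\<rbrakk>
    \<Longrightarrow> tfh C VV (representable C X) Y Y' = Cu (vhom C Y Y') (vhom C X Y) (vhom C X Y') (tcmp C X Y Y')"
  by (simp add: tfh_def Cu_def representable_def mk_vfun_simps)

text \<open>Uncurried, the two functor laws are the left unit law and the associativity law of
  \<open>C\<close>.\<close>

lemma vfunctor_representable:
  assumes [simp]: "vcategory C" "vcategory VV" "X \<in> vob C"
  shows "vfunctor C VV (representable C X)"
proof (rule vfunctorI)
  fix Y assume [simp]: "Y \<in> vob C"
  have "Cu (vhom C Y Y) (vhom C X Y) (vhom C X Y) (tcmp C X Y Y) \<odot> tid C Y = Elt (Idt (vhom C X Y))"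
    by (rule Uc_inject[where X = "vhom C X Y" and Y = "vhom C X Y"]) (auto simp: Uc_seq Uc_Elt tcmp_tid_left)
  then show "tfh C VV (representable C X) Y Y \<odot> tid C Y = tid VV (fob (representable C X) Y)"
    by (simp add: tfh_representable representable_simps tid_vself_on)
next
  fix Y Y' Y'' assume [simp]: "Y \<in> vob C" "Y' \<in> vob C" "Y'' \<in> vob C"
  have "Cu (vhom C Y Y'') (vhom C X Y) (vhom C X Y'') (tcmp C X Y Y'') \<odot> tcmp C Y Y' Y''
    = Mv (vhom C X Y) (vhom C X Y') (vhom C X Y'') \<odot>
      (Cu (vhom C Y' Y'') (vhom C X Y') (vhom C X Y'') (tcmp C X Y' Y'') \<star>
       Cu (vhom C Y Y') (vhom C X Y) (vhom C X Y') (tcmp C X Y Y'))"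
    by (rule Uc_inject[where X = "vhom C X Y" and Y = "vhom C X Y''"])
      (simp_all add: Uc_Mv, simp add: Uc_seq vcategory_laws(1))
  then show "tfh C VV (representable C X) Y Y'' \<odot> tcmp C Y Y' Y''
    = tcmp VV (fob (representable C X) Y) (fob (representable C X) Y') (fob (representable C X) Y'') \<odot>
      (tfh C VV (representable C X) Y' Y'' \<star> tfh C VV (representable C X) Y Y')"
    by (simp add: tfh_representable representable_simps tcmp_vself_on)
qed (simp_all add: representable_simps tfh_representable)

lemma act_representable:
  "\<lbrakk>vcategory C; X \<in> vob C; Y \<in> vob C; Y' \<in> vob C\<rbrakk> \<Longrightarrow> act C (representable C X) Y Y' = tcmp C X Y Y'"
  by (simp add: act_def tfh_representable representable_simps)

section \<open>Powers on generalised elements\<close>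

text \<open>Arrows \<open>W \<rightarrow> C(Y,P)\<close> correspond to arrows
  \<open>J \<otimes> W \<rightarrow> C(Y,X)\<close>. \<open>J\<close> stands to the left of
  \<open>W\<close> because composition takes \<open>k\<close> as its left factor.\<close>

definition tpower :: "('a, 'o, 'm) vcat \<Rightarrow> 'o \<Rightarrow> 'a \<Rightarrow> 'a \<Rightarrow> ('o, 'm) tar \<Rightarrow> bool" where
  "tpower C J X P k \<longleftrightarrow> P \<in> vob C \<and> arr k \<and> tdom k = J \<and> tcod k = vhom C P X \<and>
    (\<forall>Y\<in>vob C. \<forall>W\<in>Ob V. \<forall>f. arr f \<and> tdom f = J \<otimes> W \<and> tcod f = vhom C Y X \<longrightarrow>
      (\<exists>!h. arr h \<and> tdom h = W \<and> tcod h = vhom C Y P \<and> tcmp C Y P X \<odot> (k \<star> h) = f))"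

text \<open>The Yoneda lemma for the single arrow \<open>p\<close>: invertibility is tested by
  bijectivity on generalised elements.\<close>

lemma is_iso_iff:
  assumes [simp]: "arr p"
  shows "is_iso V (tdom p) (tcod p) (tval p) \<longleftrightarrow>
    (\<forall>W\<in>Ob V. \<forall>g. arr g \<and> tdom g = W \<and> tcod g = tcod p \<longrightarrow>
      (\<exists>!h. arr h \<and> tdom h = W \<and> tcod h = tdom p \<and> p \<odot> h = g))" (is "_ \<longleftrightarrow> ?univ")
proof
  assume "is_iso V (tdom p) (tcod p) (tval p)"
  then obtain q where q: "is_inverse V (tdom p) (tcod p) (tval p) q"
    by (auto simp: is_iso_def)
  define r where "r = Tar (tcod p) q (tdom p)"
  have [simp]: "arr r" "tdom r = tcod p" "tcod r = tdom p" "tval r = q"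
    using q by (auto simp: r_def arr_Tar is_inverse_def)
  have [simp]: "p \<odot> r = Idt (tcod p)" "r \<odot> p = Idt (tdom p)"
    using q by (auto intro!: tar_eqI simp: tval_simps is_inverse_def)
  show ?univ
  proof (intro ballI allI impI)
    fix W g assume g: "arr g \<and> tdom g = W \<and> tcod g = tcod p"
    show "\<exists>!h. arr h \<and> tdom h = W \<and> tcod h = tdom p \<and> p \<odot> h = g"
    proof
      show "arr (r \<odot> g) \<and> tdom (r \<odot> g) = W \<and> tcod (r \<odot> g) = tdom p \<and> p \<odot> r \<odot> g = g"
        using g by (simp add: seq_assoc[symmetric] del: seq_assoc)
    next
      fix h assume h: "arr h \<and> tdom h = W \<and> tcod h = tdom p \<and> p \<odot> h = g"
      then have "r \<odot> g = (r \<odot> p) \<odot> h" by (auto simp del: \<open>r \<odot> p = Idt (tdom p)\<close>)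
      then show "h = r \<odot> g" using h by simp
    qed
  qed
next
  assume univ: ?univ
  have "\<exists>h. arr h \<and> tdom h = tcod p \<and> tcod h = tdom p \<and> p \<odot> h = Idt (tcod p)"
    using univ[rule_format, of "tcod p" "Idt (tcod p)"] by auto
  then obtain r where r [simp]: "arr r" "tdom r = tcod p" "tcod r = tdom p" and pr: "p \<odot> r = Idt (tcod p)"
    by blast
  \<comment> \<open>Both \<open>r \<odot> p\<close> and the identity solve
    \<open>p \<odot> h = p\<close>, so the right inverse \<open>r\<close> is also a left
    inverse.\<close>
  have "\<exists>!h. arr h \<and> tdom h = tdom p \<and> tcod h = tdom p \<and> p \<odot> h = p"
    using univ[rule_format, of "tdom p" p] by auto
  moreover have "arr (r \<odot> p) \<and> tdom (r \<odot> p) = tdom p \<and> tcod (r \<odot> p) = tdom p \<and> p \<odot> r \<odot> p = p"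
    using pr by (simp add: reassoc[OF pr])
  moreover have "arr (Idt (tdom p)) \<and> tdom (Idt (tdom p)) = tdom p \<and> tcod (Idt (tdom p)) = tdom p \<and> p \<odot> Idt (tdom p) = p"
    by simp
  ultimately have rp: "r \<odot> p = Idt (tdom p)" by blast
  have "is_inverse V (tdom p) (tcod p) (tval p) (tval r)"
    using pr[THEN arg_cong, of tval] rp[THEN arg_cong, of tval] arr_tval[of p] arr_tval[of r]
    by (simp add: is_inverse_def tval_simps)
  then show "is_iso V (tdom p) (tcod p) (tval p)" by (auto simp: is_iso_def)
qed

text \<open>\<open>is_iso_iff\<close> applied to the comparison arrow in \<open>is_power\<close>,
  followed by uncurrying.\<close>

lemma is_power_iff:
  assumes C [simp]: "vcategory C" and X [simp]: "X \<in> vob C" and J [simp]: "J \<in> Ob V"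
  shows "is_power C J X P k \<longleftrightarrow> tpower C J X P (Tar J k (vhom C P X))"
proof -
  have "is_iso V (vhom C Y P) (J \<Rrightarrow> vhom C Y X) (curry_ar (vhom C Y P) J (vhom C Y X)
        (vcmp C Y P X \<cdot> (k \<boxtimes> \<iota> (vhom C Y P)) \<cdot> swp V (vhom C Y P) J)) \<longleftrightarrow>
      (\<forall>W\<in>Ob V. \<forall>f. arr f \<and> tdom f = J \<otimes> W \<and> tcod f = vhom C Y X \<longrightarrow>
      (\<exists>!h. arr h \<and> tdom h = W \<and> tcod h = vhom C Y P \<and> tcmp C Y P X \<odot> (Tar J k (vhom C P X) \<star> h) = f))"
    (is "?iso \<longleftrightarrow> ?univ")
    if P [simp]: "P \<in> vob C" and k: "k \<in> Hom V J (vhom C P X)" and Y [simp]: "Y \<in> vob C" for Y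
  proof -
    let ?k = "Tar J k (vhom C P X)"
    have [simp]: "arr ?k" using k by (simp add: arr_Tar)
    define p where "p = Cu (vhom C Y P) J (vhom C Y X) (tcmp C Y P X \<odot> (?k \<star> Idt (vhom C Y P)) \<odot> Sw (vhom C Y P) J)"
    have [simp]: "arr p" "tdom p = vhom C Y P" "tcod p = J \<Rrightarrow> vhom C Y X" by (auto simp: p_def)
    have "p = Cu (vhom C Y P) J (vhom C Y X) ((tcmp C Y P X \<odot> (?k \<star> Idt (vhom C Y P))) \<odot> Sw (vhom C Y P) J)"
      by (simp add: p_def)
    then have p: "tval p = curry_ar (vhom C Y P) J (vhom C Y X)
        (vcmp C Y P X \<cdot> (k \<boxtimes> \<iota> (vhom C Y P)) \<cdot> swp V (vhom C Y P) J)"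
      by (simp only: Cu_def tar.sel tval_simps tcmp_simps)
    have Ucp: "Uc J (vhom C Y X) (p \<odot> h) = tcmp C Y P X \<odot> (?k \<star> h) \<odot> Sw (tdom h) J"
      if "arr h" "tcod h = vhom C Y P" for h
      using that by (simp add: Uc_seq p_def Sw_natural)
    \<comment> \<open>Currying puts \<open>J\<close> on the right and \<open>tpower\<close> puts it
      on the left; the symmetry translates between factoring through \<open>p\<close> and factoring
      through \<open>k\<close>.\<close>
    have eq: "p \<odot> h = g \<longleftrightarrow> tcmp C Y P X \<odot> (?k \<star> h) = Uc J (vhom C Y X) g \<odot> Sw J (tdom h)"
      if [simp]: "arr h" "tcod h = vhom C Y P" "arr g" "tcod g = J \<Rrightarrow> vhom C Y X" "tdom g = tdom h" for g h
    proof
      assume "p \<odot> h = g"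
      then show "tcmp C Y P X \<odot> (?k \<star> h) = Uc J (vhom C Y X) g \<odot> Sw J (tdom h)"
        using Ucp[of h] by auto
    next
      assume *: "tcmp C Y P X \<odot> (?k \<star> h) = Uc J (vhom C Y X) g \<odot> Sw J (tdom h)"
      have "Uc J (vhom C Y X) (p \<odot> h) = (tcmp C Y P X \<odot> (?k \<star> h)) \<odot> Sw (tdom h) J"
        using Ucp[of h] by simp
      also have "\<dots> = Uc J (vhom C Y X) g"
        unfolding * by simp
      finally show "p \<odot> h = g" by (rule Uc_inject) auto
    qed
    have "?iso \<longleftrightarrow> (\<forall>W\<in>Ob V. \<forall>g. arr g \<and> tdom g = W \<and> tcod g = J \<Rrightarrow> vhom C Y X \<longrightarrow>
      (\<exists>!h. arr h \<and> tdom h = W \<and> tcod h = vhom C Y P \<and> p \<odot> h = g))"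
      using is_iso_iff[of p] p by simp
    also have "\<dots> \<longleftrightarrow> ?univ"
    proof (intro ball_cong refl iffI allI impI)
      fix W f
      assume [simp]: "W \<in> Ob V" and univ: "\<forall>g. arr g \<and> tdom g = W \<and> tcod g = J \<Rrightarrow> vhom C Y X \<longrightarrow>
          (\<exists>!h. arr h \<and> tdom h = W \<and> tcod h = vhom C Y P \<and> p \<odot> h = g)"
        and f: "arr f \<and> tdom f = J \<otimes> W \<and> tcod f = vhom C Y X"
      define g where "g = Cu W J (vhom C Y X) (f \<odot> Sw W J)"
      have g [simp]: "arr g" "tdom g = W" "tcod g = J \<Rrightarrow> vhom C Y X" and Ucg: "Uc J (vhom C Y X) g \<odot> Sw J W = f"
        using f by (auto simp: g_def)
      have "(arr h \<and> tdom h = W \<and> tcod h = vhom C Y P \<and> p \<odot> h = g) \<longleftrightarrow>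
          (arr h \<and> tdom h = W \<and> tcod h = vhom C Y P \<and> tcmp C Y P X \<odot> (?k \<star> h) = f)" for h
        using eq[of h g] Ucg by auto
      then show "\<exists>!h. arr h \<and> tdom h = W \<and> tcod h = vhom C Y P \<and> tcmp C Y P X \<odot> (?k \<star> h) = f"
        using univ[rule_format, of g] by simp
    next
      fix W g
      assume [simp]: "W \<in> Ob V" and univ: "\<forall>f. arr f \<and> tdom f = J \<otimes> W \<and> tcod f = vhom C Y X \<longrightarrow>
          (\<exists>!h. arr h \<and> tdom h = W \<and> tcod h = vhom C Y P \<and> tcmp C Y P X \<odot> (?k \<star> h) = f)"
        and "arr g \<and> tdom g = W \<and> tcod g = J \<Rrightarrow> vhom C Y X"
      then have g [simp]: "arr g" "tdom g = W" "tcod g = J \<Rrightarrow> vhom C Y X" by auto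
      have "(arr h \<and> tdom h = W \<and> tcod h = vhom C Y P \<and> p \<odot> h = g) \<longleftrightarrow>
          (arr h \<and> tdom h = W \<and> tcod h = vhom C Y P \<and> tcmp C Y P X \<odot> (?k \<star> h) = Uc J (vhom C Y X) g \<odot> Sw J W)" for h
        using eq[of h g] by auto
      then show "\<exists>!h. arr h \<and> tdom h = W \<and> tcod h = vhom C Y P \<and> p \<odot> h = g"
        using univ[rule_format, of "Uc J (vhom C Y X) g \<odot> Sw J W"] by simp
    qed
    finally show ?thesis .
  qed
  then show ?thesis
    unfolding is_power_def tpower_def tar.sel arr_Tar
    by (intro conj_cong ball_cong) simp_all
qed

end

section \<open>Powers\<close>

context symmetric_monoidal_closed
begin

section \<open>Pasting squares of internal homs\<close>

lemma Mv_assoc: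
  assumes "vcategory VV" and [simp]: "W \<in> Ob V" "X \<in> Ob V" "Y \<in> Ob V" "Z \<in> Ob V" "arr k" "arr g" "arr h"
    "tcod k = Y \<Rrightarrow> Z" "tcod g = X \<Rrightarrow> Y" "tcod h = W \<Rrightarrow> X"
  shows "Mv W X Z \<odot> (Mv X Y Z \<odot> (k \<star> g) \<star> h)
    = Mv W Y Z \<odot> (k \<star> Mv W X Y \<odot> (g \<star> h)) \<odot> Al (tdom k) (tdom g) (tdom h)"
  using tcmp_assoc[of VV W X Y Z k g h] assms by (simp add: tcmp_vself_on)

lemma Mv_assoc':
  assumes "vcategory VV" and [simp]: "W \<in> Ob V" "X \<in> Ob V" "Y \<in> Ob V" "Z \<in> Ob V" "arr k" "arr g" "arr h"
    "tcod k = Y \<Rrightarrow> Z" "tcod g = X \<Rrightarrow> Y" "tcod h = W \<Rrightarrow> X"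
  shows "Mv W Y Z \<odot> (k \<star> Mv W X Y \<odot> (g \<star> h))
    = Mv W X Z \<odot> (Mv X Y Z \<odot> (k \<star> g) \<star> h) \<odot> Ali (tdom k) (tdom g) (tdom h)"
  using tcmp_assoc'[of VV W X Y Z k g h] assms by (simp add: tcmp_vself_on)

text \<open>Two squares are pasted along \<open>b\<close>, and the hexagon splits the symmetry of
  \<open>S\<close> past \<open>U \<otimes> W\<close> into its two moves. With functor actions for
  \<open>a\<close>, \<open>b\<close>, \<open>d\<close>, this is the composition of wedges.\<close>

lemma Mv_slide:
  assumes VV: "vcategory VV" and [simp]: "A \<in> Ob V" "A' \<in> Ob V" "B \<in> Ob V" "B' \<in> Ob V" "D \<in> Ob V" "D' \<in> Ob V"
    and [simp]: "arr a" "arr b" "arr d" "arr w" "arr w'" "arr u" "arr u'"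
    and tc [simp]: "tcod a = A \<Rrightarrow> A'" "tcod b = B \<Rrightarrow> B'" "tcod d = D \<Rrightarrow> D'"
      "tcod w = A \<Rrightarrow> B" "tcod w' = A' \<Rrightarrow> B'" "tcod u = B \<Rrightarrow> D" "tcod u' = B' \<Rrightarrow> D'"
    and td [simp]: "tdom a = S" "tdom b = S" "tdom d = S" "tdom w = W" "tdom w' = W" "tdom u = U" "tdom u' = U"
    and w: "Mv A B B' \<odot> (b \<star> w) = (Mv A A' B' \<odot> (w' \<star> a)) \<odot> Sw S W"
    and u: "Mv B D D' \<odot> (d \<star> u) = (Mv B B' D' \<odot> (u' \<star> b)) \<odot> Sw S U"
  shows "Mv A D D' \<odot> (d \<star> Mv A B D \<odot> (u \<star> w))
    = (Mv A A' D' \<odot> (Mv A' B' D' \<odot> (u' \<star> w') \<star> a)) \<odot> Sw S (U \<otimes> W)"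
proof -
  have [simp]: "S \<in> Ob V" "W \<in> Ob V" "U \<in> Ob V"
    using arr_dom[of a] arr_dom[of w] arr_dom[of u] by simp_all
  have "Mv A D D' \<odot> (d \<star> Mv A B D \<odot> (u \<star> w))
      = Mv A B D' \<odot> ((Mv B B' D' \<odot> (u' \<star> b)) \<odot> Sw S U \<star> w) \<odot> Ali S U W"
    using Mv_assoc'[OF VV, of A B D D' d u w] by (simp add: u)
  also have "\<dots> = (Mv A B D' \<odot> (Mv B B' D' \<odot> (u' \<star> b) \<star> w)) \<odot> (Sw S U \<star> Idt W) \<odot> Ali S U W"
    by simp
  also have "Mv A B D' \<odot> (Mv B B' D' \<odot> (u' \<star> b) \<star> w)
      = Mv A B' D' \<odot> (u' \<star> Mv A B B' \<odot> (b \<star> w)) \<odot> Al U S W"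
    using Mv_assoc[OF VV, of A B B' D' u' b w] by simp
  also have "\<dots> \<odot> (Sw S U \<star> Idt W) \<odot> Ali S U W = Mv A B' D' \<odot> (u' \<star> Mv A B B' \<odot> (b \<star> w)) \<odot> Sg S U W"
    by (simp add: Sg_def)
  also have "\<dots> = (Mv A B' D' \<odot> (u' \<star> Mv A A' B' \<odot> (w' \<star> a))) \<odot> (Idt U \<star> Sw S W) \<odot> Sg S U W"
    by (simp add: w)
  also have "\<dots> = (Mv A A' D' \<odot> (Mv A' B' D' \<odot> (u' \<star> w') \<star> a)) \<odot> Ali U W S \<odot> (Idt U \<star> Sw S W) \<odot> Sg S U W"
    using Mv_assoc'[OF VV, of A A' B' D' u' w' a] by simp
  also have "Ali U W S \<odot> (Idt U \<star> Sw S W) \<odot> Sg S U W = Sw S (U \<otimes> W)"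
    by (simp add: Sw_ten_right)
  finally show ?thesis .
qed

section \<open>Powers in the base category and their preservation by functors\<close>

text \<open>An arrow \<open>W \<rightarrow> (Y \<Rrightarrow> P)\<close> uncurries to an arrow from
  \<open>W \<otimes> Y\<close> to \<open>P\<close>, so testing with arrows into \<open>P\<close>
  itself, for all \<open>W\<close>, covers every \<open>Y\<close>.\<close>

lemma tpower_VV:
  assumes [simp]: "arr k" "tdom k = J" "tcod k = P \<Rrightarrow> X" "P \<in> Ob V" "X \<in> Ob V"
    and univ: "\<And>W f. \<lbrakk>W \<in> Ob V; arr f; tdom f = J \<otimes> W; tcod f = X\<rbrakk>
      \<Longrightarrow> \<exists>!h. arr h \<and> tdom h = W \<and> tcod h = P \<and> Uc P X k \<odot> (Idt J \<star> h) = f"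
  shows "tpower VV J X P k"
  unfolding tpower_def
proof (intro conjI ballI allI impI)
  have [simp]: "J \<in> Ob V" using arr_dom[of k] by simp
  fix Y W f assume "Y \<in> vob VV" and W [simp]: "W \<in> Ob V"
    and f: "arr f \<and> tdom f = J \<otimes> W \<and> tcod f = vhom VV Y X"
  then have [simp]: "Y \<in> Ob V" "arr f" "tdom f = J \<otimes> W" "tcod f = Y \<Rrightarrow> X" by simp_all
  have eq: "Mv Y P X \<odot> (k \<star> h) = f \<longleftrightarrow> Uc P X k \<odot> (Idt J \<star> Uc Y P h) = Uc Y X f \<odot> Ali J W Y"
    if [simp]: "arr h" "tdom h = W" "tcod h = Y \<Rrightarrow> P" for h
  proof
    assume "Mv Y P X \<odot> (k \<star> h) = f"
    then have "Uc Y X f = Uc P X k \<odot> (Idt J \<star> Uc Y P h) \<odot> Al J W Y"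
      using Uc_Mv[of Y P X k h] by simp
    then show "Uc P X k \<odot> (Idt J \<star> Uc Y P h) = Uc Y X f \<odot> Ali J W Y"
      by simp
  next
    assume "Uc P X k \<odot> (Idt J \<star> Uc Y P h) = Uc Y X f \<odot> Ali J W Y"
    then have "Uc P X k \<odot> (Idt J \<star> Uc Y P h) \<odot> Al J W Y = (Uc Y X f \<odot> Ali J W Y) \<odot> Al J W Y"
      by (subst (asm) eq_commute) (simp del: seq_assoc add: seq_assoc[symmetric])
    then have "Uc Y X (Mv Y P X \<odot> (k \<star> h)) = Uc Y X f"
      using Uc_Mv[of Y P X k h] by simp
    then show "Mv Y P X \<odot> (k \<star> h) = f" by (rule Uc_inject) auto
  qed
  obtain g where g: "arr g" "tdom g = W \<otimes> Y" "tcod g = P" "Uc P X k \<odot> (Idt J \<star> g) = Uc Y X f \<odot> Ali J W Y"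
    and uniq: "\<And>g'. arr g' \<and> tdom g' = W \<otimes> Y \<and> tcod g' = P \<and> Uc P X k \<odot> (Idt J \<star> g') = Uc Y X f \<odot> Ali J W Y \<Longrightarrow> g' = g"
    using univ[of "W \<otimes> Y" "Uc Y X f \<odot> Ali J W Y"] by auto
  show "\<exists>!h. arr h \<and> tdom h = W \<and> tcod h = vhom VV Y P \<and> tcmp VV Y P X \<odot> (k \<star> h) = f"
  proof
    show "arr (Cu W Y P g) \<and> tdom (Cu W Y P g) = W \<and> tcod (Cu W Y P g) = vhom VV Y P
        \<and> tcmp VV Y P X \<odot> (k \<star> Cu W Y P g) = f"
      using g eq[of "Cu W Y P g"] by (simp add: tcmp_vself_on)
  next
    fix h assume h: "arr h \<and> tdom h = W \<and> tcod h = vhom VV Y P \<and> tcmp VV Y P X \<odot> (k \<star> h) = f"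
    then have "Uc Y P h = g"
      using eq[of h] by (intro uniq) (auto simp: tcmp_vself_on)
    then have "Uc Y P h = Uc Y P (Cu W Y P g)" using g by simp
    then show "h = Cu W Y P g"
      by (rule Uc_inject) (use g h in auto)
  qed
qed simp_all

lemma tpower_ex1:
  "\<lbrakk>tpower C J X P k; Y \<in> vob C; arr f; tdom f = J \<otimes> W; W \<in> Ob V; tcod f = vhom C Y X\<rbrakk>
    \<Longrightarrow> \<exists>!h. arr h \<and> tdom h = W \<and> tcod h = vhom C Y P \<and> tcmp C Y P X \<odot> (k \<star> h) = f"
  by (simp add: tpower_def)

lemma tpower_lift:
  assumes "tpower C J X P k" "Y \<in> vob C" "arr f" "tdom f = J \<otimes> W" "W \<in> Ob V" "tcod f = vhom C Y X"
  obtains h where "arr h" "tdom h = W" "tcod h = vhom C Y P" "tcmp C Y P X \<odot> (k \<star> h) = f"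
  using tpower_ex1[OF assms] by blast

lemma tpower_inject:
  assumes "tpower C J X P k" "vcategory C" "X \<in> vob C" "Y \<in> vob C"
    "arr h" "arr h'" "tdom h = tdom h'" "tcod h = vhom C Y P" "tcod h' = vhom C Y P"
    "tcmp C Y P X \<odot> (k \<star> h) = tcmp C Y P X \<odot> (k \<star> h')"
  shows "h = h'"
proof -
  have [simp]: "P \<in> vob C" "arr k" "tdom k = J" "tcod k = vhom C P X"
    using assms(1) by (auto simp: tpower_def)
  have "\<exists>!g. arr g \<and> tdom g = tdom h' \<and> tcod g = vhom C Y P
      \<and> tcmp C Y P X \<odot> (k \<star> g) = tcmp C Y P X \<odot> (k \<star> h')"
    using assms by (intro tpower_ex1) auto
  then show ?thesis using assms by blast
qed

text \<open>\<open>u\<close> names an arrow \<open>P \<rightarrow> P0\<close> that compares the two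
  counits. Composition with it transports a lift along \<open>k\<close> to a lift along
  \<open>k0\<close>.\<close>

lemma tcmp_elt:
  assumes [simp]: "vcategory C" "X \<in> vob C" "P \<in> vob C" "P0 \<in> vob C" "Y \<in> vob C" "arr k" "arr k0" "arr u" "arr h"
    and tc [simp]: "tdom k0 = J" "tdom k = J" "tcod k0 = vhom C P0 X" "tcod k = vhom C P X"
      "tdom u = \<one>" "tcod u = vhom C P P0" "tcod h = vhom C Y P"
    and u: "tcmp C P P0 X \<odot> (k0 \<star> u) = k \<odot> Ru J"
  shows "tcmp C Y P0 X \<odot> (k0 \<star> tcmp C Y P P0 \<odot> (u \<star> h) \<odot> Lui (tdom h)) = tcmp C Y P X \<odot> (k \<star> h)"
proof -
  have [simp]: "J \<in> Ob V" using arr_dom[of k] by simp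
  have "tcmp C Y P0 X \<odot> (k0 \<star> tcmp C Y P P0 \<odot> (u \<star> h) \<odot> Lui (tdom h))
      = (tcmp C Y P0 X \<odot> (k0 \<star> tcmp C Y P P0 \<odot> (u \<star> h))) \<odot> (Idt J \<star> Lui (tdom h))"
    by simp
  also have "\<dots> = tcmp C Y P X \<odot> (k \<odot> Ru J \<star> h) \<odot> Ali J \<one> (tdom h) \<odot> (Idt J \<star> Lui (tdom h))"
    by (subst tcmp_assoc') (auto simp: u)
  also have "\<dots> = tcmp C Y P X \<odot> (k \<star> h)"
    by (simp add: Ali_Lui)
  finally show ?thesis .
qed

text \<open>Powers of an object by \<open>J\<close> are related by an invertible element, so a functor that preserves
  one of them preserves all.\<close>

lemma tpower_preserved:
  assumes F: "vfunctor C D F" and X [simp]: "X \<in> vob C"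
    and P0: "tpower C J X P0 k0" and FP0: "tpower D J (fob F X) (fob F P0) (tfh C D F P0 X \<odot> k0)"
    and P: "tpower C J X P k"
  shows "tpower D J (fob F X) (fob F P) (tfh C D F P X \<odot> k)"
proof -
  note [simp] = vfunctor_simps[OF F]
  have [simp]: "P \<in> vob C" "arr k" "tdom k = J" "tcod k = vhom C P X"
    "P0 \<in> vob C" "arr k0" "tdom k0 = J" "tcod k0 = vhom C P0 X"
    using P P0 by (auto simp: tpower_def)
  have [simp]: "J \<in> Ob V" using arr_dom[of k] by simp
  \<comment> \<open>With \<open>W = \<one>\<close>, the two universal properties yield comparison
    arrows in both directions.\<close>
  obtain u where [simp]: "arr u" "tdom u = \<one>" "tcod u = vhom C P P0"
    and u: "tcmp C P P0 X \<odot> (k0 \<star> u) = k \<odot> Ru J"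
    by (rule tpower_lift[OF P0, of P "k \<odot> Ru J" \<one>]) auto
  obtain v where [simp]: "arr v" "tdom v = \<one>" "tcod v = vhom C P0 P"
    and v: "tcmp C P0 P X \<odot> (k \<star> v) = k0 \<odot> Ru J"
    by (rule tpower_lift[OF P, of P0 "k0 \<odot> Ru J" \<one>]) auto
  \<comment> \<open>Uniqueness for \<open>P\<close>: this arrow and the identity have the same
    composite with \<open>k\<close>.\<close>
  have "tcmp C P P0 P \<odot> (v \<star> u) \<odot> Lui (tdom u) = tid C P"
    by (rule tpower_inject[OF P, of P]) (use tcmp_elt[OF _ _ _ _ _ _ _ _ _ _ _ _ _ _ _ _ v, of P u] u in \<open>auto simp: tcmp_tid_right\<close>)
  then have "(tcmp C P P0 P \<odot> (v \<star> u) \<odot> Lui \<one>) \<odot> Lu \<one> = tid C P \<odot> Lu \<one>" by simp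
  then have vu: "tcmp C P P0 P \<odot> (v \<star> u) = tid C P \<odot> Ru \<one>" by (simp add: Lu_unt[symmetric])
  let ?Fk = "tfh C D F P X \<odot> k" and ?Gk = "tfh C D F P0 X \<odot> k0"
    and ?Fu = "tfh C D F P P0 \<odot> u" and ?Fv = "tfh C D F P0 P \<odot> v"
  have Fu: "tcmp D (fob F P) (fob F P0) (fob F X) \<odot> (?Gk \<star> ?Fu) = ?Fk \<odot> Ru J"
    using vfunctor_tcmp[OF F, of P P0 X, THEN arg_cong, of "\<lambda>a. a \<odot> (k0 \<star> u)"] by (simp add: u)
  have Fv: "tcmp D (fob F P0) (fob F P) (fob F X) \<odot> (?Fk \<star> ?Fv) = ?Gk \<odot> Ru J"
    using vfunctor_tcmp[OF F, of P0 P X, THEN arg_cong, of "\<lambda>a. a \<odot> (k \<star> v)"] by (simp add: v)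
  have Fvu: "tcmp D (fob F P) (fob F P0) (fob F P) \<odot> (?Fv \<star> ?Fu) = tid D (fob F P) \<odot> Ru \<one>"
    using vfunctor_tcmp[OF F, of P P0 P, THEN arg_cong, of "\<lambda>a. a \<odot> (v \<star> u)"]
    by (simp add: vu reassoc[OF vfunctor_tid[OF F]])
  note trans = tcmp_elt[OF _ _ _ _ _ _ _ _ _ _ _ _ _ _ _ _ Fu]
    tcmp_elt[OF _ _ _ _ _ _ _ _ _ _ _ _ _ _ _ _ Fv]
    tcmp_elt[OF _ _ _ _ _ _ _ _ _ _ _ _ _ _ _ _ Fvu]
  show ?thesis unfolding tpower_def
  proof (intro conjI ballI allI impI)
    fix Y W f assume [simp]: "Y \<in> vob D" "W \<in> Ob V" and f: "arr f \<and> tdom f = J \<otimes> W \<and> tcod f = vhom D Y (fob F X)"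
    obtain h where h [simp]: "arr h" "tdom h = W" "tcod h = vhom D Y (fob F P0)"
      and hf: "tcmp D Y (fob F P0) (fob F X) \<odot> (?Gk \<star> h) = f"
      by (rule tpower_lift[OF FP0, of Y f W]) (use f in auto)
    \<comment> \<open>The lift through \<open>fob F P0\<close> is transported by \<open>?Fv\<close>.
      Uniqueness holds because \<open>?Fu\<close> sends any solution to that lift \<open>h\<close>,
      and \<open>Fvu\<close> recovers the solution from its image.\<close>
    let ?g = "tcmp D Y (fob F P0) (fob F P) \<odot> (?Fv \<star> h) \<odot> Lui W"
    show "\<exists>!h. arr h \<and> tdom h = W \<and> tcod h = vhom D Y (fob F P) \<and> tcmp D Y (fob F P) (fob F X) \<odot> (?Fk \<star> h) = f"
    proof
      show "arr ?g \<and> tdom ?g = W \<and> tcod ?g = vhom D Y (fob F P) \<and> tcmp D Y (fob F P) (fob F X) \<odot> (?Fk \<star> ?g) = f"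
        using trans(2)[of Y h] hf by simp
    next
      fix g assume g: "arr g \<and> tdom g = W \<and> tcod g = vhom D Y (fob F P) \<and> tcmp D Y (fob F P) (fob F X) \<odot> (?Fk \<star> g) = f"
      then have [simp]: "arr g" "tdom g = W" "tcod g = vhom D Y (fob F P)" by simp_all
      have "tcmp D Y (fob F P) (fob F P0) \<odot> (?Fu \<star> g) \<odot> Lui W = h"
        by (rule tpower_inject[OF FP0, of Y]) (use trans(1)[of Y g] g hf in auto)
      then have "tcmp D Y (fob F P0) (fob F P) \<odot> (?Fv \<star> h) = g \<odot> Lu W"
        using trans(3)[of Y g] by (simp add: tcmp_tid_left)
      then show "g = ?g" by (subst reassoc) auto
    qed
  qed auto
qed

lemma preserves_powers_iff:
  assumes F: "vfunctor C D F" and S: "S \<subseteq> Ob V"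
  shows "preserves_powers S C D F \<longleftrightarrow> (\<forall>J\<in>S. \<forall>X\<in>vob C. \<forall>P k. tpower C J X P k
    \<longrightarrow> tpower D J (fob F X) (fob F P) (tfh C D F P X \<odot> k))"
proof -
  note [simp] = vfunctor_simps[OF F]
  have iff: "is_power D J (fob F X) (fob F P) (fhom F P X \<cdot> tval k)
      \<longleftrightarrow> tpower D J (fob F X) (fob F P) (tfh C D F P X \<odot> k)"
    if "J \<in> S" "X \<in> vob C" "tpower C J X P k" for J X P k
  proof -
    have "J \<in> Ob V" "tdom k = J" "tcod k = vhom C P X" using that S by (auto simp: tpower_def)
    then have "Tar J (fhom F P X \<cdot> tval k) (vhom D (fob F P) (fob F X)) = tfh C D F P X \<odot> k"
      by (auto intro!: tar_eqI simp: tval_simps)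
    then show ?thesis using that \<open>J \<in> Ob V\<close> by (simp add: is_power_iff)
  qed
  show ?thesis
  proof
    assume pres: "preserves_powers S C D F"
    show "\<forall>J\<in>S. \<forall>X\<in>vob C. \<forall>P k. tpower C J X P k \<longrightarrow> tpower D J (fob F X) (fob F P) (tfh C D F P X \<odot> k)"
    proof (intro ballI allI impI)
      fix J X P k assume *: "J \<in> S" "X \<in> vob C" "tpower C J X P k"
      then have "J \<in> Ob V" "Tar J (tval k) (vhom C P X) = k" using S by (auto simp: tpower_def intro: tar_eqI)
      then have "is_power C J X P (tval k)" using * by (simp add: is_power_iff)
      then show "tpower D J (fob F X) (fob F P) (tfh C D F P X \<odot> k)"
        using pres * iff[OF *] by (auto simp: preserves_powers_def)
    qed
  next
    assume pres: "\<forall>J\<in>S. \<forall>X\<in>vob C. \<forall>P k. tpower C J X P k \<longrightarrow> tpower D J (fob F X) (fob F P) (tfh C D F P X \<odot> k)"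
    show "preserves_powers S C D F" unfolding preserves_powers_def
    proof (intro ballI allI impI)
      fix J X P k assume *: "J \<in> S" "X \<in> vob C" "is_power C J X P k"
      then have "J \<in> Ob V" using S by auto
      then have "tpower C J X P (Tar J k (vhom C P X))" using * by (simp add: is_power_iff)
      then show "is_power D J (fob F X) (fob F P) (fhom F P X \<cdot> k)"
        using pres * iff[OF *(1,2), of P "Tar J k (vhom C P X)"] by simp
    qed
  qed
qed

lemma vop_simps [simp]: "vob (vop C) = vob C" "vhom (vop C) X Y = vhom C Y X"
  by (simp_all add: vop_def)

lemma tcmp_vop: "tcmp (vop C) X Y Z = tcmp C Z Y X \<odot> Sw (vhom C Z Y) (vhom C Y X)"
  by (rule tar_eqI) (simp_all add: tval_simps, simp add: vop_def)

text \<open>A power in an opposite category is a copower, and the copower of \<open>X\<close> by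
  \<open>J\<close> in \<open>V\<close> is \<open>J \<otimes> X\<close>. The transpose of the
  identity is the unit of the tensor-hom adjunction.\<close>

lemma tpower_vop_vself:
  assumes S: "S \<subseteq> Ob V" and J: "J \<in> S" and X: "X \<in> S" and JX: "J \<otimes> X \<in> S"
  shows "tpower (vop (vself_on S)) J X (J \<otimes> X) (Cu J X (J \<otimes> X) (Idt (J \<otimes> X)))"
  unfolding tpower_def
proof (intro conjI ballI allI impI)
  have [simp]: "J \<in> Ob V" "X \<in> Ob V" using S J X by auto
  let ?k = "Cu J X (J \<otimes> X) (Idt (J \<otimes> X))"
  fix Y W f assume "Y \<in> vob (vop (vself_on S))" and [simp]: "W \<in> Ob V"
    and f: "arr f \<and> tdom f = J \<otimes> W \<and> tcod f = vhom (vop (vself_on S)) Y X"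
  then have [simp]: "Y \<in> Ob V" "arr f" "tdom f = J \<otimes> W" "tcod f = X \<Rrightarrow> Y" using S by auto
  let ?u = "Uc X Y f \<odot> (Sw W J \<star> Idt X) \<odot> Ali W J X"
  have eq: "tcmp (vop (vself_on S)) Y (J \<otimes> X) X \<odot> (?k \<star> h) = f \<longleftrightarrow> Uc (J \<otimes> X) Y h = ?u"
    if [simp]: "arr h" "tdom h = W" "tcod h = (J \<otimes> X) \<Rrightarrow> Y" for h
  proof -
    have 1: "tcmp (vop (vself_on S)) Y (J \<otimes> X) X \<odot> (?k \<star> h) = (Mv X (J \<otimes> X) Y \<odot> (h \<star> ?k)) \<odot> Sw J W"
      by (simp add: tcmp_vop tcmp_vself_on Sw_natural)
    have 2: "Uc X Y (Mv X (J \<otimes> X) Y \<odot> (h \<star> ?k)) = Uc (J \<otimes> X) Y h \<odot> Al W J X"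
      by (simp add: Uc_Mv)
    have "(Mv X (J \<otimes> X) Y \<odot> (h \<star> ?k)) \<odot> Sw J W = f \<longleftrightarrow> Mv X (J \<otimes> X) Y \<odot> (h \<star> ?k) = f \<odot> Sw W J"
    proof
      assume "(Mv X (J \<otimes> X) Y \<odot> (h \<star> ?k)) \<odot> Sw J W = f"
      then have "((Mv X (J \<otimes> X) Y \<odot> (h \<star> ?k)) \<odot> Sw J W) \<odot> Sw W J = f \<odot> Sw W J"
        by (rule arg_cong)
      then show "Mv X (J \<otimes> X) Y \<odot> (h \<star> ?k) = f \<odot> Sw W J" by simp
    next
      assume *: "Mv X (J \<otimes> X) Y \<odot> (h \<star> ?k) = f \<odot> Sw W J"
      show "(Mv X (J \<otimes> X) Y \<odot> (h \<star> ?k)) \<odot> Sw J W = f" unfolding * by simp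
    qed
    also have "\<dots> \<longleftrightarrow> Uc X Y (Mv X (J \<otimes> X) Y \<odot> (h \<star> ?k)) = Uc X Y (f \<odot> Sw W J)"
    proof
      assume "Uc X Y (Mv X (J \<otimes> X) Y \<odot> (h \<star> ?k)) = Uc X Y (f \<odot> Sw W J)"
      then show "Mv X (J \<otimes> X) Y \<odot> (h \<star> ?k) = f \<odot> Sw W J" by (rule Uc_inject) auto
    qed simp
    also have "\<dots> \<longleftrightarrow> Uc (J \<otimes> X) Y h \<odot> Al W J X = Uc X Y f \<odot> (Sw W J \<star> Idt X)"
      unfolding 2 by (simp add: Uc_seq)
    also have "\<dots> \<longleftrightarrow> Uc (J \<otimes> X) Y h = ?u"
    proof
      assume "Uc (J \<otimes> X) Y h \<odot> Al W J X = Uc X Y f \<odot> (Sw W J \<star> Idt X)"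
      then have "(Uc (J \<otimes> X) Y h \<odot> Al W J X) \<odot> Ali W J X = (Uc X Y f \<odot> (Sw W J \<star> Idt X)) \<odot> Ali W J X"
        by (rule arg_cong)
      then show "Uc (J \<otimes> X) Y h = ?u" by simp
    qed simp
    finally show ?thesis unfolding 1 .
  qed
  show "\<exists>!h. arr h \<and> tdom h = W \<and> tcod h = vhom (vop (vself_on S)) Y (J \<otimes> X)
      \<and> tcmp (vop (vself_on S)) Y (J \<otimes> X) X \<odot> (?k \<star> h) = f"
  proof
    show "arr (Cu W (J \<otimes> X) Y ?u) \<and> tdom (Cu W (J \<otimes> X) Y ?u) = W \<and> tcod (Cu W (J \<otimes> X) Y ?u) = vhom (vop (vself_on S)) Y (J \<otimes> X)
      \<and> tcmp (vop (vself_on S)) Y (J \<otimes> X) X \<odot> (?k \<star> Cu W (J \<otimes> X) Y ?u) = f"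
      using eq[of "Cu W (J \<otimes> X) Y ?u"] by simp
  next
    fix h assume h: "arr h \<and> tdom h = W \<and> tcod h = vhom (vop (vself_on S)) Y (J \<otimes> X)
      \<and> tcmp (vop (vself_on S)) Y (J \<otimes> X) X \<odot> (?k \<star> h) = f"
    then have "Uc (J \<otimes> X) Y h = ?u" using eq[of h] by simp
    then have "Uc (J \<otimes> X) Y h = Uc (J \<otimes> X) Y (Cu W (J \<otimes> X) Y ?u)" by simp
    then show "h = Cu W (J \<otimes> X) Y ?u"
      by (rule Uc_inject) (use h in auto)
  qed
qed (use assms subsetD[OF S J] subsetD[OF S X] in auto)

end

section \<open>Ends and functor categories\<close>

context symmetric_monoidal_closed
begin

section \<open>Wedges and natural transformations\<close>

definition twedge :: "('a, 'o, 'm) vcat \<Rightarrow> ('a, 'o, 'm) vfun \<Rightarrow> ('a, 'o, 'm) vfun \<Rightarrow> 'o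
    \<Rightarrow> ('a \<Rightarrow> ('o, 'm) tar) \<Rightarrow> bool" where
  "twedge C A B W w \<longleftrightarrow> W \<in> Ob V \<and>
    (\<forall>X\<in>vob C. arr (w X) \<and> tdom (w X) = W \<and> tcod (w X) = fob A X \<Rrightarrow> fob B X) \<and>
    (\<forall>X\<in>vob C. \<forall>Y\<in>vob C.
      Mv (fob A X) (fob B X) (fob B Y) \<odot> (tfh C VV B X Y \<star> w X)
      = (Mv (fob A X) (fob A Y) (fob B Y) \<odot> (w Y \<star> tfh C VV A X Y)) \<odot> Sw (vhom C X Y) W)"

lemma twedge_arr:
  assumes "twedge C A B W w" "X \<in> vob C"
  shows "arr (w X)" "tdom (w X) = W" "tcod (w X) = fob A X \<Rrightarrow> fob B X"
  using assms by (simp_all add: twedge_def)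

lemma twedge_natural:
  assumes "twedge C A B W w" "X \<in> vob C" "Y \<in> vob C"
  shows "Mv (fob A X) (fob B X) (fob B Y) \<odot> (tfh C VV B X Y \<star> w X)
    = (Mv (fob A X) (fob A Y) (fob B Y) \<odot> (w Y \<star> tfh C VV A X Y)) \<odot> Sw (vhom C X Y) W"
  using assms by (simp add: twedge_def)

lemma is_wedge_iff:
  assumes A: "vfunctor C VV A" and B: "vfunctor C VV B"
  shows "is_wedge C A B W p \<longleftrightarrow> twedge C A B W (\<lambda>X. Tar W (p X) (fob A X \<Rrightarrow> fob B X))"
proof -
  note [simp] = V_functor_simps[OF B] V_functor_simps[OF A]
  let ?p = "\<lambda>X. Tar W (p X) (fob A X \<Rrightarrow> fob B X)"
  have "(vcmp VV (fob A X) (fob B X) (fob B Y) \<cdot> (fhom B X Y \<boxtimes> p X)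
      = vcmp VV (fob A X) (fob A Y) (fob B Y) \<cdot> (p Y \<boxtimes> fhom A X Y) \<cdot> swp V (vhom C X Y) W) \<longleftrightarrow>
      (Mv (fob A X) (fob B X) (fob B Y) \<odot> (tfh C VV B X Y \<star> ?p X)
      = (Mv (fob A X) (fob A Y) (fob B Y) \<odot> (?p Y \<star> tfh C VV A X Y)) \<odot> Sw (vhom C X Y) W)"
    (is "?l = ?r \<longleftrightarrow> ?L = ?R")
    if "X \<in> vob C" "Y \<in> vob C" for X Y
  proof -
    have "tval (tcmp VV (fob A X) (fob B X) (fob B Y) \<odot> (tfh C VV B X Y \<star> ?p X)) = ?l"
      by (simp only: tval_simps tcmp_simps tfh_simps tar.sel)
    moreover have "tval ((tcmp VV (fob A X) (fob A Y) (fob B Y) \<odot> (?p Y \<star> tfh C VV A X Y)) \<odot> Sw (vhom C X Y) W) = ?r"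
      by (simp only: tval_simps tcmp_simps tfh_simps tar.sel)
    ultimately have "tval ?L = ?l" "tval ?R = ?r" using that by (simp_all add: tcmp_vself_on)
    moreover have "?L = ?R \<longleftrightarrow> tval ?L = tval ?R" by (auto intro: tar_eqI)
    ultimately show ?thesis by simp
  qed
  moreover have "p X \<in> Hom V W (fob A X \<Rrightarrow> fob B X) \<longleftrightarrow> arr (?p X)" if "W \<in> Ob V" "X \<in> vob C" for X
    using that by (simp add: arr_Tar)
  ultimately show ?thesis
    unfolding is_wedge_def twedge_def tar.sel by (intro conj_cong ball_cong) simp_all
qed

lemma twedge_seq:
  assumes A: "vfunctor C VV A" and B: "vfunctor C VV B" and w: "twedge C A B W w"
    and [simp]: "arr h" "tcod h = W"
  shows "twedge C A B (tdom h) (\<lambda>X. w X \<odot> h)"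
proof -
  note [simp] = V_functor_simps[OF B] V_functor_simps[OF A] twedge_arr[OF w]
  have [simp]: "W \<in> Ob V" using arr_cod[of h] by simp
  have "Mv (fob A X) (fob B X) (fob B Y) \<odot> (tfh C VV B X Y \<star> w X \<odot> h)
      = (Mv (fob A X) (fob A Y) (fob B Y) \<odot> (w Y \<odot> h \<star> tfh C VV A X Y)) \<odot> Sw (vhom C X Y) (tdom h)"
    if [simp]: "X \<in> vob C" "Y \<in> vob C" for X Y
  proof -
    have "Mv (fob A X) (fob B X) (fob B Y) \<odot> (tfh C VV B X Y \<star> w X \<odot> h)
        = (Mv (fob A X) (fob B X) (fob B Y) \<odot> (tfh C VV B X Y \<star> w X)) \<odot> (Idt (vhom C X Y) \<star> h)"
      by simp
    also have "\<dots> = (Mv (fob A X) (fob A Y) (fob B Y) \<odot> (w Y \<star> tfh C VV A X Y)) \<odot> Sw (vhom C X Y) W \<odot> (Idt (vhom C X Y) \<star> h)"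
      unfolding twedge_natural[OF w that] by simp
    also have "\<dots> = (Mv (fob A X) (fob A Y) (fob B Y) \<odot> (w Y \<odot> h \<star> tfh C VV A X Y)) \<odot> Sw (vhom C X Y) (tdom h)"
      by (simp add: Sw_natural)
    finally show ?thesis .
  qed
  then show ?thesis by (simp add: twedge_def)
qed

text \<open>\<open>Mv_slide\<close>, with the actions of \<open>A\<close>, \<open>B\<close>,
  \<open>D\<close> on the arrows from \<open>X\<close> to \<open>Y\<close> in the roles of
  \<open>a\<close>, \<open>b\<close>, \<open>d\<close>.\<close>

lemma twedge_Mv:
  assumes A: "vfunctor C VV A" and B: "vfunctor C VV B" and D: "vfunctor C VV D"
    and w: "twedge C A B W w" and u: "twedge C B D U u"
  shows "twedge C A D (U \<otimes> W) (\<lambda>X. Mv (fob A X) (fob B X) (fob D X) \<odot> (u X \<star> w X))"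
proof -
  note [simp] = V_functor_simps[OF D] V_functor_simps[OF B] V_functor_simps[OF A] twedge_arr[OF w] twedge_arr[OF u]
  have "W \<in> Ob V" "U \<in> Ob V" using w u by (auto simp: twedge_def)
  moreover have "Mv (fob A X) (fob D X) (fob D Y) \<odot> (tfh C VV D X Y \<star> Mv (fob A X) (fob B X) (fob D X) \<odot> (u X \<star> w X))
      = (Mv (fob A X) (fob A Y) (fob D Y) \<odot> (Mv (fob A Y) (fob B Y) (fob D Y) \<odot> (u Y \<star> w Y) \<star> tfh C VV A X Y))
        \<odot> Sw (vhom C X Y) (U \<otimes> W)"
    if [simp]: "X \<in> vob C" "Y \<in> vob C" for X Y
    by (rule Mv_slide[where b = "tfh C VV B X Y", OF vfunctor_vcategory(2)[OF A]])
      (rule twedge_natural[OF w that] twedge_natural[OF u that] | simp)+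
  ultimately show ?thesis
    by (simp add: twedge_def)
qed

text \<open>For the vertex \<open>\<one>\<close> the wedge condition uncurries to the naturality
  square.\<close>

lemma twedge_Elt:
  assumes A: "vfunctor C VV A" and B: "vfunctor C VV B" and t: "t \<in> vnat_V C A B"
  shows "twedge C A B \<one> (\<lambda>X. Elt (Tar (fob A X) (t X) (fob B X)))"
proof -
  note [simp] = V_functor_simps[OF B] V_functor_simps[OF A]
  let ?t = "\<lambda>X. Tar (fob A X) (t X) (fob B X)"
  have [simp]: "arr (?t X)" if "X \<in> vob C" for X using t that by (simp add: vnat_V_iff A B)
  have nat: "?t Y \<odot> act C A X Y = act C B X Y \<odot> (Idt (vhom C X Y) \<star> ?t X)"
    if "X \<in> vob C" "Y \<in> vob C" for X Y
    using t that by (simp add: vnat_V_iff A B)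
  have "Mv (fob A X) (fob B X) (fob B Y) \<odot> (tfh C VV B X Y \<star> Elt (?t X))
      = (Mv (fob A X) (fob A Y) (fob B Y) \<odot> (Elt (?t Y) \<star> tfh C VV A X Y)) \<odot> Sw (vhom C X Y) \<one>"
    if X [simp]: "X \<in> vob C" "Y \<in> vob C" for X Y
  proof -
    let ?h = "vhom C X Y"
    have "Mv (fob A X) (fob B X) (fob B Y) \<odot> (tfh C VV B X Y \<star> Elt (?t X)) \<odot> Rui ?h
        = Mv (fob A X) (fob A Y) (fob B Y) \<odot> (Elt (?t Y) \<star> tfh C VV A X Y) \<odot> Lui ?h"
    proof (rule Uc_inject[where X = "fob A X" and Y = "fob B Y"])
      show "Uc (fob A X) (fob B Y) (Mv (fob A X) (fob B X) (fob B Y) \<odot> (tfh C VV B X Y \<star> Elt (?t X)) \<odot> Rui ?h)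
        = Uc (fob A X) (fob B Y) (Mv (fob A X) (fob A Y) (fob B Y) \<odot> (Elt (?t Y) \<star> tfh C VV A X Y) \<odot> Lui ?h)"
        using Uc_Mv_Elt_right[of "fob A X" "fob B X" "fob B Y" "tfh C VV B X Y" "?t X"]
          Uc_Mv_Elt_left[of "fob A X" "fob A Y" "fob B Y" "?t Y" "tfh C VV A X Y"] nat[of X Y]
        by (simp add: act_def)
    qed auto
    then have "(Mv (fob A X) (fob B X) (fob B Y) \<odot> (tfh C VV B X Y \<star> Elt (?t X)) \<odot> Rui ?h) \<odot> Ru ?h
        = (Mv (fob A X) (fob A Y) (fob B Y) \<odot> (Elt (?t Y) \<star> tfh C VV A X Y) \<odot> Lui ?h) \<odot> Ru ?h"
      by (rule arg_cong)
    \<comment> \<open>The naturality square involves inverse unit isomorphisms. Composing with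
      \<open>Ru ?h\<close> removes \<open>Rui ?h\<close> on one side and turns \<open>Lui ?h\<close>
      on the other into the symmetry of the wedge condition.\<close>
    moreover have "Lui ?h \<odot> Ru ?h = Sw ?h \<one>"
      by (simp add: Lu_Sw[symmetric])
    ultimately show ?thesis by simp
  qed
  then show ?thesis by (simp add: twedge_def)
qed

lemma vnat_V_id:
  assumes A: "vfunctor C VV A"
  shows "(\<lambda>X\<in>vob C. \<iota> (fob A X)) \<in> vnat_V C A A"
proof -
  note [simp] = V_functor_simps[OF A]
  show ?thesis by (simp add: vnat_V_iff A Idt_def[symmetric])
qed

lemma vnat_V_cmp:
  assumes A: "vfunctor C VV A" and B: "vfunctor C VV B" and D: "vfunctor C VV D"
    and s: "s \<in> vnat_V C B D" and t: "t \<in> vnat_V C A B"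
  shows "(\<lambda>X\<in>vob C. s X \<cdot> t X) \<in> vnat_V C A D"
proof -
  note [simp] = V_functor_simps[OF D] V_functor_simps[OF B] V_functor_simps[OF A]
  let ?t = "\<lambda>X. Tar (fob A X) (t X) (fob B X)" and ?s = "\<lambda>X. Tar (fob B X) (s X) (fob D X)"
  have eq: "Tar (fob A X) (s X \<cdot> t X) (fob D X) = ?s X \<odot> ?t X" for X
    by (simp add: seq_def)
  have [simp]: "arr (?t X)" "arr (?s X)" if "X \<in> vob C" for X using s t that by (simp_all add: vnat_V_iff A B D)
  have nat: "?t Y \<odot> act C A X Y = act C B X Y \<odot> (Idt (vhom C X Y) \<star> ?t X)"
    "?s Y \<odot> act C B X Y = act C D X Y \<odot> (Idt (vhom C X Y) \<star> ?s X)"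
    if "X \<in> vob C" "Y \<in> vob C" for X Y
    using s t that by (simp_all add: vnat_V_iff A B D)
  have "(?s Y \<odot> ?t Y) \<odot> act C A X Y = act C D X Y \<odot> (Idt (vhom C X Y) \<star> ?s X \<odot> ?t X)"
    if [simp]: "X \<in> vob C" "Y \<in> vob C" for X Y
    by (simp add: nat(1)) (subst reassoc2[OF nat(2)]; simp)
  then show ?thesis by (simp add: vnat_V_iff A D eq)
qed

lemma vnat_V_vfun_cmp:
  assumes M: "vfunctor C E M" and A: "vfunctor E VV A" and B: "vfunctor E VV B" and t: "t \<in> vnat_V E A B"
  shows "(\<lambda>X\<in>vob C. t (fob M X)) \<in> vnat_V C (vfun_cmp (vob C) A M) (vfun_cmp (vob C) B M)"
proof -
  note [simp] = vfunctor_simps[OF M] V_functor_simps[OF B] V_functor_simps[OF A]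
  let ?t = "\<lambda>X. Tar (fob A X) (t X) (fob B X)"
  have [simp]: "arr (?t X)" if "X \<in> vob E" for X using t that by (simp_all add: vnat_V_iff A B)
  have nat: "?t Y \<odot> act E A X Y = act E B X Y \<odot> (Idt (vhom E X Y) \<star> ?t X)"
    if "X \<in> vob E" "Y \<in> vob E" for X Y
    using t that by (simp_all add: vnat_V_iff A B)
  have act: "act C (vfun_cmp (vob C) F M) X Y = act E F (fob M X) (fob M Y) \<odot> (tfh C E M X Y \<star> Idt (fob F (fob M X)))"
    if F: "vfunctor E VV F" and X [simp]: "X \<in> vob C" "Y \<in> vob C" for F X Y
    using vfunctor_fob[OF F] vfunctor_arr[OF F]
    by (simp add: act_def tfh_vfun_cmp[where D = E] vfun_cmp_simps Uc_seq)
  have "?t (fob M Y) \<odot> act C (vfun_cmp (vob C) A M) X Y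
      = act C (vfun_cmp (vob C) B M) X Y \<odot> (Idt (vhom C X Y) \<star> ?t (fob M X))"
    if [simp]: "X \<in> vob C" "Y \<in> vob C" for X Y
    by (simp add: act A B) (subst reassoc2[OF nat]; simp)
  then show ?thesis
    using vfunctor_cmp[OF M A refl] vfunctor_cmp[OF M B refl] by (simp add: vnat_V_iff vfun_cmp_simps)
qed

definition ep :: "('a, 'o, 'm) vcat \<Rightarrow> ('a, 'o, 'm) vfun \<Rightarrow> ('a, 'o, 'm) vfun \<Rightarrow> 'a \<Rightarrow> ('o, 'm) tar" where
  "ep C A B X = Tar (end_ob C A B) (end_proj C A B X) (fob A X \<Rrightarrow> fob B X)"

definition el :: "('a, 'o, 'm) vcat \<Rightarrow> ('a, 'o, 'm) vfun \<Rightarrow> ('a, 'o, 'm) vfun \<Rightarrow> 'o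
    \<Rightarrow> ('a \<Rightarrow> ('o, 'm) tar) \<Rightarrow> ('o, 'm) tar" where
  "el C A B W w = Tar W (end_lift C A B W (\<lambda>X. tval (w X))) (end_ob C A B)"

lemma ep_simps [simp]: "tdom (ep C A B X) = end_ob C A B" "tcod (ep C A B X) = fob A X \<Rrightarrow> fob B X"
  by (simp_all add: ep_def)

lemma el_simps [simp]: "tdom (el C A B W w) = W" "tcod (el C A B W w) = end_ob C A B"
  by (simp_all add: el_def)

end

section \<open>Hom-objects as ends, and categories of functors\<close>

text \<open>Once an end exists, the choice in \<open>chosen_end\<close> is an end, and the
  description in \<open>end_lift\<close> is definite for every wedge.\<close>

locale vend = symmetric_monoidal_closed V
  for V :: "('o, 'm) smc" (structure) +
  fixes C :: "('a, 'o, 'm) vcat" and A B :: "('a, 'o, 'm) vfun"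
  assumes A: "vfunctor C VV A" and B: "vfunctor C VV B" and ex: "\<exists>E p. is_end C A B E p"
begin

lemma is_end: "is_end C A B (end_ob C A B) (end_proj C A B)"
  unfolding chosen_end_def using ex by (metis (mono_tags) fst_conv snd_conv someI_ex)

lemma twedge_ep: "twedge C A B (end_ob C A B) (ep C A B)"
  using is_end unfolding is_end_def is_wedge_iff[OF A B] by (simp add: ep_def[abs_def])

lemma end_ob [simp]: "end_ob C A B \<in> Ob V"
  using twedge_ep by (simp add: twedge_def)

lemma arr_ep [simp]: "X \<in> vob C \<Longrightarrow> arr (ep C A B X)"
  using twedge_arr[OF twedge_ep] by simp

lemma el_props:
  assumes w: "twedge C A B W w"
  shows "arr (el C A B W w)" and "X \<in> vob C \<Longrightarrow> ep C A B X \<odot> el C A B W w = w X"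
proof -
  have "twedge C A B W (\<lambda>X. Tar W (tval (w X)) (fob A X \<Rrightarrow> fob B X))"
  proof -
    have eq: "Tar W (tval (w X)) (fob A X \<Rrightarrow> fob B X) = w X" if "X \<in> vob C" for X
      using twedge_arr[OF w that] by (intro tar_eqI) auto
    show ?thesis using w by (simp add: twedge_def eq)
  qed
  then have "is_wedge C A B W (\<lambda>X. tval (w X))" by (simp add: is_wedge_iff[OF A B])
  then have "\<exists>!h. h \<in> Hom V W (end_ob C A B) \<and> (\<forall>X\<in>vob C. end_proj C A B X \<cdot> h = tval (w X))"
    using is_end by (simp add: is_end_def)
  then have *: "end_lift C A B W (\<lambda>X. tval (w X)) \<in> Hom V W (end_ob C A B)
      \<and> (\<forall>X\<in>vob C. end_proj C A B X \<cdot> end_lift C A B W (\<lambda>X. tval (w X)) = tval (w X))"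
    unfolding end_lift_def by (rule theI')
  have "W \<in> Ob V" using w by (simp add: twedge_def)
  then show "arr (el C A B W w)" using * by (simp add: el_def arr_Tar)
  show "ep C A B X \<odot> el C A B W w = w X" if "X \<in> vob C"
    using * that twedge_arr[OF w that] by (intro tar_eqI) (auto simp: tval_simps ep_def el_def)
qed

text \<open>Both arrows lift the wedge obtained by composing the projections with \<open>h\<close>,
  so uniqueness of lifts identifies them.\<close>

lemma ep_inject:
  assumes "arr h" "arr h'" "tdom h = tdom h'" "tcod h = end_ob C A B" "tcod h' = end_ob C A B"
    "\<And>X. X \<in> vob C \<Longrightarrow> ep C A B X \<odot> h = ep C A B X \<odot> h'"
  shows "h = h'"
proof -
  have "is_wedge C A B (tdom h) (\<lambda>X. tval (ep C A B X \<odot> h))"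
    using twedge_seq[OF A B twedge_ep assms(1,4)]
    by (simp add: is_wedge_iff[OF A B] twedge_def seq_def)
  then have ex1: "\<exists>!g. g \<in> Hom V (tdom h) (end_ob C A B) \<and> (\<forall>X\<in>vob C. end_proj C A B X \<cdot> g = tval (ep C A B X \<odot> h))"
    using is_end by (simp add: is_end_def)
  have "tval h \<in> Hom V (tdom h) (end_ob C A B) \<and> (\<forall>X\<in>vob C. end_proj C A B X \<cdot> tval h = tval (ep C A B X \<odot> h))"
    using assms(1-5) by (auto simp: tval_simps ep_def intro: arr_tval)
  moreover have "tval h' \<in> Hom V (tdom h) (end_ob C A B) \<and> (\<forall>X\<in>vob C. end_proj C A B X \<cdot> tval h' = tval (ep C A B X \<odot> h))"
  proof (intro conjI ballI)
    show "end_proj C A B X \<cdot> tval h' = tval (ep C A B X \<odot> h)" if "X \<in> vob C" for X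
      unfolding assms(6)[OF that] by (simp add: tval_simps ep_def)
  qed (use assms in \<open>auto intro: arr_tval\<close>)
  ultimately have "tval h = tval h'" using ex1 by blast
  then show ?thesis using assms by (auto intro: tar_eqI)
qed

lemma vnat_elt_props:
  assumes t: "t \<in> vnat_V C A B"
  shows "arr (Tar \<one> (vnat_elt C A B t) (end_ob C A B))"
    and "X \<in> vob C \<Longrightarrow> ep C A B X \<odot> Tar \<one> (vnat_elt C A B t) (end_ob C A B) = Elt (Tar (fob A X) (t X) (fob B X))"
proof -
  have "Tar \<one> (vnat_elt C A B t) (end_ob C A B) = el C A B \<one> (\<lambda>X. Elt (Tar (fob A X) (t X) (fob B X)))"
    by (simp add: vnat_elt_def el_def Tar_elt[symmetric])
  then show "arr (Tar \<one> (vnat_elt C A B t) (end_ob C A B))"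
    and "X \<in> vob C \<Longrightarrow> ep C A B X \<odot> Tar \<one> (vnat_elt C A B t) (end_ob C A B) = Elt (Tar (fob A X) (t X) (fob B X))"
    using el_props[OF twedge_Elt[OF A B t]] by simp_all
qed

end

locale vfun_category = symmetric_monoidal_closed V
  for V :: "('o, 'm) smc" (structure) +
  fixes C :: "('a, 'o, 'm) vcat" and S :: "('a, 'o, 'm) vfun set"
  assumes S: "A \<in> S \<Longrightarrow> vfunctor C VV A" and vfun_cat_exists: "vfun_cat_exists C S"
begin

lemma vend: "\<lbrakk>A \<in> S; B \<in> S\<rbrakk> \<Longrightarrow> vend V C A B"
  using S vfun_cat_exists by unfold_locales (auto simp: vfun_cat_exists_def)

lemma vfun_cat_simps [simp]: "vob (vfun_cat C S) = S" "vhom (vfun_cat C S) A B = end_ob C A B"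
  by (simp_all add: vfun_cat_def)

lemma end_ob_in [simp]: "\<lbrakk>A \<in> S; B \<in> S\<rbrakk> \<Longrightarrow> end_ob C A B \<in> Ob V"
  using vend.end_ob[OF vend] .

lemma arr_ep [simp]: "\<lbrakk>A \<in> S; B \<in> S; X \<in> vob C\<rbrakk> \<Longrightarrow> arr (ep C A B X)"
  using vend.arr_ep[OF vend] .

lemma fob_in [simp]: "\<lbrakk>A \<in> S; X \<in> vob C\<rbrakk> \<Longrightarrow> fob A X \<in> Ob V"
  using vfunctor_Ob[OF S] .

lemma tcmp_props:
  assumes "A \<in> S" "B \<in> S" "D \<in> S"
  shows "arr (tcmp (vfun_cat C S) A B D)"
    and "X \<in> vob C \<Longrightarrow> ep C A D X \<odot> tcmp (vfun_cat C S) A B D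
      = Mv (fob A X) (fob B X) (fob D X) \<odot> (ep C B D X \<star> ep C A B X)"
proof -
  interpret AB: vend V C A B using vend assms by blast
  interpret BD: vend V C B D using vend assms by blast
  interpret AD: vend V C A D using vend assms by blast
  let ?w = "\<lambda>X. Mv (fob A X) (fob B X) (fob D X) \<odot> (ep C B D X \<star> ep C A B X)"
  let ?W = "end_ob C B D \<otimes> end_ob C A B"
  have w: "twedge C A D ?W ?w"
    using twedge_Mv[OF AB.A AB.B BD.B AB.twedge_ep BD.twedge_ep] .
  let ?r = "\<lambda>X. vcmp VV (fob A X) (fob B X) (fob D X) \<cdot> (end_proj C B D X \<boxtimes> end_proj C A B X)"
  \<comment> \<open>\<open>end_lift\<close> reads its family on \<open>vob C\<close> only, where the
    raw and the typed family agree.\<close>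
  have "end_lift C A D ?W ?r = end_lift C A D ?W (\<lambda>X. tval (?w X))"
  proof -
    have "?r X = tval (?w X)" if "X \<in> vob C" for X
      using that assms by (simp add: tcmp_vself_on[symmetric, where S = "Ob V"] tval_simps ep_def)
    then show ?thesis unfolding end_lift_def by simp
  qed
  then have "tcmp (vfun_cat C S) A B D = el C A D ?W ?w"
    by (intro tar_eqI) (simp_all add: el_def, simp add: vfun_cat_def)
  then show "arr (tcmp (vfun_cat C S) A B D)"
    and "X \<in> vob C \<Longrightarrow> ep C A D X \<odot> tcmp (vfun_cat C S) A B D = ?w X"
    using AD.el_props[OF w] by simp_all
qed

text \<open>The identity of \<open>A\<close> is the element named by the identity transformation, so
  \<open>vnat_elt_props\<close> covers it.\<close>

lemma tid_props:
  assumes A [simp]: "A \<in> S"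
  shows "arr (tid (vfun_cat C S) A)"
    and "X \<in> vob C \<Longrightarrow> ep C A A X \<odot> tid (vfun_cat C S) A = Elt (Idt (fob A X))"
proof -
  interpret AA: vend V C A A using vend assms by blast
  let ?t = "\<lambda>X\<in>vob C. \<iota> (fob A X)"
  have "end_lift C A A \<one> (\<lambda>X. vid VV (fob A X)) = vnat_elt C A A ?t"
    unfolding vnat_elt_def end_lift_def by (simp add: vself_on_def)
  then have "tid (vfun_cat C S) A = Tar \<one> (vnat_elt C A A ?t) (end_ob C A A)"
    by (intro tar_eqI) (simp_all, simp add: vfun_cat_def)
  then show "arr (tid (vfun_cat C S) A)"
    and "X \<in> vob C \<Longrightarrow> ep C A A X \<odot> tid (vfun_cat C S) A = Elt (Idt (fob A X))"
    using AA.vnat_elt_props[OF vnat_V_id[OF AA.A]] by (simp_all add: Idt_def)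
qed

end

section \<open>Theories and algebras\<close>

context symmetric_monoidal_closed
begin

text \<open>This lifts a wedge along a pointwise power: \<open>q\<close> and \<open>q'\<close> are the counits of the powers.\<close>

lemma Mv_slide_lift:
  assumes VV: "vcategory VV" and [simp]: "A \<in> Ob V" "A' \<in> Ob V" "B \<in> Ob V" "B' \<in> Ob V" "D \<in> Ob V" "D' \<in> Ob V"
    and [simp]: "arr a" "arr b" "arr d" "arr q" "arr q'" "arr h" "arr h'"
    and tc [simp]: "tcod a = A \<Rrightarrow> A'" "tcod b = B \<Rrightarrow> B'" "tcod d = D \<Rrightarrow> D'"
      "tcod q = B \<Rrightarrow> D" "tcod q' = B' \<Rrightarrow> D'" "tcod h = A \<Rrightarrow> B" "tcod h' = A' \<Rrightarrow> B'"
    and td [simp]: "tdom a = S" "tdom b = S" "tdom d = S" "tdom q = J" "tdom q' = J" "tdom h = W" "tdom h' = W"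
    and q: "Mv B B' D' \<odot> (q' \<star> b) = (Mv B D D' \<odot> (d \<star> q)) \<odot> Sw J S"
    and f: "Mv A D D' \<odot> (d \<star> Mv A B D \<odot> (q \<star> h))
      = (Mv A A' D' \<odot> (Mv A' B' D' \<odot> (q' \<star> h') \<star> a)) \<odot> Sw S (J \<otimes> W)"
  shows "Mv A B' D' \<odot> (q' \<star> Mv A B B' \<odot> (b \<star> h))
    = Mv A B' D' \<odot> (q' \<star> (Mv A A' B' \<odot> (h' \<star> a)) \<odot> Sw S W)"
proof -
  have [simp]: "S \<in> Ob V" "W \<in> Ob V" "J \<in> Ob V"
    using arr_dom[of a] arr_dom[of h] arr_dom[of q] by simp_all
  \<comment> \<open>Both sides stay composed with \<open>q'\<close>. In the application
    \<open>q'\<close> is the counit of a power, and uniqueness of lifts removes it there.\<close>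
  have "Mv A B' D' \<odot> (q' \<star> Mv A B B' \<odot> (b \<star> h))
      = Mv A B D' \<odot> ((Mv B D D' \<odot> (d \<star> q)) \<odot> Sw J S \<star> h) \<odot> Ali J S W"
    using Mv_assoc'[OF VV, of A B B' D' q' b h] by (simp add: q)
  also have "\<dots> = (Mv A B D' \<odot> (Mv B D D' \<odot> (d \<star> q) \<star> h)) \<odot> (Sw J S \<star> Idt W) \<odot> Ali J S W"
    by simp
  also have "Mv A B D' \<odot> (Mv B D D' \<odot> (d \<star> q) \<star> h)
      = Mv A D D' \<odot> (d \<star> Mv A B D \<odot> (q \<star> h)) \<odot> Al S J W"
    using Mv_assoc[OF VV, of A B D D' d q h] by simp
  also have "\<dots> \<odot> (Sw J S \<star> Idt W) \<odot> Ali J S W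
      = (Mv A D D' \<odot> (d \<star> Mv A B D \<odot> (q \<star> h))) \<odot> Sg J S W"
    by (simp add: Sg_def)
  also have "\<dots> = (Mv A A' D' \<odot> (Mv A' B' D' \<odot> (q' \<star> h') \<star> a)) \<odot> Sw S (J \<otimes> W) \<odot> Sg J S W"
    unfolding f by simp
  also have "Sw S (J \<otimes> W) \<odot> Sg J S W = Ali J W S \<odot> (Idt J \<star> Sw S W)"
    by (simp add: Sw_Sg)
  also have "(Mv A A' D' \<odot> (Mv A' B' D' \<odot> (q' \<star> h') \<star> a)) \<odot> Ali J W S \<odot> (Idt J \<star> Sw S W)
      = (Mv A B' D' \<odot> (q' \<star> Mv A A' B' \<odot> (h' \<star> a))) \<odot> (Idt J \<star> Sw S W)"
    using Mv_assoc'[OF VV, of A A' B' D' q' h' a] by simp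
  also have "\<dots> = Mv A B' D' \<odot> (q' \<star> (Mv A A' B' \<odot> (h' \<star> a)) \<odot> Sw S W)"
    by simp
  finally show ?thesis .
qed

end

section \<open>Theories, their morphisms and the pullback of algebras\<close>

context arity_system
begin

lemma theoryD:
  assumes "is_theory T"
  shows "vcategory (tcat T)" "vob (tcat T) = \<J>" "vfunctor (vop (vself_on \<J>)) (tcat T) (tstr T)"
    "preserves_powers \<J> (vop (vself_on \<J>)) (tcat T) (tstr T)" "X \<in> \<J> \<Longrightarrow> fob (tstr T) X = X"
  using assms by (simp_all add: is_theory_def)

declare theoryD(1,2) [simp]

lemma arities_in [simp]: "X \<in> \<J> \<Longrightarrow> X \<in> Ob V"
  using arities_sub by blast

lemma Ob_Th [simp]: "T \<in> Ob Th \<longleftrightarrow> is_theory T"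
  by (simp add: Th_def)

lemma Hom_Th: "M \<in> Hom Th T U \<longleftrightarrow> vfunctor (tcat T) (tcat U) M \<and> vfun_cmp \<J> M (tstr T) = tstr U"
  by (simp add: Th_def)

lemma cmp_Th [simp]: "cmp Th M N = vfun_cmp \<J> M N"
  by (simp add: Th_def)

lemma ident_Th [simp]: "ident Th T = vfun_id (tcat T)"
  by (simp add: Th_def)

text \<open>Both structure functors are the identity on objects, and \<open>M\<close> commutes with
  them. Pulled-back algebras therefore keep their values, and components over different theories can
  be compared directly.\<close>

lemma morphism_fob:
  assumes "M \<in> Hom Th T U" "is_theory T" "is_theory U" "X \<in> \<J>"
  shows "fob M X = X"
proof -
  have "fob (vfun_cmp \<J> M (tstr T)) X = X" using assms by (simp add: Hom_Th theoryD(5))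
  then show ?thesis using assms by (simp add: vfun_cmp_simps theoryD(5))
qed

lemma category_Th: "category Th"
proof
  fix T U assume "T \<in> Ob Th" "U \<in> Ob Th"
  then have T: "is_theory T" "is_theory U" by simp_all
  note str = theoryD(3)[OF T(1)]
  show "\<iota>\<^bsub>Th\<^esub> T \<in> Hom Th T T"
    using vfun_id_cmp[OF str] vfunctor_id[of "tcat T"] T by (simp add: Hom_Th)
  fix M assume M: "M \<in> Hom Th T U"
  show "\<iota>\<^bsub>Th\<^esub> U \<cdot>\<^bsub>Th\<^esub> M = M" "M \<cdot>\<^bsub>Th\<^esub> \<iota>\<^bsub>Th\<^esub> T = M"
    using M vfun_id_cmp[of "tcat T" "tcat U" M] vfun_cmp_id[of "tcat T" "tcat U" M] T by (simp_all add: Hom_Th)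
next
  fix T1 T2 T3 M N assume "T1 \<in> Ob Th" "T2 \<in> Ob Th" "T3 \<in> Ob Th"
    and M: "M \<in> Hom Th T1 T2" and N: "N \<in> Hom Th T2 T3"
  then have T: "is_theory T1" "is_theory T2" "is_theory T3" by simp_all
  note str = theoryD(3)[OF T(1)]
  show "N \<cdot>\<^bsub>Th\<^esub> M \<in> Hom Th T1 T3"
    using M N T vfun_cmp_assoc[OF str, of "tcat T2" M "tcat T3" N \<J> \<J>]
      vfunctor_cmp[of "tcat T1" "tcat T2" M "tcat T3" N \<J>]
    by (simp add: Hom_Th)
next
  fix T1 T2 T3 T4 M N L assume "T1 \<in> Ob Th" "T2 \<in> Ob Th" "T3 \<in> Ob Th" "T4 \<in> Ob Th"
    "M \<in> Hom Th T1 T2" "N \<in> Hom Th T2 T3" "L \<in> Hom Th T3 T4"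
  then show "L \<cdot>\<^bsub>Th\<^esub> N \<cdot>\<^bsub>Th\<^esub> M = L \<cdot>\<^bsub>Th\<^esub> (N \<cdot>\<^bsub>Th\<^esub> M)"
    using vfun_cmp_assoc[of "tcat T1" "tcat T2" M "tcat T3" N "tcat T4" L \<J> \<J>] by (simp add: Hom_Th)
qed

text \<open>The structure functor supplies the power \<open>J \<otimes> X\<close> of \<open>X\<close>, which every morphism of theories
  preserves.\<close>

lemma preserves_powers_morphism:
  assumes M: "M \<in> Hom Th T U" and T: "is_theory T" and U: "is_theory U"
    and J [simp]: "J \<in> \<J>" and X [simp]: "X \<in> \<J>" and P: "tpower (tcat T) J X P k"
  shows "tpower (tcat U) J X P (tfh (tcat T) (tcat U) M P X \<odot> k)"
proof -
  note [simp] = arities_tens theoryD(5)[OF T] theoryD(5)[OF U] morphism_fob[OF M T U]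
  let ?op = "vop (vself_on \<J>)" and ?k = "Cu J X (J \<otimes> X) (Idt (J \<otimes> X))"
  have M': "vfunctor (tcat T) (tcat U) M" "vfun_cmp \<J> M (tstr T) = tstr U" using M by (simp_all add: Hom_Th)
  \<comment> \<open>\<open>J \<otimes> X\<close> is a power of \<open>X\<close> in the opposite of
    the arities, and the structure functor of a theory preserves it.\<close>
  have power: "tpower (tcat T') J X (J \<otimes> X) (tfh ?op (tcat T') (tstr T') (J \<otimes> X) X \<odot> ?k)"
    if T': "is_theory T'" for T'
  proof -
    note str = theoryD(3,4)[OF T']
    have "tpower ?op J X (J \<otimes> X) ?k" by (rule tpower_vop_vself) (auto simp: arities_sub)
    then show ?thesis
      using str(2)[unfolded preserves_powers_iff[OF str(1) arities_sub], rule_format, of J X "J \<otimes> X" ?k]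
      by (simp add: theoryD(5)[OF T'])
  qed
  have "arr (tfh ?op (tcat T) (tstr T) (J \<otimes> X) X)"
    by (rule vfunctor_arr[OF theoryD(3)[OF T]]) auto
  moreover have "arr (tfh (tcat T) (tcat U) M (J \<otimes> X) X)"
    by (rule vfunctor_arr[OF M'(1)]) (use T in auto)
  moreover have "tfh ?op (tcat U) (tstr U) (J \<otimes> X) X
      = tfh (tcat T) (tcat U) M (J \<otimes> X) X \<odot> tfh ?op (tcat T) (tstr T) (J \<otimes> X) X"
    using tfh_vfun_cmp[of "J \<otimes> X" \<J> X ?op "tcat U" M "tstr T" "tcat T"] by (simp add: M'(2))
  \<comment> \<open>\<open>M\<close> carries one structure functor to the other, so the image under
    \<open>M\<close> of the standard power in \<open>T\<close> is the standard power in
    \<open>U\<close>; \<open>tpower_preserved\<close> extends this to the given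
    \<open>P\<close>.\<close>
  ultimately have "tpower (tcat U) J X (J \<otimes> X) (tfh (tcat T) (tcat U) M (J \<otimes> X) X \<odot> tfh ?op (tcat T) (tstr T) (J \<otimes> X) X \<odot> ?k)"
    using power[OF U] by simp
  moreover have "P \<in> \<J>" using P T by (simp add: tpower_def)
  ultimately show ?thesis
    using tpower_preserved[OF M'(1) _ power[OF T] _ P] T by simp
qed

lemma algs_vfunctor: "A \<in> algs T \<Longrightarrow> vfunctor (tcat T) VV A"
  by (simp add: algs_def)

text \<open>Powers are carried along \<open>M\<close> by \<open>preserves_powers_morphism\<close>,
  and from there by \<open>A\<close>.\<close>

lemma alg_pull_in:
  assumes M: "M \<in> Hom Th T U" and T: "is_theory T" and U: "is_theory U" and A: "A \<in> algs U"
  shows "alg_pull M A \<in> algs T"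
proof -
  note [simp] = morphism_fob[OF M T U]
  have M': "vfunctor (tcat T) (tcat U) M" using M by (simp add: Hom_Th)
  have A': "vfunctor (tcat U) VV A" "preserves_powers \<J> (tcat U) VV A" using A by (simp_all add: algs_def)
  have MA: "vfunctor (tcat T) VV (alg_pull M A)"
    unfolding alg_pull_def by (rule vfunctor_cmp[OF M' A'(1)]) (simp add: T)
  have "tpower VV J (fob (alg_pull M A) X) (fob (alg_pull M A) P) (tfh (tcat T) VV (alg_pull M A) P X \<odot> k)"
    if J [simp]: "J \<in> \<J>" and X [simp]: "X \<in> \<J>" and P: "tpower (tcat T) J X P k" for J X P k
  proof -
    have [simp]: "P \<in> \<J>" "arr k" "tcod k = vhom (tcat T) P X" using P T by (simp_all add: tpower_def)
    have [simp]: "arr (tfh (tcat T) (tcat U) M P X)" "arr (tfh (tcat U) VV A P X)"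
      by (rule vfunctor_arr[OF M'] vfunctor_arr[OF A'(1)]; simp add: T U)+
    show ?thesis
      using A'(2)[unfolded preserves_powers_iff[OF A'(1) arities_sub], rule_format, OF J _ preserves_powers_morphism[OF M T U J X P]]
      by (simp add: alg_pull_def vfun_cmp_simps tfh_vfun_cmp[where D = "tcat U"] U)
  qed
  then have "preserves_powers \<J> (tcat T) VV (alg_pull M A)"
    unfolding preserves_powers_iff[OF MA arities_sub] by (simp add: T)
  then show ?thesis using MA by (simp add: algs_def)
qed

lemma alg_pull_pull:
  assumes "M \<in> Hom Th T2 T1" "N \<in> Hom Th T3 T2" "is_theory T1" "is_theory T2" "is_theory T3" "A \<in> algs T1"
  shows "alg_pull (vfun_cmp \<J> M N) A = alg_pull N (alg_pull M A)"
  using assms vfun_cmp_assoc[of "tcat T3" "tcat T2" N "tcat T1" M VV A \<J> \<J>]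
  by (simp add: alg_pull_def Hom_Th algs_def)

lemma alg_pull_id:
  assumes "is_theory T" "A \<in> algs T"
  shows "alg_pull (vfun_id (tcat T)) A = A"
  using vfun_cmp_id[of "tcat T" VV A] assms by (simp add: alg_pull_def algs_def)

end

context amenable_arity_system
begin

lemma vfun_category_algs:
  assumes "is_theory T"
  shows "vfun_category V (tcat T) (algs T)"
  using amenable assms by unfold_locales (auto simp: is_amenable_def algs_def)

text \<open>The second claim mentions a theory because amenability speaks about the adjunction of
  each theory, whose evaluation functor has target \<open>VV\<close>.\<close>

lemma vcategory_AlgV: "is_theory T \<Longrightarrow> vcategory (AlgV T)"
  and vcategory_VV: "is_theory T \<Longrightarrow> vcategory VV"
  using amenable unfolding is_amenable_def has_left_adjoint_def by (blast dest: vfunctor_vcategory)+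

end

section \<open>A bifold algebra as a functor into algebras\<close>

locale bifold_algebra = amenable_arity_system V \<J>
  for V :: "('o, 'm) smc" (structure) and \<J> :: "'o set" +
  fixes T U :: "('o, 'm) jtheory" and D :: "('o \<times> 'o, 'o, 'm) vfun"
  assumes T [simp]: "is_theory T" and U [simp]: "is_theory U" and D_balgs: "D \<in> balgs T U"
begin

sublocale vbifunctor V "tcat T" "tcat U" VV D
  using D_balgs by unfold_locales (auto simp: balgs_def)

sublocale algs: vfun_category V "tcat T" "algs T"
  by (rule vfun_category_algs) simp

lemma D_Ob [simp]: "\<lbrakk>X \<in> \<J>; K \<in> \<J>\<rbrakk> \<Longrightarrow> fob D (X, K) \<in> Ob V"
  using D_in[of X K] by simp

lemma VV [simp]: "vcategory VV"
  using vcategory_VV[OF T] .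

lemma AlgV [simp]: "vcategory (AlgV T)"
  using vcategory_AlgV[OF T] .

lemma vob_AlgV [simp]: "vob (AlgV T) = algs T"
  by (simp add: AlgV_def)

lemma vhom_AlgV [simp]: "vhom (AlgV T) A B = end_ob (tcat T) A B"
  by (simp add: AlgV_def)

lemma at_right_in [simp]: "K \<in> \<J> \<Longrightarrow> at_right T U D K \<in> algs T"
  using D_balgs vfunctor_fix_right[of K] by (simp add: algs_def balgs_def)

text \<open>The wedge condition compares the two orders in which the variables act, and
  \<open>rr_ll\<close> and \<open>ll_rr\<close> evaluate them to the same arrow up to the
  symmetry.\<close>

lemma twedge_at_left:
  assumes [simp]: "K \<in> \<J>" "K' \<in> \<J>"
  shows "twedge (tcat T) (at_right T U D K) (at_right T U D K') (vhom (tcat U) K K') (\<lambda>X. ll X K K')"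
  using rr_ll ll_rr by (simp add: twedge_def tcmp_vself_on)

abbreviation "tr \<equiv> balg_transpose T U D"

lemma tfh_transpose:
  assumes [simp]: "K \<in> \<J>" "K' \<in> \<J>"
  shows "tfh (tcat U) (AlgV T) tr K K'
    = el (tcat T) (at_right T U D K) (at_right T U D K') (vhom (tcat U) K K') (\<lambda>X. ll X K K')"
  by (simp add: tfh_def el_def balg_transpose_def mk_vfun_simps)

lemma transpose_simps:
  "K \<in> \<J> \<Longrightarrow> fob tr K = at_right T U D K"
  "fob tr \<in> extensional \<J>" "case_prod (fhom tr) \<in> extensional (\<J> \<times> \<J>)"
  by (simp_all add: balg_transpose_def mk_vfun_simps)

lemma transpose_props:
  assumes [simp]: "K \<in> \<J>" "K' \<in> \<J>"
  shows "arr (tfh (tcat U) (AlgV T) tr K K')"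
    and "X \<in> \<J> \<Longrightarrow> ep (tcat T) (at_right T U D K) (at_right T U D K') X \<odot> tfh (tcat U) (AlgV T) tr K K' = ll X K K'"
proof -
  interpret vend V "tcat T" "at_right T U D K" "at_right T U D K'"
    by (rule algs.vend) auto
  show "arr (tfh (tcat U) (AlgV T) tr K K')"
    and "X \<in> \<J> \<Longrightarrow> ep (tcat T) (at_right T U D K) (at_right T U D K') X \<odot> tfh (tcat U) (AlgV T) tr K K' = ll X K K'"
    using el_props[OF twedge_at_left[of K K']] by (simp_all add: tfh_transpose)
qed

text \<open>The projections are jointly monic, and the projection at \<open>X\<close> turns each
  functor law into that law for \<open>D(X,-)\<close>.\<close>

lemma vfunctor_transpose: "vfunctor (tcat U) (AlgV T) tr"
proof (rule vfunctorI)
  note [simp] = transpose_simps(1) transpose_props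
  fix K assume "K \<in> vob (tcat U)"
  then have K [simp]: "K \<in> \<J>" by simp
  interpret vend V "tcat T" "at_right T U D K" "at_right T U D K"
    by (rule algs.vend) auto
  note tid = algs.tid_props[OF at_right_in[OF K], folded AlgV_def]
  show "tfh (tcat U) (AlgV T) tr K K \<odot> tid (tcat U) K = tid (AlgV T) (fob tr K)"
  proof (rule ep_inject)
    fix X assume "X \<in> vob (tcat T)"
    then have X [simp]: "X \<in> \<J>" by simp
    have "ep (tcat T) (at_right T U D K) (at_right T U D K) X \<odot> tfh (tcat U) (AlgV T) tr K K \<odot> tid (tcat U) K
        = ll X K K \<odot> tid (tcat U) K"
      by (subst reassoc[OF transpose_props(2)]) auto
    also have "\<dots> = Elt (Idt (fob D (X, K)))"
      using vfunctor_tid[OF vfunctor_fix_left[of X], of K] by (simp add: tid_vself_on)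
    finally show "ep (tcat T) (at_right T U D K) (at_right T U D K) X \<odot> tfh (tcat U) (AlgV T) tr K K \<odot> tid (tcat U) K
        = ep (tcat T) (at_right T U D K) (at_right T U D K) X \<odot> tid (AlgV T) (fob tr K)"
      using tid(2)[of X] by simp
  qed (use tid(1) in simp_all)
next
  note [simp] = transpose_simps(1) transpose_props
  fix K K' K'' assume "K \<in> vob (tcat U)" "K' \<in> vob (tcat U)" "K'' \<in> vob (tcat U)"
  then have K [simp]: "K \<in> \<J>" "K' \<in> \<J>" "K'' \<in> \<J>" by simp_all
  interpret vend V "tcat T" "at_right T U D K" "at_right T U D K''"
    by (rule algs.vend) auto
  note tcmp = algs.tcmp_props[OF K[THEN at_right_in], folded AlgV_def]
  show "tfh (tcat U) (AlgV T) tr K K'' \<odot> tcmp (tcat U) K K' K''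
    = tcmp (AlgV T) (fob tr K) (fob tr K') (fob tr K'') \<odot> (tfh (tcat U) (AlgV T) tr K' K'' \<star> tfh (tcat U) (AlgV T) tr K K')"
  proof (rule ep_inject)
    fix X assume "X \<in> vob (tcat T)"
    then have X [simp]: "X \<in> \<J>" by simp
    have "ep (tcat T) (at_right T U D K) (at_right T U D K'') X \<odot> tfh (tcat U) (AlgV T) tr K K'' \<odot> tcmp (tcat U) K K' K''
        = ll X K K'' \<odot> tcmp (tcat U) K K' K''"
      by (subst reassoc[OF transpose_props(2)]) auto
    also have "\<dots> = Mv (fob D (X, K)) (fob D (X, K')) (fob D (X, K'')) \<odot> (ll X K' K'' \<star> ll X K K')"
      using vfunctor_tcmp[OF vfunctor_fix_left[of X], of K K' K''] by (simp add: tcmp_vself_on)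
    also have "\<dots> = ep (tcat T) (at_right T U D K) (at_right T U D K'') X
        \<odot> tcmp (AlgV T) (fob tr K) (fob tr K') (fob tr K'') \<odot> (tfh (tcat U) (AlgV T) tr K' K'' \<star> tfh (tcat U) (AlgV T) tr K K')"
      using tcmp(1) by (simp add: reassoc[OF tcmp(2)])
    finally show "ep (tcat T) (at_right T U D K) (at_right T U D K'') X \<odot> tfh (tcat U) (AlgV T) tr K K'' \<odot> tcmp (tcat U) K K' K'' = \<dots>" .
  qed (use tcmp(1) in simp_all)
qed (simp_all add: transpose_simps transpose_props)

end

section \<open>The algebra of homomorphisms from an algebra to a bifold algebra\<close>

locale hom_algebra = bifold_algebra V \<J> T U D
  for V :: "('o, 'm) smc" (structure) and \<J> :: "'o set" and T U D +
  fixes A :: "('o, 'o, 'm) vfun"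
  assumes A [simp]: "A \<in> algs T"
begin

abbreviation "HA \<equiv> HomAlg T U A D"
abbreviation "HO K \<equiv> end_ob (tcat T) A (at_right T U D K)"
abbreviation "pr K X \<equiv> ep (tcat T) A (at_right T U D K) X"
abbreviation "uc K X \<equiv> Uc (fob A X) (fob D (X, K))"

lemma A_functor: "vfunctor (tcat T) VV A"
  using A by (simp add: algs_def)

lemma A_Ob [simp]: "X \<in> \<J> \<Longrightarrow> fob A X \<in> Ob V"
  using vfunctor_fob[OF A_functor] by simp

lemma vend_HA: "K \<in> \<J> \<Longrightarrow> vend V (tcat T) A (at_right T U D K)"
  by (rule algs.vend) auto

lemma arr_pr [simp]: "\<lbrakk>K \<in> \<J>; X \<in> \<J>\<rbrakk> \<Longrightarrow> arr (pr K X)"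
  by (rule algs.arr_ep) auto

lemma vfunctor_HA: "vfunctor (tcat U) VV HA"
  unfolding HomAlg_def
  by (rule vfunctor_cmp[OF vfunctor_transpose vfunctor_representable]) auto

lemma fob_HA [simp]: "K \<in> \<J> \<Longrightarrow> fob HA K = HO K"
  by (simp add: HomAlg_def vfun_cmp_simps representable_simps transpose_simps)

lemma HA_Ob: "K \<in> \<J> \<Longrightarrow> HO K \<in> Ob V"
  by simp

text \<open>The functor is a representable after the transpose, so its action is composition in
  \<open>AlgV T\<close>. The projections compute this composition componentwise and send the
  transpose to \<open>ll\<close>.\<close>

lemma act_HA:
  assumes [simp]: "K \<in> \<J>" "K' \<in> \<J>"
  shows "arr (act (tcat U) HA K K')"
    and "X \<in> \<J> \<Longrightarrow> pr K' X \<odot> act (tcat U) HA K K'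
      = Mv (fob A X) (fob D (X, K)) (fob D (X, K')) \<odot> (ll X K K' \<star> pr K X)"
proof -
  note tcmp = algs.tcmp_props[OF A at_right_in[of K] at_right_in[of K'], folded AlgV_def]
  note [simp] = transpose_props
  show arr: "arr (act (tcat U) HA K K')"
    using arr_act[OF vfunctor_HA] by simp
  have rep: "arr (tfh (AlgV T) VV (representable (AlgV T) A) (at_right T U D K) (at_right T U D K'))"
    by (rule vfunctor_arr[OF vfunctor_representable]) auto
  have "act (tcat U) HA K K' = Uc (HO K) (HO K')
      (tfh (AlgV T) VV (representable (AlgV T) A) (at_right T U D K) (at_right T U D K') \<odot> tfh (tcat U) (AlgV T) tr K K')"
    unfolding act_def using tfh_vfun_cmp[of K \<J> K' "tcat U" VV "representable (AlgV T) A" tr "AlgV T"]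
    by (simp add: HomAlg_def[symmetric] transpose_simps)
  also have "\<dots> = act (AlgV T) (representable (AlgV T) A) (at_right T U D K) (at_right T U D K')
      \<odot> (tfh (tcat U) (AlgV T) tr K K' \<star> Idt (HO K))"
    using rep by (simp add: Uc_seq act_def representable_simps transpose_simps)
  also have "\<dots> = tcmp (AlgV T) A (at_right T U D K) (at_right T U D K')
      \<odot> (tfh (tcat U) (AlgV T) tr K K' \<star> Idt (HO K))"
    by (simp add: act_representable)
  finally have "act (tcat U) HA K K' = tcmp (AlgV T) A (at_right T U D K) (at_right T U D K')
      \<odot> (tfh (tcat U) (AlgV T) tr K K' \<star> Idt (HO K))" .
  then show "pr K' X \<odot> act (tcat U) HA K K'
      = Mv (fob A X) (fob D (X, K)) (fob D (X, K')) \<odot> (ll X K K' \<star> pr K X)" if [simp]: "X \<in> \<J>"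
    using tcmp(1) by (simp add: reassoc[OF tcmp(2)] transpose_simps)
qed

lemma HA_inject:
  assumes K: "K \<in> \<J>" and h: "arr h" "arr h'" "tdom h = tdom h'"
    "tcod h = HO K" "tcod h' = HO K"
    and eq: "\<And>X. X \<in> \<J> \<Longrightarrow> uc K X (pr K X \<odot> h) = uc K X (pr K X \<odot> h')"
  shows "h = h'"
proof (rule vend.ep_inject[OF vend_HA[OF K] h])
  fix X assume "X \<in> vob (tcat T)"
  then have [simp]: "X \<in> \<J>" by simp
  show "pr K X \<odot> h = pr K X \<odot> h'"
    by (rule Uc_inject[OF eq]) (use K h in auto)
qed

text \<open>The power \<open>P\<close> of \<open>X\<close> gives powers of all \<open>D(L, X)\<close>, along which the wedge defining an
  arrow into \<open>HA X\<close> lifts to one defining an arrow into \<open>HA P\<close>.\<close>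

lemma HA_power:
  assumes j [simp]: "j \<in> \<J>" and X [simp]: "X \<in> \<J>" and P: "tpower (tcat U) j X P k"
  shows "tpower VV j (fob HA X) (fob HA P) (tfh (tcat U) VV HA P X \<odot> k)"
proof -
  have [simp]: "P \<in> \<J>" "arr k" "tdom k = j" "tcod k = vhom (tcat U) P X"
    using P by (auto simp: tpower_def)
  note [simp] = act_HA(1)
  have HA_arr [simp]: "arr (tfh (tcat U) VV HA P X)"
    by (rule vfunctor_arr[OF vfunctor_HA]) auto
  \<comment> \<open>\<open>D(L,-)\<close> preserves powers for every arity \<open>L\<close>, so it
    sends the given power to one in \<open>V\<close>.\<close>
  have power: "tpower VV j (fob D (L, X)) (fob D (L, P)) (ll L P X \<odot> k)" if L [simp]: "L \<in> \<J>" for L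
  proof -
    have F: "vfunctor (tcat U) VV (at_left T U D L)" by (rule vfunctor_fix_left) simp
    have "preserves_powers \<J> (tcat U) VV (at_left T U D L)" using D_balgs L by (simp add: balgs_def)
    from this[unfolded preserves_powers_iff[OF F arities_sub], rule_format, OF j _ P] show ?thesis by simp
  qed
  interpret HP: vend V "tcat T" A "at_right T U D P" by (rule vend_HA) simp
  interpret HX: vend V "tcat T" A "at_right T U D X" by (rule vend_HA) simp
  show ?thesis
  proof (rule tpower_VV)
    fix W f assume W [simp]: "W \<in> Ob V" and f [simp]: "arr f" "tdom f = j \<otimes> W" and "tcod f = fob HA X"
    then have tcf [simp]: "tcod f = HO X" by simp
    have Uc_act: "Uc (fob HA P) (fob HA X) (tfh (tcat U) VV HA P X \<odot> k) \<odot> (Idt j \<star> h) = act (tcat U) HA P X \<odot> (k \<star> h)"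
      if "arr h" "tdom h = W" "tcod h = fob HA P" for h
      using that by (simp add: Uc_seq act_def)
    have pr_act: "pr X L \<odot> act (tcat U) HA P X \<odot> (k \<star> h)
        = Mv (fob A L) (fob D (L, P)) (fob D (L, X)) \<odot> (ll L P X \<odot> k \<star> pr P L \<odot> h)"
      if "arr h" "tcod h = fob HA P" "L \<in> \<J>" for h L
      using that by (subst reassoc[OF act_HA(2)]) auto
    \<comment> \<open>\<open>f\<close> is lifted one component at a time: the component at
      \<open>L\<close> factors through the power \<open>D(L,P)\<close>.\<close>
    have "\<exists>h. arr h \<and> tdom h = W \<and> tcod h = fob A L \<Rrightarrow> fob D (L, P)
        \<and> Mv (fob A L) (fob D (L, P)) (fob D (L, X)) \<odot> (ll L P X \<odot> k \<star> h) = pr X L \<odot> f" if L [simp]: "L \<in> \<J>" for L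
      by (rule tpower_lift[OF power, of L "fob A L" "pr X L \<odot> f" W]) (auto simp: tcmp_vself_on)
    then obtain w where w: "arr (w L)" "tdom (w L) = W" "tcod (w L) = fob A L \<Rrightarrow> fob D (L, P)"
        "Mv (fob A L) (fob D (L, P)) (fob D (L, X)) \<odot> (ll L P X \<odot> k \<star> w L) = pr X L \<odot> f" if "L \<in> \<J>" for L
      by metis
    have wedge: "twedge (tcat T) A (at_right T U D P) W w"
    proof -
      have "Mv (fob A L) (fob D (L, P)) (fob D (L', P)) \<odot> (rr P L L' \<star> w L)
        = (Mv (fob A L) (fob A L') (fob D (L', P)) \<odot> (w L' \<star> tfh (tcat T) VV A L L')) \<odot> Sw (vhom (tcat T) L L') W"
        if L [simp]: "L \<in> \<J>" "L' \<in> \<J>" for L L'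
      proof -
        note [simp] = w[OF L(1)] w[OF L(2)]
        have [simp]: "arr (tfh (tcat T) VV A L L')" by (rule vfunctor_arr[OF A_functor]) auto
        \<comment> \<open>The counits \<open>ll L P X \<odot> k\<close> are natural in
          \<open>L\<close>, because the actions of the two variables of \<open>D\<close> commute up
          to the symmetry.\<close>
        have comm: "Mv (fob D (L, P)) (fob D (L', P)) (fob D (L', X)) \<odot> (ll L' P X \<odot> k \<star> rr P L L')
          = (Mv (fob D (L, P)) (fob D (L, X)) (fob D (L', X)) \<odot> (rr X L L' \<star> ll L P X \<odot> k)) \<odot> Sw j (vhom (tcat T) L L')"
        proof -
          have "Mv (fob D (L, P)) (fob D (L', P)) (fob D (L', X)) \<odot> (ll L' P X \<odot> k \<star> rr P L L')
            = (Mv (fob D (L, P)) (fob D (L', P)) (fob D (L', X)) \<odot> (ll L' P X \<star> rr P L L')) \<odot> (k \<star> Idt (vhom (tcat T) L L'))"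
            by simp
          also have "\<dots> = ((Mv (fob D (L, P)) (fob D (L, X)) (fob D (L', X)) \<odot> (rr X L L' \<star> ll L P X))
              \<odot> Sw (vhom (tcat U) P X) (vhom (tcat T) L L')) \<odot> (k \<star> Idt (vhom (tcat T) L L'))"
            using ll_rr_commute[of L L' P X] by (simp add: tcmp_vself_on)
          also have "\<dots> = (Mv (fob D (L, P)) (fob D (L, X)) (fob D (L', X)) \<odot> (rr X L L' \<star> ll L P X \<odot> k)) \<odot> Sw j (vhom (tcat T) L L')"
            by (simp add: Sw_natural)
          finally show ?thesis .
        qed
        have fw: "Mv (fob A L) (fob D (L, X)) (fob D (L', X)) \<odot>
            (rr X L L' \<star> Mv (fob A L) (fob D (L, P)) (fob D (L, X)) \<odot> (ll L P X \<odot> k \<star> w L))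
          = (Mv (fob A L) (fob A L') (fob D (L', X)) \<odot>
            (Mv (fob A L') (fob D (L', P)) (fob D (L', X)) \<odot> (ll L' P X \<odot> k \<star> w L') \<star> tfh (tcat T) VV A L L'))
            \<odot> Sw (vhom (tcat T) L L') (j \<otimes> W)"
          using twedge_natural[OF twedge_seq[OF HX.A HX.B HX.twedge_ep f(1) tcf], of L L'] by simp
        \<comment> \<open>By uniqueness for the power at \<open>L'\<close>, the wedge equation may
          be tested after composing with its counit. With \<open>comm\<close> it then follows from
          \<open>fw\<close>, the wedge equation for the projections of \<open>f\<close>.\<close>
        show ?thesis
        proof (rule tpower_inject[OF power[OF L(2)], of "fob A L"])
          show "tcmp VV (fob A L) (fob D (L', P)) (fob D (L', X)) \<odot> (ll L' P X \<odot> k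
              \<star> Mv (fob A L) (fob D (L, P)) (fob D (L', P)) \<odot> (rr P L L' \<star> w L))
            = tcmp VV (fob A L) (fob D (L', P)) (fob D (L', X)) \<odot> (ll L' P X \<odot> k
              \<star> (Mv (fob A L) (fob A L') (fob D (L', P)) \<odot> (w L' \<star> tfh (tcat T) VV A L L')) \<odot> Sw (vhom (tcat T) L L') W)"
            unfolding tcmp_vself_on[OF A_Ob[OF L(1)] D_Ob[OF L(2) \<open>P \<in> \<J>\<close>] D_Ob[OF L(2) X]]
            by (rule Mv_slide_lift[where d = "rr X L L'" and q = "ll L P X \<odot> k", OF VV _ _ _ _ _ _ _ _ _ _ _ _ _ _ _ _ _ _ _ _ _ _ _ _ _ _ _ comm fw]) auto
        qed auto
      qed
      then show ?thesis using w by (simp add: twedge_def)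
    qed
    show "\<exists>!h. arr h \<and> tdom h = W \<and> tcod h = fob HA P
        \<and> Uc (fob HA P) (fob HA X) (tfh (tcat U) VV HA P X \<odot> k) \<odot> (Idt j \<star> h) = f"
    proof
      let ?h = "el (tcat T) A (at_right T U D P) W w"
      note [simp] = HP.el_props[OF wedge]
      have "act (tcat U) HA P X \<odot> (k \<star> ?h) = f"
      proof (rule HX.ep_inject)
        fix L assume "L \<in> vob (tcat T)"
        then have [simp]: "L \<in> \<J>" by simp
        show "pr X L \<odot> act (tcat U) HA P X \<odot> (k \<star> ?h) = pr X L \<odot> f"
          by (simp add: pr_act w)
      qed auto
      then show "arr ?h \<and> tdom ?h = W \<and> tcod ?h = fob HA P
        \<and> Uc (fob HA P) (fob HA X) (tfh (tcat U) VV HA P X \<odot> k) \<odot> (Idt j \<star> ?h) = f"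
        using Uc_act[of ?h] by simp
    next
      fix h assume h: "arr h \<and> tdom h = W \<and> tcod h = fob HA P
        \<and> Uc (fob HA P) (fob HA X) (tfh (tcat U) VV HA P X \<odot> k) \<odot> (Idt j \<star> h) = f"
      then have f_eq: "f = act (tcat U) HA P X \<odot> (k \<star> h)" using Uc_act[of h] by simp
      show "h = el (tcat T) A (at_right T U D P) W w"
      proof (rule HP.ep_inject)
        fix L assume "L \<in> vob (tcat T)"
        then have L [simp]: "L \<in> \<J>" by simp
        \<comment> \<open>The projections of \<open>h\<close> solve the lifting problem that
          determines \<open>w L\<close>.\<close>
        have "pr P L \<odot> h = w L"
        proof (rule tpower_inject[OF power[OF L], of "fob A L"])
          show "tcmp VV (fob A L) (fob D (L, P)) (fob D (L, X)) \<odot> (ll L P X \<odot> k \<star> pr P L \<odot> h)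
            = tcmp VV (fob A L) (fob D (L, P)) (fob D (L, X)) \<odot> (ll L P X \<odot> k \<star> w L)"
            using w(4)[OF L] pr_act[of h L] h unfolding f_eq by (simp add: tcmp_vself_on)
        qed (use h w[OF L] in auto)
        then show "pr P L \<odot> h = pr P L \<odot> el (tcat T) A (at_right T U D P) W w"
          using HP.el_props(2)[OF wedge, of L] by simp
      qed (use h HP.el_props[OF wedge] in auto)
    qed
  qed auto
qed

lemma HA_in: "HA \<in> algs U"
  using vfunctor_HA HA_power by (simp add: algs_def preserves_powers_iff[OF vfunctor_HA arities_sub])

end

section \<open>Pulling back along pairs of theory morphisms\<close>

context symmetric_monoidal_closed
begin

lemma vfun_tensor_simps:
  "\<lbrakk>X \<in> S; Y \<in> S'\<rbrakk> \<Longrightarrow> fob (vfun_tensor S S' M N) (X, Y) = (fob M X, fob N Y)"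
  "\<lbrakk>X \<in> S; Y \<in> S'; X' \<in> S; Y' \<in> S'\<rbrakk>
    \<Longrightarrow> tfh (vtensor C E) (vtensor C' E') (vfun_tensor S S' M N) (X, Y) (X', Y') = tfh C C' M X X' \<star> tfh E E' N Y Y'"
  by (auto simp: vfun_tensor_def mk_vfun_simps tval_simps intro!: tar_eqI)

text \<open>Both laws hold factor by factor, the interchange being natural. That the tensor products
  are enriched categories is a hypothesis, discharged later by bifold algebras over them.\<close>

lemma vfunctor_tensor:
  assumes M: "vfunctor C C' M" and N: "vfunctor E E' N"
    and CE: "vcategory (vtensor C E)" "vcategory (vtensor C' E')" and S: "S = vob C" "S' = vob E"
  shows "vfunctor (vtensor C E) (vtensor C' E') (vfun_tensor S S' M N)"
proof -
  note [simp] = vfunctor_simps[OF N] vfunctor_simps[OF M] vfun_tensor_simps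
  show ?thesis unfolding S
  proof (rule vfunctorI)
    fix x assume "x \<in> vob (vtensor C E)"
    then obtain X Y where x: "x = (X, Y)" and [simp]: "X \<in> vob C" "Y \<in> vob E" by auto
    show "tfh (vtensor C E) (vtensor C' E') (vfun_tensor (vob C) (vob E) M N) x x \<odot> tid (vtensor C E) x
        = tid (vtensor C' E') (fob (vfun_tensor (vob C) (vob E) M N) x)"
      by (simp add: x tid_vtensor vfunctor_tid[OF M] vfunctor_tid[OF N])
  next
    fix x y z assume "x \<in> vob (vtensor C E)" "y \<in> vob (vtensor C E)" "z \<in> vob (vtensor C E)"
    then obtain X Y X' Y' X'' Y'' where x: "x = (X, Y)" "y = (X', Y')" "z = (X'', Y'')"
      and [simp]: "X \<in> vob C" "Y \<in> vob E" "X' \<in> vob C" "Y' \<in> vob E" "X'' \<in> vob C" "Y'' \<in> vob E"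
      by auto
    show "tfh (vtensor C E) (vtensor C' E') (vfun_tensor (vob C) (vob E) M N) x z \<odot> tcmp (vtensor C E) x y z
        = tcmp (vtensor C' E') (fob (vfun_tensor (vob C) (vob E) M N) x) (fob (vfun_tensor (vob C) (vob E) M N) y)
            (fob (vfun_tensor (vob C) (vob E) M N) z)
          \<odot> (tfh (vtensor C E) (vtensor C' E') (vfun_tensor (vob C) (vob E) M N) y z
            \<star> tfh (vtensor C E) (vtensor C' E') (vfun_tensor (vob C) (vob E) M N) x y)"
      by (simp add: x tcmp_vtensor vfunctor_tcmp[OF M] vfunctor_tcmp[OF N] Mid_natural)
  qed (use CE in \<open>auto, auto simp: vfun_tensor_def mk_vfun_simps(3,4)\<close>)
qed

lemma act_vfun_cmp:
  assumes M: "vfunctor C E M" and F: "vfunctor E VV F" and X [simp]: "X \<in> vob C" "Y \<in> vob C"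
  shows "act C (vfun_cmp (vob C) F M) X Y = act E F (fob M X) (fob M Y) \<odot> (tfh C E M X Y \<star> Idt (fob F (fob M X)))"
  using vfunctor_fob[OF F] vfunctor_arr[OF F] vfunctor_fob[OF M] vfunctor_arr[OF M]
  by (simp add: act_def tfh_vfun_cmp[where D = E] vfun_cmp_simps Uc_seq)

text \<open>The action of \<open>M\<close> is applied before the wedge equation is used, and the
  symmetry is natural in it. The action of \<open>alg_pullV\<close> on hom-objects rests on
  this.\<close>

lemma twedge_vfun_cmp:
  assumes M: "vfunctor C E M" and A: "vfunctor E VV A" and B: "vfunctor E VV B" and w: "twedge E A B W w"
  shows "twedge C (vfun_cmp (vob C) A M) (vfun_cmp (vob C) B M) W (\<lambda>X. w (fob M X))"
proof -
  note [simp] = vfunctor_simps[OF M] V_functor_simps[OF B] V_functor_simps[OF A]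
    twedge_arr[OF w] vfun_cmp_simps(1) tfh_vfun_cmp[where C = C and E = VV and D = E]
  have W [simp]: "W \<in> Ob V" using w by (simp add: twedge_def)
  have "Mv (fob A (fob M X)) (fob B (fob M X)) (fob B (fob M Y)) \<odot> (tfh E VV B (fob M X) (fob M Y) \<odot> tfh C E M X Y \<star> w (fob M X))
    = (Mv (fob A (fob M X)) (fob A (fob M Y)) (fob B (fob M Y)) \<odot> (w (fob M Y) \<star> tfh E VV A (fob M X) (fob M Y) \<odot> tfh C E M X Y)) \<odot> Sw (vhom C X Y) W"
    if [simp]: "X \<in> vob C" "Y \<in> vob C" for X Y
  proof -
    have "Mv (fob A (fob M X)) (fob B (fob M X)) (fob B (fob M Y)) \<odot> (tfh E VV B (fob M X) (fob M Y) \<odot> tfh C E M X Y \<star> w (fob M X))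
      = (Mv (fob A (fob M X)) (fob B (fob M X)) (fob B (fob M Y)) \<odot> (tfh E VV B (fob M X) (fob M Y) \<star> w (fob M X))) \<odot> (tfh C E M X Y \<star> Idt W)"
      by simp
    also have "\<dots> = (Mv (fob A (fob M X)) (fob A (fob M Y)) (fob B (fob M Y)) \<odot> (w (fob M Y) \<star> tfh E VV A (fob M X) (fob M Y)))
        \<odot> Sw (vhom E (fob M X) (fob M Y)) W \<odot> (tfh C E M X Y \<star> Idt W)"
      by (subst twedge_natural[OF w]) auto
    also have "\<dots> = (Mv (fob A (fob M X)) (fob A (fob M Y)) (fob B (fob M Y)) \<odot> (w (fob M Y) \<star> tfh E VV A (fob M X) (fob M Y) \<odot> tfh C E M X Y)) \<odot> Sw (vhom C X Y) W"
      by (simp add: Sw_natural)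
    finally show ?thesis .
  qed
  then show ?thesis unfolding twedge_def by simp
qed

end

context vbifunctor
begin

text \<open>A functor preserves identities, so an identity may be inserted before or after pulling
  back. Each partial functor of the pulled-back functor is thus a composite.\<close>

lemma fix_pull:
  assumes M: "vfunctor C' C M" and N: "vfunctor E' E N"
  shows "Y \<in> vob E' \<Longrightarrow> fix_right C' E' (vfun_cmp (vob C' \<times> vob E') D (vfun_tensor (vob C') (vob E') M N)) Y
      = vfun_cmp (vob C') (fix_right C E D (fob N Y)) M"
    and "X \<in> vob C' \<Longrightarrow> fix_left C' E' (vfun_cmp (vob C' \<times> vob E') D (vfun_tensor (vob C') (vob E') M N)) X
      = vfun_cmp (vob E') (fix_left C E D (fob M X)) N"
proof -
  let ?D = "vfun_cmp (vob C' \<times> vob E') D (vfun_tensor (vob C') (vob E') M N)"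
  note [simp] = vfunctor_simps[OF N] vfunctor_simps[OF M] vfun_tensor_simps
  have pull: "tfh (vtensor C' E') B ?D (X, Y) (X', Y') = dd (fob M X) (fob N Y) (fob M X') (fob N Y') \<odot> (tfh C' C M X X' \<star> tfh E' E N Y Y')"
    if "X \<in> vob C'" "Y \<in> vob E'" "X' \<in> vob C'" "Y' \<in> vob E'" for X Y X' Y'
    using that by (subst tfh_vfun_cmp[where D = "vtensor C E"]) auto
  show "fix_right C' E' ?D Y = vfun_cmp (vob C') (fix_right C E D (fob N Y)) M" if Y [simp]: "Y \<in> vob E'"
  proof (rule vfun_eqI[where S = "vob C'"])
    fix X X' assume X [simp]: "X \<in> vob C'" "X' \<in> vob C'"
    let ?h = "vhom C' X X'"
    have "tval (tfh C' B (fix_right C' E' ?D Y) X X')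
        = tval ((tfh (vtensor C' E') B ?D (X, Y) (X', Y) \<odot> (Idt ?h \<star> tid E' Y)) \<odot> Rui ?h)"
      by (simp add: fix_right_def mk_vfun_simps tval_simps del: seq_assoc)
    also have "\<dots> = tval (dd (fob M X) (fob N Y) (fob M X') (fob N Y) \<odot> (tfh C' C M X X' \<star> tid E (fob N Y)) \<odot> Rui ?h)"
      by (simp add: pull vfunctor_tid[OF N])
    also have "\<dots> = tval (rr (fob N Y) (fob M X) (fob M X') \<odot> tfh C' C M X X')"
      by (simp add: rr_eq Rui_natural)
    finally show "fhom (fix_right C' E' ?D Y) X X' = fhom (vfun_cmp (vob C') (fix_right C E D (fob N Y)) M) X X'"
      by (simp add: vfun_cmp_simps tval_simps)
  qed (auto simp: fix_right_def mk_vfun_simps vfun_cmp_simps)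
  show "fix_left C' E' ?D X = vfun_cmp (vob E') (fix_left C E D (fob M X)) N" if X [simp]: "X \<in> vob C'"
  proof (rule vfun_eqI[where S = "vob E'"])
    fix Y Y' assume Y [simp]: "Y \<in> vob E'" "Y' \<in> vob E'"
    let ?h = "vhom E' Y Y'"
    have "tval (tfh E' B (fix_left C' E' ?D X) Y Y')
        = tval ((tfh (vtensor C' E') B ?D (X, Y) (X, Y') \<odot> (tid C' X \<star> Idt ?h)) \<odot> Lui ?h)"
      by (simp add: fix_left_def mk_vfun_simps tval_simps del: seq_assoc)
    also have "\<dots> = tval (dd (fob M X) (fob N Y) (fob M X) (fob N Y') \<odot> (tid C (fob M X) \<star> tfh E' E N Y Y') \<odot> Lui ?h)"
      by (simp add: pull vfunctor_tid[OF M])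
    also have "\<dots> = tval (ll (fob M X) (fob N Y) (fob N Y') \<odot> tfh E' E N Y Y')"
      by (simp add: ll_eq Lui_natural)
    finally show "fhom (fix_left C' E' ?D X) Y Y' = fhom (vfun_cmp (vob E') (fix_left C E D (fob M X)) N) Y Y'"
      by (simp add: vfun_cmp_simps tval_simps)
  qed (auto simp: fix_left_def mk_vfun_simps vfun_cmp_simps)
qed

end

context amenable_arity_system
begin

lemma balgs_vfunctor: "D \<in> balgs T U \<Longrightarrow> vfunctor (vtensor (tcat T) (tcat U)) VV D"
  by (simp add: balgs_def)

lemma balgs_vcategory: "D \<in> balgs T U \<Longrightarrow> vcategory (vtensor (tcat T) (tcat U))"
  by (rule vfunctor_vcategory[OF balgs_vfunctor])

text \<open>By \<open>fix_pull\<close> the partial functors are pulled-back algebras, so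
  \<open>alg_pull_in\<close> applies in each variable. \<open>E\<close> provides that the tensor
  product of \<open>tcat T2\<close> and \<open>tcat U2\<close> is an enriched category.\<close>

lemma balg_pull_in:
  assumes T: "is_theory T1" "is_theory U1" "is_theory T2" "is_theory U2"
    and M: "Ml \<in> Hom Th T2 T1" "Mr \<in> Hom Th U2 U1" and D: "D \<in> balgs T1 U1"
    and E: "E \<in> balgs T2 U2"
  shows "balg_pull Ml Mr D \<in> balgs T2 U2"
    and "K \<in> \<J> \<Longrightarrow> at_right T2 U2 (balg_pull Ml Mr D) K = alg_pull Ml (at_right T1 U1 D K)"
    and "K \<in> \<J> \<Longrightarrow> at_left T2 U2 (balg_pull Ml Mr D) K = alg_pull Mr (at_left T1 U1 D K)"
proof -
  interpret D: bifold_algebra V \<J> T1 U1 D using T D by unfold_locales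
  note [simp] = T morphism_fob[OF M(1) T(3,1)] morphism_fob[OF M(2) T(4,2)]
  have M': "vfunctor (tcat T2) (tcat T1) Ml" "vfunctor (tcat U2) (tcat U1) Mr" using M by (simp_all add: Hom_Th)
  note D' = balgs_vfunctor[OF D]
  have pull: "balg_pull Ml Mr D = vfun_cmp (vob (tcat T2) \<times> vob (tcat U2)) D (vfun_tensor (vob (tcat T2)) (vob (tcat U2)) Ml Mr)"
    by (simp add: balg_pull_def)
  show R: "at_right T2 U2 (balg_pull Ml Mr D) K = alg_pull Ml (at_right T1 U1 D K)" if "K \<in> \<J>" for K
    unfolding pull using that by (subst D.fix_pull(1)[OF M']) (simp_all add: alg_pull_def)
  show L: "at_left T2 U2 (balg_pull Ml Mr D) K = alg_pull Mr (at_left T1 U1 D K)" if "K \<in> \<J>" for K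
    unfolding pull using that by (subst D.fix_pull(2)[OF M']) (simp_all add: alg_pull_def)
  have "vfunctor (vtensor (tcat T2) (tcat U2)) VV (balg_pull Ml Mr D)"
    unfolding balg_pull_def
    by (rule vfunctor_cmp[OF vfunctor_tensor[OF M' balgs_vcategory[OF E] balgs_vcategory[OF D]] D']) simp_all
  moreover have "at_left T1 U1 D K \<in> algs U1" if "K \<in> \<J>" for K
    using that D D.vfunctor_fix_left[of K] by (simp add: algs_def balgs_def)
  ultimately show "balg_pull Ml Mr D \<in> balgs T2 U2"
    using alg_pull_in[OF M(1) T(3,1) D.at_right_in] alg_pull_in[OF M(2) T(4,2)]
    by (simp add: balgs_def R L) (simp add: algs_def)
qed

end

section \<open>Homomorphisms induced over fixed theories\<close>

locale hom_algebra_arrow = amenable_arity_system V \<J> + src: hom_algebra V \<J> T U D A + tgt: hom_algebra V \<J> T U D' A'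
  for V :: "('o, 'm) smc" (structure) and \<J> :: "'o set" and T U D A D' A' +
  fixes f :: "'o \<Rightarrow> 'm" and g :: "'o \<times> 'o \<Rightarrow> 'm"
  assumes f: "f \<in> vnat_V (tcat T) A' A" and g: "g \<in> balg_hom T U D D'"
begin

abbreviation "tf X \<equiv> Tar (fob A' X) (f X) (fob A X)"
abbreviation "tg X K \<equiv> Tar (fob D (X, K)) (g (X, K)) (fob D' (X, K))"

definition ha :: "'o \<Rightarrow> ('o, 'm) tar" where
  "ha K = Tar (src.HO K) (HomAlg_ar T U A D A' D' f g K)
    (tgt.HO K)"

lemma arr_tf [simp]: "X \<in> \<J> \<Longrightarrow> arr (tf X)"
  using f vnat_V_iff[OF tgt.A_functor src.A_functor] by simp

lemma arr_tg [simp]: "\<lbrakk>X \<in> \<J>; K \<in> \<J>\<rbrakk> \<Longrightarrow> arr (tg X K)"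
  using g vnat_V_iff[OF src.D tgt.D] by (simp add: balg_hom_def)

lemma g_right:
  assumes "K \<in> \<J>"
  shows "(\<lambda>X\<in>\<J>. g (X, K)) \<in> vnat_V (tcat T) (at_right T U D K) (at_right T U D' K)"
  using vnat_V_fix_right[OF _ _ src.D tgt.D, of g K] g assms by (simp add: balg_hom_def)

lemma g_left_natural:
  assumes [simp]: "X \<in> \<J>" "K \<in> \<J>" "K' \<in> \<J>"
  shows "tg X K' \<odot> Uc (fob D (X, K)) (fob D (X, K')) (src.ll X K K')
    = Uc (fob D' (X, K)) (fob D' (X, K')) (tgt.ll X K K') \<odot> (Idt (vhom (tcat U) K K') \<star> tg X K)"
proof -
  have "(\<lambda>K\<in>\<J>. g (X, K)) \<in> vnat_V (tcat U) (at_left T U D X) (at_left T U D' X)"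
    using vnat_V_fix_left[OF _ _ src.D tgt.D, of g X] g by (simp add: balg_hom_def)
  then show ?thesis
    using vnat_V_iff[OF src.vfunctor_fix_left[of X] tgt.vfunctor_fix_left[of X]] by (simp add: act_def)
qed

text \<open>Composition in \<open>AlgV T\<close> is componentwise, and composing with a name
  uncurries to composing with the arrow: \<open>g\<close> is applied after evaluation and
  \<open>f\<close> before it.\<close>

lemma ha_props:
  assumes K [simp]: "K \<in> \<J>"
  shows "arr (ha K)"
    and "X \<in> \<J> \<Longrightarrow> tgt.uc K X (tgt.pr K X \<odot> ha K)
      = tg X K \<odot> src.uc K X (src.pr K X) \<odot> (Idt (src.HO K) \<star> tf X)"
proof -
  let ?DK = "at_right T U D K" and ?DK' = "at_right T U D' K"
  let ?H = "end_ob (tcat T) A ?DK" and ?H' = "end_ob (tcat T) A ?DK'"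
  interpret A'A: vend V "tcat T" A' A by (rule src.algs.vend) auto
  interpret DD': vend V "tcat T" ?DK ?DK' by (rule src.algs.vend) auto
  let ?f = "Tar \<one> (vnat_elt (tcat T) A' A f) (end_ob (tcat T) A' A)"
  let ?g = "Tar \<one> (vnat_elt (tcat T) ?DK ?DK' (\<lambda>X\<in>\<J>. g (X, K))) (end_ob (tcat T) ?DK ?DK')"
  note f_props [simp] = A'A.vnat_elt_props[OF f, simplified]
  have g_props [simp]: "arr ?g" "X \<in> \<J> \<Longrightarrow> ep (tcat T) ?DK ?DK' X \<odot> ?g = Elt (tg X K)" for X
    using DD'.vnat_elt_props[OF g_right[OF K]] by simp_all
  note tcmp1 = src.algs.tcmp_props[OF src.A src.at_right_in[OF K] tgt.at_right_in[OF K], folded AlgV_def]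
  note tcmp2 = src.algs.tcmp_props[OF tgt.A src.A tgt.at_right_in[OF K], folded AlgV_def]
  have [simp]: "end_ob (tcat T) A ?DK' \<in> Ob V" "end_ob (tcat T) A ?DK \<in> Ob V"
    by (rule src.algs.end_ob_in; simp)+
  have [simp]: "arr (ep (tcat T) A ?DK' X)" "arr (ep (tcat T) ?DK ?DK' X)" "arr (ep (tcat T) A' A X)" if "X \<in> \<J>" for X
    using that by (simp_all add: src.algs.arr_ep)
  \<comment> \<open>\<open>?b\<close> composes with \<open>g\<close>, and \<open>?a\<close> then
    composes with \<open>f\<close>; these are the two factors of \<open>hom_map\<close>.\<close>
  let ?b = "tcmp (AlgV T) A ?DK ?DK' \<odot> (?g \<star> Idt ?H) \<odot> Lui ?H"
  let ?a = "tcmp (AlgV T) A' A ?DK' \<odot> (Idt ?H' \<star> ?f) \<odot> Rui ?H'"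
  have [simp]: "arr ?a" "arr ?b" using tcmp1(1) tcmp2(1) by simp_all
  have "?a \<odot> ?b = ((tcmp (AlgV T) A' A ?DK' \<odot> (Idt ?H' \<star> ?f)) \<odot> Rui ?H')
      \<odot> ((tcmp (AlgV T) A ?DK ?DK' \<odot> (?g \<star> Idt ?H)) \<odot> Lui ?H)"
    using tcmp1(1) tcmp2(1) by simp
  then have "tval (?a \<odot> ?b) = HomAlg_ar T U A D A' D' f g K"
    by (simp only: HomAlg_ar_def hom_map_def tval_simps tcmp_simps tar.sel src.vhom_AlgV K restrict_apply' if_True)
  then have ha: "ha K = ?a \<odot> ?b"
    by (intro tar_eqI) (simp_all add: ha_def)
  show "arr (ha K)" unfolding ha using tcmp1(1) tcmp2(1) by simp
  show "tgt.uc K X (tgt.pr K X \<odot> ha K)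
      = tg X K \<odot> src.uc K X (src.pr K X) \<odot> (Idt ?H \<star> tf X)" if X [simp]: "X \<in> \<J>"
  proof -
    have pb: "ep (tcat T) A ?DK' X \<odot> ?b = Mv (fob A X) (fob D (X, K)) (fob D' (X, K)) \<odot> (Elt (tg X K) \<star> src.pr K X) \<odot> Lui ?H"
      using tcmp1(1) by (simp add: reassoc[OF tcmp1(2)])
    have pa: "tgt.pr K X \<odot> ?a = Mv (fob A' X) (fob A X) (fob D' (X, K)) \<odot> (ep (tcat T) A ?DK' X \<star> Elt (tf X)) \<odot> Rui ?H'"
      using tcmp2(1) by (simp add: reassoc[OF tcmp2(2)])
    have "tgt.uc K X (tgt.pr K X \<odot> ha K)
        = tgt.uc K X (tgt.pr K X \<odot> ?a) \<odot> (?b \<star> Idt (fob A' X))"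
      unfolding ha by (subst Uc_seq[symmetric]; simp add: tcmp1(1) tcmp2(1))
    also have "tgt.uc K X (tgt.pr K X \<odot> ?a)
        = Uc (fob A X) (fob D' (X, K)) (ep (tcat T) A ?DK' X) \<odot> (Idt ?H' \<star> tf X)"
      unfolding pa using Uc_Mv_Elt_right[of "fob A' X" "fob A X" "fob D' (X, K)" "ep (tcat T) A ?DK' X" "tf X"] by simp
    also have "\<dots> \<odot> (?b \<star> Idt (fob A' X)) = Uc (fob A X) (fob D' (X, K)) (ep (tcat T) A ?DK' X \<odot> ?b) \<odot> (Idt ?H \<star> tf X)"
      using tcmp1(1) by (simp add: Uc_seq[of "ep (tcat T) A ?DK' X"])
    also have "Uc (fob A X) (fob D' (X, K)) (ep (tcat T) A ?DK' X \<odot> ?b) = tg X K \<odot> src.uc K X (src.pr K X)"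
      unfolding pb using Uc_Mv_Elt_left[of "fob A X" "fob D (X, K)" "fob D' (X, K)" "tg X K" "src.pr K X"] by simp
    finally show ?thesis by simp
  qed
qed

text \<open>On uncurried projections \<open>f\<close> acts on the argument and commutes with the
  action of \<open>U\<close> by functoriality of \<open>\<otimes>\<close>. What remains is
  naturality of \<open>g\<close> in the second variable.\<close>

lemma HomAlg_ar_in: "HomAlg_ar T U A D A' D' f g \<in> vnat_V (tcat U) src.HA tgt.HA"
proof -
  have "ha K' \<odot> act (tcat U) src.HA K K' = act (tcat U) tgt.HA K K' \<odot> (Idt (vhom (tcat U) K K') \<star> ha K)"
    if K [simp]: "K \<in> \<J>" "K' \<in> \<J>" for K K'
  proof (rule tgt.HA_inject)
    note [simp] = ha_props(1) src.act_HA(1) tgt.act_HA(1)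
    have [simp]: "tdom (ha K) = src.HO K" "tcod (ha K) = tgt.HO K" for K
      by (simp_all add: ha_def)
    let ?h = "vhom (tcat U) K K'" and ?H = "src.HO K"
    have [simp]: "?H \<in> Ob V" using src.HA_Ob[of K] by simp
    show "arr (ha K' \<odot> act (tcat U) src.HA K K')" "arr (act (tcat U) tgt.HA K K' \<odot> (Idt ?h \<star> ha K))"
      "tdom (ha K' \<odot> act (tcat U) src.HA K K') = tdom (act (tcat U) tgt.HA K K' \<odot> (Idt ?h \<star> ha K))"
      "tcod (ha K' \<odot> act (tcat U) src.HA K K') = tgt.HO K'"
      "tcod (act (tcat U) tgt.HA K K' \<odot> (Idt ?h \<star> ha K)) = tgt.HO K'"
      by simp_all
    fix X assume X [simp]: "X \<in> \<J>"
    have "tgt.uc K' X (tgt.pr K' X \<odot> ha K' \<odot> act (tcat U) src.HA K K')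
        = tgt.uc K' X (tgt.pr K' X \<odot> ha K') \<odot> (act (tcat U) src.HA K K' \<star> Idt (fob A' X))"
      by (subst Uc_seq[symmetric]) simp_all
    also have "\<dots> = tg X K' \<odot> (src.uc K' X (src.pr K' X) \<odot> (act (tcat U) src.HA K K' \<star> Idt (fob A X))) \<odot> (Idt (?h \<otimes> ?H) \<star> tf X)"
      by (simp add: ha_props(2))
    also have "src.uc K' X (src.pr K' X) \<odot> (act (tcat U) src.HA K K' \<star> Idt (fob A X))
        = Uc (fob D (X, K)) (fob D (X, K')) (src.ll X K K') \<odot> (Idt ?h \<star> src.uc K X (src.pr K X)) \<odot> Al ?h ?H (fob A X)"
      by (subst Uc_seq[symmetric]) (simp_all add: src.act_HA(2) Uc_Mv)
    also have "tg X K' \<odot> \<dots> \<odot> (Idt (?h \<otimes> ?H) \<star> tf X)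
        = (tg X K' \<odot> Uc (fob D (X, K)) (fob D (X, K')) (src.ll X K K')) \<odot> (Idt ?h \<star> src.uc K X (src.pr K X))
          \<odot> Al ?h ?H (fob A X) \<odot> ((Idt ?h \<star> Idt ?H) \<star> tf X)"
      by simp
    also have "\<dots> = Uc (fob D' (X, K)) (fob D' (X, K')) (tgt.ll X K K')
        \<odot> (Idt ?h \<star> tg X K \<odot> src.uc K X (src.pr K X) \<odot> (Idt ?H \<star> tf X)) \<odot> Al ?h ?H (fob A' X)"
      unfolding g_left_natural[OF X K] by (subst Al_natural) simp_all
    also have "\<dots> = tgt.uc K' X (Mv (fob A' X) (fob D' (X, K)) (fob D' (X, K')) \<odot> (tgt.ll X K K' \<star> tgt.pr K X \<odot> ha K))"
      by (simp add: Uc_Mv ha_props(2))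
    also have "Mv (fob A' X) (fob D' (X, K)) (fob D' (X, K')) \<odot> (tgt.ll X K K' \<star> tgt.pr K X \<odot> ha K)
        = tgt.pr K' X \<odot> act (tcat U) tgt.HA K K' \<odot> (Idt ?h \<star> ha K)"
      by (subst reassoc[OF tgt.act_HA(2)]) simp_all
    finally show "tgt.uc K' X (tgt.pr K' X \<odot> ha K' \<odot> act (tcat U) src.HA K K')
        = tgt.uc K' X (tgt.pr K' X \<odot> act (tcat U) tgt.HA K K' \<odot> (Idt ?h \<star> ha K))" .
  qed simp
  then show ?thesis
    using ha_props(1) by (simp add: vnat_V_iff[OF src.vfunctor_HA tgt.vfunctor_HA] ha_def) (simp add: HomAlg_ar_def)
qed

end

section \<open>The functor Hom\<close>

locale hom_morphism = amenable_arity_system V \<J> +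
  src: hom_algebra V \<J> T1 U1 D1 A1 + tgt: hom_algebra V \<J> T2 U2 D2 A2
  for V :: "('o, 'm) smc" (structure) and \<J> :: "'o set" and T1 U1 D1 A1 T2 U2 D2 A2 +
  fixes Ml Mr :: "('o, 'o, 'm) vfun" and f :: "'o \<Rightarrow> 'm" and g :: "'o \<times> 'o \<Rightarrow> 'm"
  assumes Ml: "Ml \<in> Hom Th T2 T1" and Mr: "Mr \<in> Hom Th U2 U1"
    and f: "f \<in> vnat_V (tcat T2) A2 (alg_pull Ml A1)"
    and g: "g \<in> balg_hom T2 U2 (balg_pull Ml Mr D1) D2"
begin

abbreviation "PD \<equiv> balg_pull Ml Mr D1"
abbreviation "PA \<equiv> alg_pull Ml A1"

lemma pull_in: "PD \<in> balgs T2 U2" "PA \<in> algs T2"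
  using balg_pull_in(1)[OF _ _ _ _ Ml Mr src.D_balgs tgt.D_balgs] alg_pull_in[OF Ml] by simp_all

text \<open>The second factor of \<open>psi\<close> lives over \<open>T2\<close> and
  \<open>U2\<close>: it is induced by \<open>f\<close> and \<open>g\<close> and leads from the
  pulled-back data to the target.\<close>

sublocale ar: hom_algebra_arrow V \<J> T2 U2 PD PA D2 A2 f g
  using pull_in f g by unfold_locales auto

lemma M_fob [simp]: "X \<in> \<J> \<Longrightarrow> fob Ml X = X" "X \<in> \<J> \<Longrightarrow> fob Mr X = X"
  using morphism_fob[OF Ml] morphism_fob[OF Mr] by simp_all

lemma M_functor: "vfunctor (tcat T2) (tcat T1) Ml" "vfunctor (tcat U2) (tcat U1) Mr"
  using Ml Mr by (simp_all add: Hom_Th)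

lemma pull_right: "K \<in> \<J> \<Longrightarrow> at_right T2 U2 PD K = alg_pull Ml (at_right T1 U1 D1 K)"
  and pull_left: "K \<in> \<J> \<Longrightarrow> at_left T2 U2 PD K = alg_pull Mr (at_left T1 U1 D1 K)"
  using balg_pull_in[OF _ _ _ _ Ml Mr src.D_balgs tgt.D_balgs] by simp_all

lemma PA_fob [simp]: "X \<in> \<J> \<Longrightarrow> fob PA X = fob A1 X"
  by (simp add: alg_pull_def vfun_cmp_simps)

lemma PD_fob [simp]: "\<lbrakk>X \<in> \<J>; K \<in> \<J>\<rbrakk> \<Longrightarrow> fob PD (X, K) = fob D1 (X, K)"
  by (simp add: balg_pull_def vfun_cmp_simps vfun_tensor_simps)

abbreviation "HC \<equiv> hom_comparison T1 U1 T2 Ml Mr A1 D1"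

definition hc :: "'o \<Rightarrow> ('o, 'm) tar" where
  "hc K = Tar (src.HO K) (HC K) (ar.src.HO K)"

lemma hc_simps [simp]:
  "tdom (hc K) = src.HO K"
  "tcod (hc K) = ar.src.HO K"
  by (simp_all add: hc_def)

text \<open>The comparison restricts the family of projections along \<open>Ml\<close>. As
  \<open>Ml\<close> fixes objects, the restricted family has the same members, so \<open>hc\<close>
  is invisible to the projections.\<close>

lemma hc_props:
  assumes K [simp]: "K \<in> \<J>"
  shows "arr (hc K)" and "X \<in> \<J> \<Longrightarrow> ar.src.pr K X \<odot> hc K = src.pr K X"
proof -
  interpret E: vend V "tcat T1" A1 "at_right T1 U1 D1 K" by (rule src.vend_HA) simp
  interpret E': vend V "tcat T2" PA "at_right T2 U2 PD K" by (rule ar.src.vend_HA) simp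
  have w: "twedge (tcat T2) PA (at_right T2 U2 PD K) (src.HO K) (\<lambda>X. src.pr K (fob Ml X))"
    using twedge_vfun_cmp[OF M_functor(1) E.A E.B E.twedge_ep] by (simp add: pull_right) (simp add: alg_pull_def)
  have "hc K = el (tcat T2) PA (at_right T2 U2 PD K) (src.HO K) (\<lambda>X. src.pr K (fob Ml X))"
    by (simp add: hc_def el_def hom_comparison_def alg_pullV_def mk_vfun_simps ep_def pull_right)
  then show "arr (hc K)" and "X \<in> \<J> \<Longrightarrow> ar.src.pr K X \<odot> hc K = src.pr K X"
    using E'.el_props[OF w] by simp_all
qed

lemma alg_pull_HA: "alg_pull Mr src.HA \<in> algs U2"
  by (rule alg_pull_in[OF Mr _ _ src.HA_in]) simp_all

text \<open>Both paths have the same projections: \<open>ll\<close> of the pulled-back bifold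
  algebra is \<open>ll\<close> of \<open>D1\<close> after the action of \<open>Mr\<close>, and
  \<open>Mr\<close> enters the action on the pulled-back source in the same way.\<close>

lemma hom_comparison_in: "HC \<in> vnat_V (tcat U2) (alg_pull Mr src.HA) ar.src.HA"
proof -
  note [simp] = hc_props(1) src.act_HA(1) ar.src.act_HA(1) vfunctor_arr[OF M_functor(2), simplified]
  have "hc K' \<odot> act (tcat U2) (alg_pull Mr src.HA) K K' = act (tcat U2) ar.src.HA K K' \<odot> (Idt (vhom (tcat U2) K K') \<star> hc K)"
    if K [simp]: "K \<in> \<J>" "K' \<in> \<J>" for K K'
  proof -
    let ?H = "src.HO K" and ?M = "tfh (tcat U2) (tcat U1) Mr K K'"
    have [simp]: "?H \<in> Ob V" using src.HA_Ob by simp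
    have [simp]: "arr ?M" using vfunctor_arr[OF M_functor(2), of K K'] by simp
    have ll: "ar.src.ll X K K' = src.ll X K K' \<odot> ?M" if "X \<in> \<J>" for X
    proof -
      have "ar.src.ll X K K' = tfh (tcat U2) VV (vfun_cmp \<J> (at_left T1 U1 D1 X) Mr) K K'"
        using that pull_left[of X] by (simp add: alg_pull_def)
      then show ?thesis using tfh_vfun_cmp[of K \<J> K' "tcat U2" VV "at_left T1 U1 D1 X" Mr "tcat U1"] that by simp
    qed
    have act: "act (tcat U2) (alg_pull Mr src.HA) K K' = act (tcat U1) src.HA K K' \<odot> (?M \<star> Idt ?H)"
      using act_vfun_cmp[OF M_functor(2) src.vfunctor_HA, of K K'] by (simp add: alg_pull_def)
    show ?thesis unfolding act
    proof (rule vend.ep_inject[OF ar.src.vend_HA[OF K(2)]])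
      fix X assume "X \<in> vob (tcat T2)"
      then have X [simp]: "X \<in> \<J>" by simp
      have "ar.src.pr K' X \<odot> hc K' \<odot> act (tcat U1) src.HA K K' \<odot> (?M \<star> Idt ?H)
          = (src.pr K' X \<odot> act (tcat U1) src.HA K K') \<odot> (?M \<star> Idt ?H)"
        by (subst reassoc[OF hc_props(2)]) simp_all
      also have "\<dots> = Mv (fob A1 X) (fob D1 (X, K)) (fob D1 (X, K')) \<odot> (src.ll X K K' \<odot> ?M \<star> src.pr K X)"
        by (simp add: src.act_HA(2))
      also have "\<dots> = (Mv (fob A1 X) (fob D1 (X, K)) (fob D1 (X, K')) \<odot> (ar.src.ll X K K' \<star> ar.src.pr K X)) \<odot> (Idt (vhom (tcat U2) K K') \<star> hc K)"
        using ar.src.arr_ll[of X K K'] ar.src.arr_pr[of K X] by (simp add: ll hc_props(2))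
      also have "\<dots> = ar.src.pr K' X \<odot> act (tcat U2) ar.src.HA K K' \<odot> (Idt (vhom (tcat U2) K K') \<star> hc K)"
        by (subst reassoc[OF ar.src.act_HA(2)]) (simp_all add: ar.src.act_HA(2))
      finally show "ar.src.pr K' X \<odot> hc K' \<odot> act (tcat U1) src.HA K K' \<odot> (?M \<star> Idt ?H)
          = ar.src.pr K' X \<odot> act (tcat U2) ar.src.HA K K' \<odot> (Idt (vhom (tcat U2) K K') \<star> hc K)" .
    qed simp_all
  qed
  moreover have "fob (alg_pull Mr src.HA) K = src.HO K" if "K \<in> \<J>" for K
    using that by (simp add: alg_pull_def vfun_cmp_simps)
  ultimately show ?thesis
    using hc_props(1)
    by (simp add: vnat_V_iff[OF algs_vfunctor[OF alg_pull_HA] ar.src.vfunctor_HA] hc_def) (simp add: hom_comparison_def)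
qed

definition psi :: "'o \<Rightarrow> 'm" where
  "psi = cmp (Alg0 U2) (HomAlg_ar T2 U2 PA PD A2 D2 f g) HC"

lemma psi_in: "psi \<in> vnat_V (tcat U2) (alg_pull Mr src.HA) tgt.HA"
  using vnat_V_cmp[OF algs_vfunctor[OF alg_pull_HA] ar.src.vfunctor_HA tgt.vfunctor_HA ar.HomAlg_ar_in hom_comparison_in]
  by (simp add: psi_def Alg0_def)

abbreviation "tpsi K \<equiv> Tar (src.HO K) (psi K) (tgt.HO K)"

text \<open>\<open>ar.ha_props\<close> composed with \<open>hc\<close>, which disappears under the
  projections. The result mentions neither \<open>Ml\<close> nor \<open>Mr\<close>, so identities
  and composites are decided by \<open>f\<close> and \<open>g\<close>.\<close>

lemma psi_props:
  assumes K [simp]: "K \<in> \<J>"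
  shows "arr (tpsi K)"
    and "X \<in> \<J> \<Longrightarrow> tgt.uc K X (tgt.pr K X \<odot> tpsi K)
      = Tar (fob D1 (X, K)) (g (X, K)) (fob D2 (X, K)) \<odot> src.uc K X (src.pr K X)
        \<odot> (Idt (src.HO K) \<star> Tar (fob A2 X) (f X) (fob A1 X))"
proof -
  note [simp] = hc_props(1) ar.ha_props(1)
  have [simp]: "tdom (ar.ha K) = ar.src.HO K"
    "tcod (ar.ha K) = tgt.HO K"
    by (simp_all add: ar.ha_def)
  have psi: "tpsi K = ar.ha K \<odot> hc K"
    by (simp add: psi_def Alg0_def ar.ha_def hc_def seq_def)
  show "arr (tpsi K)" unfolding psi by simp
  assume X [simp]: "X \<in> \<J>"
  let ?H = "src.HO K"
  have [simp]: "?H \<in> Ob V" "ar.src.HO K \<in> Ob V"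
    using src.HA_Ob ar.src.HA_Ob by simp_all
  have [simp]: "arr (Tar (fob A2 X) (f X) (fob A1 X))" "arr (Tar (fob D1 (X, K)) (g (X, K)) (fob D2 (X, K)))"
    using ar.arr_tf[of X] ar.arr_tg[of X K] by simp_all
  have arr_pr [simp]: "arr (ar.src.pr K X)" using ar.src.arr_pr[of K X] by simp
  have "tgt.uc K X (tgt.pr K X \<odot> ar.ha K \<odot> hc K)
      = tgt.uc K X (tgt.pr K X \<odot> ar.ha K) \<odot> (hc K \<star> Idt (fob A2 X))"
    by (subst Uc_seq[symmetric]) simp_all
  also have "\<dots> = Tar (fob D1 (X, K)) (g (X, K)) (fob D2 (X, K))
      \<odot> (src.uc K X (ar.src.pr K X) \<odot> (hc K \<star> Idt (fob A1 X))) \<odot> (Idt ?H \<star> Tar (fob A2 X) (f X) (fob A1 X))"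
    using ar.ha_props(2)[of K X] by simp
  also have "src.uc K X (ar.src.pr K X) \<odot> (hc K \<star> Idt (fob A1 X))
      = src.uc K X (src.pr K X)"
    by (subst Uc_seq[symmetric]) (simp_all add: hc_props(2))
  finally show "tgt.uc K X (tgt.pr K X \<odot> tpsi K)
      = Tar (fob D1 (X, K)) (g (X, K)) (fob D2 (X, K)) \<odot> src.uc K X (src.pr K X)
        \<odot> (Idt ?H \<star> Tar (fob A2 X) (f X) (fob A1 X))"
    unfolding psi .
qed

lemma psi_extensional: "psi \<in> extensional \<J>"
  by (simp add: psi_def Alg0_def)

end

context amenable_arity_system
begin

lemma psi_ident:
  assumes "hom_morphism V \<J> T U D A T U D A (vfun_id (tcat T)) (vfun_id (tcat U))
    (\<lambda>K\<in>\<J>. \<iota> (fob A K)) (\<lambda>X\<in>\<J> \<times> \<J>. \<iota> (fob D X))"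
  shows "hom_morphism.psi V \<J> T U D A T U D A (vfun_id (tcat T)) (vfun_id (tcat U))
    (\<lambda>K\<in>\<J>. \<iota> (fob A K)) (\<lambda>X\<in>\<J> \<times> \<J>. \<iota> (fob D X)) = (\<lambda>K\<in>\<J>. \<iota> (fob (HomAlg T U A D) K))"
proof -
  interpret hom_morphism V \<J> T U D A T U D A "vfun_id (tcat T)" "vfun_id (tcat U)"
    "\<lambda>K\<in>\<J>. \<iota> (fob A K)" "\<lambda>X\<in>\<J> \<times> \<J>. \<iota> (fob D X)" by fact
  show ?thesis
  proof (rule extensionalityI[OF psi_extensional])
    fix K assume K [simp]: "K \<in> \<J>"
    have [simp]: "src.HO K \<in> Ob V" using src.HA_Ob by simp
    have "tpsi K = Idt (src.HO K)"
    proof (rule src.HA_inject[OF K psi_props(1)[OF K]])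
      fix X assume X [simp]: "X \<in> \<J>"
      show "src.uc K X (src.pr K X \<odot> tpsi K)
        = src.uc K X (src.pr K X \<odot> Idt (src.HO K))"
        by (simp add: psi_props(2) Idt_def[symmetric])
    qed simp_all
    then show "psi K = (\<lambda>K\<in>\<J>. \<iota> (fob (HomAlg T U A D) K)) K"
      by (simp add: Idt_def)
  qed simp
qed

text \<open>As the formula for \<open>psi\<close> does not mention the theory morphisms,
  \<open>Ll\<close> and \<open>Lr\<close> are constrained by \<open>c\<close> alone. Uncurried, the
  components of \<open>f\<close> and \<open>f'\<close> compose before evaluation, those of
  \<open>g\<close> and \<open>g'\<close> after it.\<close>

lemma psi_cmp:
  assumes a: "hom_morphism V \<J> T1 U1 D1 A1 T2 U2 D2 A2 Ml Mr f g"
    and b: "hom_morphism V \<J> T2 U2 D2 A2 T3 U3 D3 A3 Nl Nr f' g'"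
    and c: "hom_morphism V \<J> T1 U1 D1 A1 T3 U3 D3 A3 Ll Lr f'' g''"
    and f: "\<And>X. X \<in> \<J> \<Longrightarrow> f'' X = f X \<cdot> f' X"
    and g: "\<And>X K. X \<in> \<J> \<Longrightarrow> K \<in> \<J> \<Longrightarrow> g'' (X, K) = g' (X, K) \<cdot> g (X, K)"
    and K [simp]: "K \<in> \<J>"
  shows "hom_morphism.psi V \<J> T1 U1 D1 A1 T3 U3 D3 A3 Ll Lr f'' g'' K
    = hom_morphism.psi V \<J> T2 U2 D2 A2 T3 U3 D3 A3 Nl Nr f' g' K
      \<cdot> hom_morphism.psi V \<J> T1 U1 D1 A1 T2 U2 D2 A2 Ml Mr f g K"
proof -
  interpret a: hom_morphism V \<J> T1 U1 D1 A1 T2 U2 D2 A2 Ml Mr f g by fact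
  interpret b: hom_morphism V \<J> T2 U2 D2 A2 T3 U3 D3 A3 Nl Nr f' g' by fact
  interpret c: hom_morphism V \<J> T1 U1 D1 A1 T3 U3 D3 A3 Ll Lr f'' g'' by fact
  note [simp] = a.psi_props(1) b.psi_props(1) c.psi_props(1)
  let ?H1 = "a.src.HO K" and ?H2 = "a.tgt.HO K"
  have [simp]: "?H1 \<in> Ob V" "?H2 \<in> Ob V" using a.src.HA_Ob a.tgt.HA_Ob by simp_all
  have "c.tpsi K = b.tpsi K \<odot> a.tpsi K"
  proof (rule b.tgt.HA_inject[OF K])
    fix X assume X [simp]: "X \<in> \<J>"
    let ?f = "Tar (fob A2 X) (f X) (fob A1 X)" and ?g = "Tar (fob D1 (X, K)) (g (X, K)) (fob D2 (X, K))"
    let ?f' = "Tar (fob A3 X) (f' X) (fob A2 X)" and ?g' = "Tar (fob D2 (X, K)) (g' (X, K)) (fob D3 (X, K))"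
    have [simp]: "arr ?f" "arr ?g" "arr ?f'" "arr ?g'"
      using a.ar.arr_tf[of X] a.ar.arr_tg[of X K] b.ar.arr_tf[of X] b.ar.arr_tg[of X K] by simp_all
    have f'': "Tar (fob A3 X) (f'' X) (fob A1 X) = ?f \<odot> ?f'"
      and g'': "Tar (fob D1 (X, K)) (g'' (X, K)) (fob D3 (X, K)) = ?g' \<odot> ?g"
      by (simp_all add: f g seq_def)
    have "b.tgt.uc K X (b.tgt.pr K X \<odot> b.tpsi K \<odot> a.tpsi K)
        = b.tgt.uc K X (b.tgt.pr K X \<odot> b.tpsi K) \<odot> (a.tpsi K \<star> Idt (fob A3 X))"
      by (subst Uc_seq[symmetric]) simp_all
    also have "\<dots> = ?g' \<odot> (a.tgt.uc K X (a.tgt.pr K X) \<odot> (a.tpsi K \<star> Idt (fob A2 X))) \<odot> (Idt ?H1 \<star> ?f')"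
      by (simp add: b.psi_props(2))
    also have "a.tgt.uc K X (a.tgt.pr K X) \<odot> (a.tpsi K \<star> Idt (fob A2 X))
        = ?g \<odot> a.src.uc K X (a.src.pr K X) \<odot> (Idt ?H1 \<star> ?f)"
      by (subst Uc_seq[symmetric]) (simp_all add: a.psi_props(2))
    also have "?g' \<odot> \<dots> \<odot> (Idt ?H1 \<star> ?f') = b.tgt.uc K X (b.tgt.pr K X \<odot> c.tpsi K)"
      by (simp add: c.psi_props(2) f'' g'')
    finally show "b.tgt.uc K X (b.tgt.pr K X \<odot> c.tpsi K)
        = b.tgt.uc K X (b.tgt.pr K X \<odot> b.tpsi K \<odot> a.tpsi K)" ..
  qed simp_all
  then show ?thesis by (simp add: seq_def)
qed

end

section \<open>Pullbacks, total categories, opposites and products\<close>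

text \<open>The common target of \<open>P\<close> and \<open>L\<close> is left implicit:
  compatibility is asked only for identities over equal objects and for composable pairs whose
  images already agree.\<close>

lemma category_pullback:
  assumes C: "category C" and D: "category D"
    and ident: "\<And>X Y. \<lbrakk>X \<in> Ob C; Y \<in> Ob D; onOb P X = onOb L Y\<rbrakk> \<Longrightarrow> onAr P X X (ident C X) = onAr L Y Y (ident D Y)"
    and cmp: "\<And>X X' X'' Y Y' Y'' f f' g g'. \<lbrakk>X \<in> Ob C; X' \<in> Ob C; X'' \<in> Ob C; Y \<in> Ob D; Y' \<in> Ob D; Y'' \<in> Ob D;
        f \<in> Hom C X X'; f' \<in> Hom C X' X''; g \<in> Hom D Y Y'; g' \<in> Hom D Y' Y'';
        onAr P X X' f = onAr L Y Y' g; onAr P X' X'' f' = onAr L Y' Y'' g'\<rbrakk>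
      \<Longrightarrow> onAr P X X'' (cmp C f' f) = onAr L Y Y'' (cmp D g' g)"
  shows "category (pullback_cat C D P L)"
proof -
  interpret C: category C by (rule C)
  interpret D: category D by (rule D)
  show ?thesis
    by unfold_locales
      (auto simp: pullback_cat_def C.ident_in D.ident_in ident cmp C.ident_left D.ident_left
        C.ident_right D.ident_right C.cmp_assoc D.cmp_assoc intro: C.cmp_in D.cmp_in)
qed

text \<open>The Grothendieck construction for arrows that are contravariant in the base and have a
  component in the fibre over the codomain.\<close>

lemma category_total:
  fixes E :: "('e, 'm \<times> 't) cat"
  assumes B: "category B" and F: "\<And>b. b \<in> Ob B \<Longrightarrow> category (F b)"
    and Ob: "\<And>X. X \<in> Ob E \<Longrightarrow> bs X \<in> Ob B" "\<And>X. X \<in> Ob E \<Longrightarrow> fb X \<in> Ob (F (bs X))"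
    and Hom: "\<And>X Y. \<lbrakk>X \<in> Ob E; Y \<in> Ob E\<rbrakk>
      \<Longrightarrow> Hom E X Y = {(M, t). M \<in> Hom B (bs Y) (bs X) \<and> t \<in> Hom (F (bs Y)) (po M (fb X)) (fb Y)}"
    and ident: "\<And>X. X \<in> Ob E \<Longrightarrow> ident E X = (ident B (bs X), ident (F (bs X)) (fb X))"
    and cmp: "\<And>M t N s. cmp E (N, s) (M, t) = (cmp B M N, fc s (pa N t))" "\<And>b. cmp (F b) = fc"
    and pull: "\<And>b c M x y. \<lbrakk>b \<in> Ob B; c \<in> Ob B; M \<in> Hom B c b; x \<in> Ob (F b); y \<in> Ob (F c)\<rbrakk> \<Longrightarrow>
        po M x \<in> Ob (F c) \<and> pa M (ident (F b) x) = ident (F c) (po M x)"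
      "\<And>b c M x y z t. \<lbrakk>b \<in> Ob B; c \<in> Ob B; M \<in> Hom B c b; x \<in> Ob (F b); y \<in> Ob (F b); z \<in> Ob (F c);
        t \<in> Hom (F b) x y\<rbrakk> \<Longrightarrow> pa M t \<in> Hom (F c) (po M x) (po M y)"
      "\<And>b c M s t. \<lbrakk>b \<in> Ob B; c \<in> Ob B; M \<in> Hom B c b\<rbrakk> \<Longrightarrow> pa M (fc s t) = fc (pa M s) (pa M t)"
    and pull_ident: "\<And>b x. \<lbrakk>b \<in> Ob B; x \<in> Ob (F b)\<rbrakk> \<Longrightarrow> po (ident B b) x = x"
      "\<And>b x y t. \<lbrakk>b \<in> Ob B; x \<in> Ob (F b); y \<in> Ob (F b); t \<in> Hom (F b) x y\<rbrakk> \<Longrightarrow> pa (ident B b) t = t"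
    and pull_cmp: "\<And>b c d M N x y z. \<lbrakk>b \<in> Ob B; c \<in> Ob B; d \<in> Ob B; M \<in> Hom B c b; N \<in> Hom B d c;
        x \<in> Ob (F b); y \<in> Ob (F c); z \<in> Ob (F d)\<rbrakk> \<Longrightarrow> po (cmp B M N) x = po N (po M x)"
      "\<And>b c d M N t. \<lbrakk>b \<in> Ob B; c \<in> Ob B; d \<in> Ob B; M \<in> Hom B c b; N \<in> Hom B d c\<rbrakk>
        \<Longrightarrow> pa (cmp B M N) t = pa N (pa M t)"
  shows "category E"
proof -
  interpret B: category B by (rule B)
  note F_laws = category.ident_in[OF F] category.cmp_in[OF F] category.ident_left[OF F]
    category.ident_right[OF F] category.cmp_assoc[OF F]
  show ?thesis
  proof
    fix X assume X: "X \<in> Ob E"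
    then show "\<iota>\<^bsub>E\<^esub> X \<in> Hom E X X"
      using Ob[OF X] by (simp add: Hom ident pull_ident B.ident_in F_laws(1))
  next
    fix X Y Z f g assume X: "X \<in> Ob E" "Y \<in> Ob E" "Z \<in> Ob E" and f: "f \<in> Hom E X Y" and g: "g \<in> Hom E Y Z"
    obtain M t where M: "f = (M, t)" "M \<in> Hom B (bs Y) (bs X)" "t \<in> Hom (F (bs Y)) (po M (fb X)) (fb Y)"
      using f X by (auto simp: Hom)
    obtain N s where N: "g = (N, s)" "N \<in> Hom B (bs Z) (bs Y)" "s \<in> Hom (F (bs Z)) (po N (fb Y)) (fb Z)"
      using g X by (auto simp: Hom)
    note O = Ob(1)[OF X(1)] Ob(1)[OF X(2)] Ob(1)[OF X(3)] Ob(2)[OF X(1)] Ob(2)[OF X(2)] Ob(2)[OF X(3)]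
    have po: "po M (fb X) \<in> Ob (F (bs Y))" "po N (fb Y) \<in> Ob (F (bs Z))" using pull(1) M N O by blast+
    moreover from this have "po N (po M (fb X)) \<in> Ob (F (bs Z))" using pull(1) N O by blast
    moreover have "pa N t \<in> Hom (F (bs Z)) (po N (po M (fb X))) (po N (fb Y))"
      using pull(2) M N O po by blast
    ultimately have "fc s (pa N t) \<in> Hom (F (bs Z)) (po N (po M (fb X))) (fb Z)"
      using F_laws(2)[OF O(3)] N(3) O(6) unfolding cmp(2) by blast
    then show "g \<cdot>\<^bsub>E\<^esub> f \<in> Hom E X Z"
      using X B.cmp_in[OF O(3,2,1) N(2) M(2)] pull_cmp(1)[OF O(1-3) M(2) N(2) O(4-6)] by (simp add: Hom cmp M N)
  next
    fix X Y f assume X: "X \<in> Ob E" "Y \<in> Ob E" and f: "f \<in> Hom E X Y"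
    obtain M t where M: "f = (M, t)" "M \<in> Hom B (bs Y) (bs X)" "t \<in> Hom (F (bs Y)) (po M (fb X)) (fb Y)"
      using f X by (auto simp: Hom)
    note O = Ob(1)[OF X(1)] Ob(1)[OF X(2)] Ob(2)[OF X(1)] Ob(2)[OF X(2)]
    note po = pull(1)[OF O(1,2) M(2) O(3,4)]
    have "fc (ident (F (bs Y)) (fb Y)) t = t" "fc t (ident (F (bs Y)) (po M (fb X))) = t"
      using F_laws(3)[OF O(2) _ O(4) M(3)] F_laws(4)[OF O(2) _ O(4) M(3)] po by (simp_all add: cmp(2))
    then show "\<iota>\<^bsub>E\<^esub> Y \<cdot>\<^bsub>E\<^esub> f = f" "f \<cdot>\<^bsub>E\<^esub> \<iota>\<^bsub>E\<^esub> X = f"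
      using B.ident_left[OF O(2,1) M(2)] B.ident_right[OF O(2,1) M(2)] po
        pull_ident(2)[OF O(2) _ O(4) M(3)] X by (simp_all add: M cmp ident)
  next
    fix W X Y Z f g h assume X: "W \<in> Ob E" "X \<in> Ob E" "Y \<in> Ob E" "Z \<in> Ob E"
      and f: "f \<in> Hom E W X" and g: "g \<in> Hom E X Y" and h: "h \<in> Hom E Y Z"
    obtain M t where M: "f = (M, t)" "M \<in> Hom B (bs X) (bs W)" "t \<in> Hom (F (bs X)) (po M (fb W)) (fb X)"
      using f X by (auto simp: Hom)
    obtain N s where N: "g = (N, s)" "N \<in> Hom B (bs Y) (bs X)" "s \<in> Hom (F (bs Y)) (po N (fb X)) (fb Y)"
      using g X by (auto simp: Hom)
    obtain L r where L: "h = (L, r)" "L \<in> Hom B (bs Z) (bs Y)" "r \<in> Hom (F (bs Z)) (po L (fb Y)) (fb Z)"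
      using h X by (auto simp: Hom)
    note O = Ob(1)[OF X(1)] Ob(1)[OF X(2)] Ob(1)[OF X(3)] Ob(1)[OF X(4)]
      Ob(2)[OF X(1)] Ob(2)[OF X(2)] Ob(2)[OF X(3)] Ob(2)[OF X(4)]
    have po: "po M (fb W) \<in> Ob (F (bs X))" "po N (fb X) \<in> Ob (F (bs Y))" "po L (fb Y) \<in> Ob (F (bs Z))"
      using pull(1) M N L O by blast+
    moreover from this have "po N (po M (fb W)) \<in> Ob (F (bs Y))" "po L (po N (fb X)) \<in> Ob (F (bs Z))"
      using pull(1) N L O by blast+
    moreover from this have "po L (po N (po M (fb W))) \<in> Ob (F (bs Z))" using pull(1) L O by blast
    moreover have Nt: "pa N t \<in> Hom (F (bs Y)) (po N (po M (fb W))) (po N (fb X))"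
      using pull(2) M N O po by blast
    \<comment> \<open>Pulling back preserves composition, so associativity in the total category
      becomes associativity in the last fibre.\<close>
    ultimately have "fc (fc r (pa L s)) (pa L (pa N t)) = fc r (fc (pa L s) (pa L (pa N t)))"
      using F_laws(5)[OF O(4), of "po L (po N (po M (fb W)))" "po L (po N (fb X))" "po L (fb Y)" "fb Z"
          "pa L (pa N t)" "pa L s" r] pull(2)[OF O(3,4) L(2) _ _ O(8)] N(3) L(3) O by (simp add: cmp(2))
    then show "h \<cdot>\<^bsub>E\<^esub> g \<cdot>\<^bsub>E\<^esub> f = h \<cdot>\<^bsub>E\<^esub> (g \<cdot>\<^bsub>E\<^esub> f)"
      using B.cmp_assoc[OF O(4,3,2,1) L(2) N(2) M(2)] pull(3)[OF O(3,4) L(2)] pull_cmp(2)[OF O(2-4) N(2) L(2)]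
      by (simp add: M N L cmp)
  qed
qed

text \<open>The fibre components of arrows in \<open>AlgStar\<close> are reversed, so
  \<open>AlgStar\<close> is a total category over the opposite fibres.\<close>

definition op_cat :: "('o, 'a) cat \<Rightarrow> ('o, 'a) cat" where
  "op_cat C = \<lparr>Ob = Ob C, Hom = (\<lambda>X Y. Hom C Y X), ident = ident C, cmp = (\<lambda>g f. cmp C f g)\<rparr>"

lemma category_op:
  assumes "category C"
  shows "category (op_cat C)"
proof -
  interpret category C by (rule assms)
  show ?thesis
    by unfold_locales (auto simp: op_cat_def ident_in ident_left ident_right cmp_assoc intro: cmp_in)
qed

text \<open>\<open>BAlg\<close> is a total category over the base
  \<open>prod_cat Th Th\<close>.\<close>

definition prod_cat :: "('o, 'a) cat \<Rightarrow> ('p, 'b) cat \<Rightarrow> ('o \<times> 'p, 'a \<times> 'b) cat" where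
  "prod_cat C D = \<lparr>Ob = Ob C \<times> Ob D, Hom = (\<lambda>(X, Y) (X', Y'). Hom C X X' \<times> Hom D Y Y'),
    ident = (\<lambda>(X, Y). (ident C X, ident D Y)), cmp = (\<lambda>(f', g') (f, g). (cmp C f' f, cmp D g' g))\<rparr>"

lemma category_prod:
  assumes "category C" "category D"
  shows "category (prod_cat C D)"
proof -
  interpret C: category C by (rule assms(1))
  interpret D: category D by (rule assms(2))
  show ?thesis
    by unfold_locales
      (auto simp: prod_cat_def C.ident_in D.ident_in C.ident_left D.ident_left
        C.ident_right D.ident_right C.cmp_assoc D.cmp_assoc intro: C.cmp_in D.cmp_in)
qed

context symmetric_monoidal_closed
begin

text \<open>Algebras and bifold algebras are both enriched functors into \<open>VV\<close>, so one
  argument serves the fibres of \<open>Alg\<close>, \<open>AlgStar\<close> and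
  \<open>BAlg\<close>.\<close>

lemma category_vnat:
  assumes S: "\<And>A. A \<in> S \<Longrightarrow> vfunctor C VV A"
  shows "category \<lparr>Ob = S, Hom = vnat_V C, ident = (\<lambda>A. \<lambda>K\<in>vob C. \<iota> (fob A K)),
    cmp = (\<lambda>h f. \<lambda>K\<in>vob C. h K \<cdot> f K)\<rparr>"
proof -
  have t: "t K \<in> Hom V (fob A K) (fob B K)" if "t \<in> vnat_V C A B" "K \<in> vob C" for t A B K
    using that by (simp add: vnat_V_def)
  have ext: "t \<in> extensional (vob C)" if "t \<in> vnat_V C A B" for t A B
    using that by (simp add: vnat_V_def)
  note Ob = vfunctor_Ob[OF S]
  show ?thesis
  proof (unfold_locales; simp)
    fix A assume "A \<in> S"
    then show "(\<lambda>K\<in>vob C. \<iota> (fob A K)) \<in> vnat_V C A A" by (intro vnat_V_id S)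
  next
    fix A B D s t assume "A \<in> S" "B \<in> S" "D \<in> S" "t \<in> vnat_V C A B" "s \<in> vnat_V C B D"
    then show "(\<lambda>K\<in>vob C. s K \<cdot> t K) \<in> vnat_V C A D" by (intro vnat_V_cmp[of C A B D] S)
  next
    fix A B t assume A: "A \<in> S" "B \<in> S" "t \<in> vnat_V C A B"
    have "\<iota> (fob B K) \<cdot> t K = t K" "t K \<cdot> \<iota> (fob A K) = t K" if "K \<in> vob C" for K
      using ident_left[OF Ob[OF A(1)] Ob[OF A(2)] t[OF A(3)]] ident_right[OF Ob[OF A(1)] Ob[OF A(2)] t[OF A(3)]] that by simp_all
    \<comment> \<open>The conditionals are what the simplifier leaves of the inner
      restrictions.\<close>
    then show "(\<lambda>K\<in>vob C. (if K \<in> vob C then \<iota> (fob B K) else undefined) \<cdot> t K) = t"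
      "(\<lambda>K\<in>vob C. t K \<cdot> (if K \<in> vob C then \<iota> (fob A K) else undefined)) = t"
      using ext[OF A(3)] by (auto intro!: extensionalityI[where A = "vob C"])
  next
    fix A B D E r s t assume A: "A \<in> S" "B \<in> S" "D \<in> S" "E \<in> S" and "t \<in> vnat_V C A B" "s \<in> vnat_V C B D" "r \<in> vnat_V C D E"
    then have "r K \<cdot> s K \<cdot> t K = r K \<cdot> (s K \<cdot> t K)" if "K \<in> vob C" for K
      using that Ob[OF A(1)] Ob[OF A(2)] Ob[OF A(3)] Ob[OF A(4)] t
      by (intro cmp_assoc[of "fob A K" "fob B K" "fob D K" "fob E K"]) auto
    then show "(\<lambda>K\<in>vob C. (if K \<in> vob C then r K \<cdot> s K else undefined) \<cdot> t K)
        = (\<lambda>K\<in>vob C. r K \<cdot> (if K \<in> vob C then s K \<cdot> t K else undefined))"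
      by auto
  qed
qed

end

section \<open>Categories of algebras and bifold algebras over varying theories\<close>

context amenable_arity_system
begin

lemma category_Alg0:
  assumes "is_theory T"
  shows "category (Alg0 T)"
  using category_vnat[of "algs T" "tcat T"] assms by (simp add: Alg0_def algs_vfunctor)

lemma vnat_V_ext: "t \<in> vnat_V C F G \<Longrightarrow> t \<in> extensional (vob C)"
  by (simp add: vnat_V_def)

lemma alg_pull_ar_in:
  assumes "M \<in> Hom Th T U" "is_theory T" "is_theory U" "A \<in> algs U" "B \<in> algs U" "t \<in> vnat_V (tcat U) A B"
  shows "alg_pull_ar M t \<in> vnat_V (tcat T) (alg_pull M A) (alg_pull M B)"
  using vnat_V_vfun_cmp[of "tcat T" "tcat U" M A B t] assms
  by (simp add: Hom_Th algs_def alg_pull_ar_def alg_pull_def)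

lemma Alg_simps:
  "(T, A) \<in> Ob Alg \<longleftrightarrow> is_theory T \<and> A \<in> algs T"
  "(M, t) \<in> Hom Alg (T1, A1) (T2, A2) \<longleftrightarrow> M \<in> Hom Th T2 T1 \<and> t \<in> vnat_V (tcat T2) (alg_pull M A1) A2"
  "ident Alg (T, A) = (vfun_id (tcat T), \<lambda>K\<in>\<J>. \<iota> (fob A K))"
  "cmp Alg (N, s) (M, t) = (vfun_cmp \<J> M N, \<lambda>K\<in>\<J>. s K \<cdot> alg_pull_ar N t K)"
  by (simp_all add: Alg_def Alg0_def)

lemma AlgStar_simps:
  "(T, A) \<in> Ob AlgStar \<longleftrightarrow> is_theory T \<and> A \<in> algs T"
  "(M, t) \<in> Hom AlgStar (T1, A1) (T2, A2) \<longleftrightarrow> M \<in> Hom Th T2 T1 \<and> t \<in> vnat_V (tcat T2) A2 (alg_pull M A1)"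
  "ident AlgStar (T, A) = (vfun_id (tcat T), \<lambda>K\<in>\<J>. \<iota> (fob A K))"
  "cmp AlgStar (N, s) (M, t) = (vfun_cmp \<J> M N, \<lambda>K\<in>\<J>. alg_pull_ar N t K \<cdot> s K)"
  by (simp_all add: AlgStar_def Alg0_def)

lemma BAlg_simps:
  "(T, U, D) \<in> Ob BAlg \<longleftrightarrow> is_theory T \<and> is_theory U \<and> D \<in> balgs T U"
  "((Ml, Mr), t) \<in> Hom BAlg (T1, U1, D1) (T2, U2, D2) \<longleftrightarrow> Ml \<in> Hom Th T2 T1 \<and> Mr \<in> Hom Th U2 U1 \<and>
    t \<in> vnat_V (vtensor (tcat T2) (tcat U2)) (balg_pull Ml Mr D1) D2"
  "ident BAlg (T, U, D) = ((vfun_id (tcat T), vfun_id (tcat U)), \<lambda>X\<in>\<J> \<times> \<J>. \<iota> (fob D X))"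
  "cmp BAlg ((Nl, Nr), s) ((Ml, Mr), t)
    = ((vfun_cmp \<J> Ml Nl, vfun_cmp \<J> Mr Nr), \<lambda>X\<in>\<J> \<times> \<J>. s X \<cdot> balg_pull_ar Nl Nr t X)"
  by (simp_all add: BAlg_def balg_hom_def)

text \<open>Restrictions to \<open>\<J>\<close> are compatible with pulling back because a morphism
  of theories maps \<open>\<J>\<close> identically to itself.\<close>

lemma alg_pull_laws:
  assumes M: "M \<in> Hom Th T U" "is_theory T" "is_theory U"
  shows "alg_pull_ar M (\<lambda>K\<in>\<J>. \<iota> (fob A K)) = (\<lambda>K\<in>\<J>. \<iota> (fob (alg_pull M A) K))"
    and "alg_pull_ar M (\<lambda>K\<in>\<J>. s K \<cdot> t K) = (\<lambda>K\<in>\<J>. alg_pull_ar M s K \<cdot> alg_pull_ar M t K)"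
    and "\<lbrakk>N \<in> Hom Th T' T; is_theory T'\<rbrakk> \<Longrightarrow> alg_pull_ar (vfun_cmp \<J> M N) t = alg_pull_ar N (alg_pull_ar M t)"
  using M by (auto simp: alg_pull_ar_def alg_pull_def vfun_cmp_simps morphism_fob[OF M]
      morphism_fob[where T = T' and U = T])

lemma alg_pull_ar_id: "is_theory T \<Longrightarrow> t \<in> vnat_V (tcat T) A B \<Longrightarrow> alg_pull_ar (vfun_id (tcat T)) t = t"
  using vnat_V_ext[of t "tcat T" A B]
  by (auto simp: alg_pull_ar_def vfun_id_simps intro!: extensionalityI[where A = \<J>])

lemmas alg_pull_facts = alg_pull_in alg_pull_ar_in alg_pull_laws alg_pull_id alg_pull_ar_id alg_pull_pull

lemma category_Alg: "category Alg"
  by (rule category_total[OF category_Th category_Alg0, where po = alg_pull and pa = alg_pull_ar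
        and bs = fst and fb = snd and fc = "\<lambda>s t. \<lambda>K\<in>\<J>. s K \<cdot> t K"])
    (auto simp: Alg_def Alg0_def intro: alg_pull_facts)

lemma category_AlgStar: "category AlgStar"
  by (rule category_total[OF category_Th category_op[OF category_Alg0], where po = alg_pull and pa = alg_pull_ar
        and bs = fst and fb = snd and fc = "\<lambda>s t. \<lambda>K\<in>\<J>. t K \<cdot> s K"])
    (auto simp: AlgStar_def Alg0_def op_cat_def intro: alg_pull_facts)

lemma vfun_tensor_id:
  assumes "is_theory T" "is_theory U"
  shows "vfun_tensor \<J> \<J> (vfun_id (tcat T)) (vfun_id (tcat U)) = vfun_id (vtensor (tcat T) (tcat U))"
  by (rule vfun_eqI[where S = "\<J> \<times> \<J>"]) (use assms in \<open>auto simp: vfun_tensor_def vfun_id_def mk_vfun_simps tensA_ident\<close>)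

lemma balg_pull_id:
  assumes "is_theory T" "is_theory U" "D \<in> balgs T U"
  shows "balg_pull (vfun_id (tcat T)) (vfun_id (tcat U)) D = D"
  using vfun_cmp_id[OF balgs_vfunctor[OF assms(3)]] assms by (simp add: balg_pull_def vfun_tensor_id)

lemma tensor_functor:
  assumes "Ml \<in> Hom Th T2 T1" "Mr \<in> Hom Th U2 U1" "is_theory T1" "is_theory U1" "is_theory T2" "is_theory U2"
    "vcategory (vtensor (tcat T1) (tcat U1))" "vcategory (vtensor (tcat T2) (tcat U2))"
  shows "vfunctor (vtensor (tcat T2) (tcat U2)) (vtensor (tcat T1) (tcat U1)) (vfun_tensor \<J> \<J> Ml Mr)"
  using assms by (intro vfunctor_tensor) (simp_all add: Hom_Th)

text \<open>Tensoring respects composition of functors, and composition is associative.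
  \<open>E\<close> and \<open>E'\<close> provide that the remaining tensor products are enriched
  categories; to have them at hand, \<open>category_total\<close> supplies objects of all three
  fibres in \<open>pull_cmp\<close>.\<close>

lemma balg_pull_pull:
  assumes M: "Ml \<in> Hom Th T2 T1" "Mr \<in> Hom Th U2 U1" and N: "Nl \<in> Hom Th T3 T2" "Nr \<in> Hom Th U3 U2"
    and T: "is_theory T1" "is_theory U1" "is_theory T2" "is_theory U2" "is_theory T3" "is_theory U3"
    and D: "D \<in> balgs T1 U1"
    and E: "E \<in> balgs T2 U2" "E' \<in> balgs T3 U3"
  shows "balg_pull (vfun_cmp \<J> Ml Nl) (vfun_cmp \<J> Mr Nr) D = balg_pull Nl Nr (balg_pull Ml Mr D)"
proof -
  note D' = balgs_vfunctor[OF D] and cat = balgs_vcategory[OF E(1)] balgs_vcategory[OF E(2)]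
  have M': "vfunctor (tcat T2) (tcat T1) Ml" "vfunctor (tcat U2) (tcat U1) Mr"
    and N': "vfunctor (tcat T3) (tcat T2) Nl" "vfunctor (tcat U3) (tcat U2) Nr"
    using M N by (simp_all add: Hom_Th)
  note [simp] = morphism_fob[OF M(1) T(3,1)] morphism_fob[OF M(2) T(4,2)] morphism_fob[OF N(1) T(5,3)] morphism_fob[OF N(2) T(6,4)]
  have tensor: "vfun_tensor \<J> \<J> (vfun_cmp \<J> Ml Nl) (vfun_cmp \<J> Mr Nr) = vfun_cmp (\<J> \<times> \<J>) (vfun_tensor \<J> \<J> Ml Mr) (vfun_tensor \<J> \<J> Nl Nr)"
  proof (rule vfun_eqI[where S = "\<J> \<times> \<J>"])
    fix x y assume "x \<in> \<J> \<times> \<J>" "y \<in> \<J> \<times> \<J>"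
    then obtain X Y X' Y' where x: "x = (X, Y)" "y = (X', Y')" and [simp]: "X \<in> \<J>" "Y \<in> \<J>" "X' \<in> \<J>" "Y' \<in> \<J>" by auto
    let ?Ml = "tfh (tcat T2) (tcat T1) Ml X X'" and ?Mr = "tfh (tcat U2) (tcat U1) Mr Y Y'"
      and ?Nl = "tfh (tcat T3) (tcat T2) Nl X X'" and ?Nr = "tfh (tcat U3) (tcat U2) Nr Y Y'"
    have "arr ?Ml" "arr ?Mr" "arr ?Nl" "arr ?Nr"
      using vfunctor_arr[OF M'(1), of X X'] vfunctor_arr[OF M'(2), of Y Y']
        vfunctor_arr[OF N'(1), of X X'] vfunctor_arr[OF N'(2), of Y Y'] T by simp_all
    then have "tval ((?Ml \<odot> ?Nl) \<star> (?Mr \<odot> ?Nr)) = tval ((?Ml \<star> ?Mr) \<odot> (?Nl \<star> ?Nr))" by simp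
    then show "fhom (vfun_tensor \<J> \<J> (vfun_cmp \<J> Ml Nl) (vfun_cmp \<J> Mr Nr)) x y
        = fhom (vfun_cmp (\<J> \<times> \<J>) (vfun_tensor \<J> \<J> Ml Mr) (vfun_tensor \<J> \<J> Nl Nr)) x y"
      by (simp add: x vfun_tensor_def mk_vfun_simps vfun_cmp_simps tval_simps)
  qed (auto simp: vfun_tensor_def mk_vfun_simps vfun_cmp_simps)
  show ?thesis
    unfolding balg_pull_def tensor
    by (rule vfun_cmp_assoc[symmetric, OF tensor_functor[OF N T(3-6) cat]
          tensor_functor[OF M T(1-4) vfunctor_vcategory(1)[OF D'] cat(1)] D'])
      (use T in simp_all)
qed

lemma balg_pull_ar_in:
  assumes M: "Ml \<in> Hom Th T2 T1" "Mr \<in> Hom Th U2 U1"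
    and T: "is_theory T1" "is_theory U1" "is_theory T2" "is_theory U2"
    and D: "D \<in> balgs T1 U1" "D' \<in> balgs T1 U1"
    and E: "E \<in> balgs T2 U2"
    and t: "t \<in> vnat_V (vtensor (tcat T1) (tcat U1)) D D'"
  shows "balg_pull_ar Ml Mr t \<in> vnat_V (vtensor (tcat T2) (tcat U2)) (balg_pull Ml Mr D) (balg_pull Ml Mr D')"
proof -
  have "(\<lambda>X\<in>\<J> \<times> \<J>. t (fob (vfun_tensor \<J> \<J> Ml Mr) X)) = balg_pull_ar Ml Mr t"
    by (auto simp: balg_pull_ar_def vfun_tensor_simps fun_eq_iff)
  then show ?thesis
    using vnat_V_vfun_cmp[OF tensor_functor[OF M T balgs_vcategory[OF D(1)] balgs_vcategory[OF E]]
        balgs_vfunctor[OF D(1)] balgs_vfunctor[OF D(2)] t] T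
    by (simp add: balg_pull_def)
qed

lemma balg_pull_laws:
  assumes M: "Ml \<in> Hom Th T2 T1" "Mr \<in> Hom Th U2 U1" and T: "is_theory T1" "is_theory U1" "is_theory T2" "is_theory U2"
  shows "balg_pull_ar Ml Mr (\<lambda>X\<in>\<J> \<times> \<J>. \<iota> (fob D X)) = (\<lambda>X\<in>\<J> \<times> \<J>. \<iota> (fob (balg_pull Ml Mr D) X))"
    and "balg_pull_ar Ml Mr (\<lambda>X\<in>\<J> \<times> \<J>. s X \<cdot> t X) = (\<lambda>X\<in>\<J> \<times> \<J>. balg_pull_ar Ml Mr s X \<cdot> balg_pull_ar Ml Mr t X)"
    and "\<lbrakk>Nl \<in> Hom Th T3 T2; Nr \<in> Hom Th U3 U2; is_theory T3; is_theory U3\<rbrakk> \<Longrightarrow>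
      balg_pull_ar (vfun_cmp \<J> Ml Nl) (vfun_cmp \<J> Mr Nr) t = balg_pull_ar Nl Nr (balg_pull_ar Ml Mr t)"
  using T by (auto simp: balg_pull_ar_def balg_pull_def vfun_cmp_simps vfun_tensor_simps morphism_fob[OF M(1) T(3,1)]
      morphism_fob[OF M(2) T(4,2)] morphism_fob[where T = T3 and U = T2] morphism_fob[where T = U3 and U = U2])

lemma balg_pull_ar_id:
  assumes "is_theory T" "is_theory U" "t \<in> vnat_V (vtensor (tcat T) (tcat U)) D D'"
  shows "balg_pull_ar (vfun_id (tcat T)) (vfun_id (tcat U)) t = t"
  using vnat_V_ext[OF assms(3)] assms(1,2)
  by (auto simp: balg_pull_ar_def vfun_id_simps intro!: extensionalityI[where A = "\<J> \<times> \<J>"])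

text \<open>The counterpart of \<open>Alg0\<close>: the fibre of \<open>BAlg\<close> over a pair of
  theories.\<close>

definition BAlg0 where
  "BAlg0 = (\<lambda>(T, U). \<lparr>Ob = balgs T U, Hom = balg_hom T U, ident = (\<lambda>D. \<lambda>X\<in>\<J> \<times> \<J>. \<iota> (fob D X)),
    cmp = (\<lambda>s t. \<lambda>X\<in>\<J> \<times> \<J>. s X \<cdot> t X)\<rparr>)"

lemma category_BAlg0:
  assumes "b \<in> Ob (prod_cat Th Th)"
  shows "category (BAlg0 b)"
proof -
  have "balg_hom T U = vnat_V (vtensor (tcat T) (tcat U))" for T U
    by (simp add: balg_hom_def fun_eq_iff)
  then show ?thesis
    using category_vnat[of "balgs (fst b) (snd b)" "vtensor (tcat (fst b)) (tcat (snd b))"] assms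
    by (auto simp: BAlg0_def prod_cat_def balgs_vfunctor)
qed

lemma category_BAlg: "category BAlg"
proof (rule category_total[OF category_prod[OF category_Th category_Th] category_BAlg0,
      where po = "\<lambda>(Ml, Mr). balg_pull Ml Mr" and pa = "\<lambda>(Ml, Mr). balg_pull_ar Ml Mr"
        and bs = "\<lambda>(T, U, D). (T, U)" and fb = "\<lambda>(T, U, D). D" and fc = "\<lambda>s t. \<lambda>X\<in>\<J> \<times> \<J>. s X \<cdot> t X"])
qed (auto simp: BAlg_def BAlg0_def prod_cat_def balg_hom_def
      intro: balg_pull_in(1) balg_pull_ar_in balg_pull_laws balg_pull_id balg_pull_ar_id balg_pull_pull)

lemma category_AlgStar_BAlg: "category AlgStar_BAlg"
  unfolding AlgStar_BAlg_def
proof (rule category_pullback[OF category_AlgStar category_BAlg])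
  fix X Y assume "onOb P_fctr X = onOb L_fctr Y"
  then show "onAr P_fctr X X (\<iota>\<^bsub>AlgStar\<^esub> X) = onAr L_fctr Y Y (\<iota>\<^bsub>BAlg\<^esub> Y)"
    by (cases X; cases Y) (simp add: P_fctr_def L_fctr_def AlgStar_simps BAlg_simps)
next
  fix X X' X'' Y Y' Y'' f f' g g'
  assume "onAr P_fctr X X' f = onAr L_fctr Y Y' g" "onAr P_fctr X' X'' f' = onAr L_fctr Y' Y'' g'"
  then show "onAr P_fctr X X'' (f' \<cdot>\<^bsub>AlgStar\<^esub> f) = onAr L_fctr Y Y'' (g' \<cdot>\<^bsub>BAlg\<^esub> g)"
    by (cases f; cases f'; cases g; cases g'; cases "fst g"; cases "fst g'")
      (simp add: P_fctr_def L_fctr_def AlgStar_simps BAlg_simps)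
qed

section \<open>The functor on the pullback category\<close>

text \<open>Objects of the pullback are the data of \<open>hom_algebra\<close> and arrows, by
  \<open>AlgStar_BAlg_Hom\<close>, those of \<open>hom_morphism\<close>. This carries the results of
  the two locales over to the category.\<close>

lemma AlgStar_BAlg_Ob:
  "((T, A), (T', U, D)) \<in> Ob AlgStar_BAlg \<longleftrightarrow> T' = T \<and> hom_algebra V \<J> T U D A"
  by (auto simp: AlgStar_BAlg_def pullback_cat_def P_fctr_def L_fctr_def AlgStar_simps BAlg_simps hom_algebra_def
      bifold_algebra_def bifold_algebra_axioms_def hom_algebra_axioms_def amenable_arity_system_axioms)

lemma AlgStar_BAlg_Hom:
  assumes "hom_algebra V \<J> T1 U1 D1 A1" "hom_algebra V \<J> T2 U2 D2 A2"
  shows "((Ml, f), ((Ml', Mr), g)) \<in> Hom AlgStar_BAlg ((T1, A1), (T1, U1, D1)) ((T2, A2), (T2, U2, D2))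
    \<longleftrightarrow> Ml' = Ml \<and> hom_morphism V \<J> T1 U1 D1 A1 T2 U2 D2 A2 Ml Mr f g"
  using assms by (auto simp: AlgStar_BAlg_def pullback_cat_def P_fctr_def L_fctr_def AlgStar_simps BAlg_simps
      hom_morphism_def hom_morphism_axioms_def balg_hom_def amenable_arity_system_axioms)

text \<open>The arrow part reads the algebras from domain and codomain, because \<open>psi\<close>
  depends on them and the arrow does not contain them.\<close>

definition Hom_fctr where
  "Hom_fctr = \<lparr>onOb = (\<lambda>((T, A), (T', U, D)). (U, HomAlg T U A D)),
    onAr = (\<lambda>((T1, A1), (T1', U1, D1)) ((T2, A2), (T2', U2, D2)) ((Ml, f), ((Ml', Mr), g)).
      (Mr, hom_morphism.psi V \<J> T1 U1 D1 A1 T2 U2 D2 A2 Ml Mr f g))\<rparr>"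

lemma Hom_functor: "cat_functor AlgStar_BAlg Alg Hom_fctr"
proof (intro cat_functor.intro cat_functor_axioms.intro category_AlgStar_BAlg category_Alg)
  fix X assume "X \<in> Ob AlgStar_BAlg"
  then obtain T A U D where X: "X = ((T, A), (T, U, D))" and h: "hom_algebra V \<J> T U D A"
    by (cases X) (auto simp: AlgStar_BAlg_Ob)
  interpret hom_algebra V \<J> T U D A by (rule h)
  show "onOb Hom_fctr X \<in> Ob Alg"
    using HA_in by (simp add: X Hom_fctr_def Alg_simps)
  have "ident AlgStar_BAlg X = ((vfun_id (tcat T), \<lambda>K\<in>\<J>. \<iota> (fob A K)), ((vfun_id (tcat T), vfun_id (tcat U)), \<lambda>X\<in>\<J> \<times> \<J>. \<iota> (fob D X)))"
    by (simp add: X AlgStar_BAlg_def pullback_cat_def AlgStar_simps BAlg_simps)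
  \<comment> \<open>The locale is not verified by hand: identities are arrows of the pullback
    category, and its arrows satisfy the locale.\<close>
  moreover from this have "hom_morphism V \<J> T U D A T U D A (vfun_id (tcat T)) (vfun_id (tcat U))
      (\<lambda>K\<in>\<J>. \<iota> (fob A K)) (\<lambda>X\<in>\<J> \<times> \<J>. \<iota> (fob D X))"
    using category.ident_in[OF category_AlgStar_BAlg, of X] h by (simp add: X AlgStar_BAlg_Ob AlgStar_BAlg_Hom)
  ultimately show "onAr Hom_fctr X X (\<iota>\<^bsub>AlgStar_BAlg\<^esub> X) = \<iota>\<^bsub>Alg\<^esub> (onOb Hom_fctr X)"
    using psi_ident by (simp add: X Hom_fctr_def Alg_simps)
next
  fix X Y f assume "X \<in> Ob AlgStar_BAlg" "Y \<in> Ob AlgStar_BAlg" and f: "f \<in> Hom AlgStar_BAlg X Y"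
  then obtain T1 A1 U1 D1 T2 A2 U2 D2 Ml p Ml' Mr q where
    X: "X = ((T1, A1), (T1, U1, D1))" "Y = ((T2, A2), (T2, U2, D2))" "f = ((Ml, p), ((Ml', Mr), q))"
    and h: "hom_algebra V \<J> T1 U1 D1 A1" "hom_algebra V \<J> T2 U2 D2 A2"
    by (cases X; cases Y; cases f) (auto simp: AlgStar_BAlg_Ob)
  interpret hom_morphism V \<J> T1 U1 D1 A1 T2 U2 D2 A2 Ml Mr p q
    using f h by (simp add: X AlgStar_BAlg_Hom)
  show "onAr Hom_fctr X Y f \<in> Hom Alg (onOb Hom_fctr X) (onOb Hom_fctr Y)"
    using psi_in Mr by (simp add: X Hom_fctr_def Alg_simps)
next
  fix X Y Z f g assume XYZ: "X \<in> Ob AlgStar_BAlg" "Y \<in> Ob AlgStar_BAlg" "Z \<in> Ob AlgStar_BAlg"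
    and f: "f \<in> Hom AlgStar_BAlg X Y" and g: "g \<in> Hom AlgStar_BAlg Y Z"
  then obtain T1 A1 U1 D1 T2 A2 U2 D2 T3 A3 U3 D3 Ml p Ml' Mr q Nl p' Nl' Nr q' where
    X: "X = ((T1, A1), (T1, U1, D1))" "Y = ((T2, A2), (T2, U2, D2))" "Z = ((T3, A3), (T3, U3, D3))"
      "f = ((Ml, p), ((Ml', Mr), q))" "g = ((Nl, p'), ((Nl', Nr), q'))"
    and h: "hom_algebra V \<J> T1 U1 D1 A1" "hom_algebra V \<J> T2 U2 D2 A2" "hom_algebra V \<J> T3 U3 D3 A3"
    by (cases X; cases Y; cases Z; cases f; cases g) (auto simp: AlgStar_BAlg_Ob)
  have a: "hom_morphism V \<J> T1 U1 D1 A1 T2 U2 D2 A2 Ml Mr p q" and [simp]: "Ml' = Ml"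
    using f h by (simp_all add: X AlgStar_BAlg_Hom)
  have b: "hom_morphism V \<J> T2 U2 D2 A2 T3 U3 D3 A3 Nl Nr p' q'" and [simp]: "Nl' = Nl"
    using g h by (simp_all add: X AlgStar_BAlg_Hom)
  let ?p = "\<lambda>K\<in>\<J>. alg_pull_ar Nl p K \<cdot> p' K" and ?q = "\<lambda>X\<in>\<J> \<times> \<J>. q' X \<cdot> balg_pull_ar Nl Nr q X"
  have gf: "g \<cdot>\<^bsub>AlgStar_BAlg\<^esub> f = ((vfun_cmp \<J> Ml Nl, ?p), ((vfun_cmp \<J> Ml Nl, vfun_cmp \<J> Mr Nr), ?q))"
    by (simp add: X AlgStar_BAlg_def pullback_cat_def AlgStar_simps BAlg_simps)
  \<comment> \<open>As for identities, closure of the pullback category under composition delivers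
    the locale.\<close>
  have c: "hom_morphism V \<J> T1 U1 D1 A1 T3 U3 D3 A3 (vfun_cmp \<J> Ml Nl) (vfun_cmp \<J> Mr Nr) ?p ?q"
    using category.cmp_in[OF category_AlgStar_BAlg XYZ f g] h unfolding gf by (simp add: X AlgStar_BAlg_Hom)
  interpret a: hom_morphism V \<J> T1 U1 D1 A1 T2 U2 D2 A2 Ml Mr p q by (rule a)
  interpret b: hom_morphism V \<J> T2 U2 D2 A2 T3 U3 D3 A3 Nl Nr p' q' by (rule b)
  interpret c: hom_morphism V \<J> T1 U1 D1 A1 T3 U3 D3 A3 "vfun_cmp \<J> Ml Nl" "vfun_cmp \<J> Mr Nr" ?p ?q by (rule c)
  have "c.psi = (\<lambda>K\<in>\<J>. b.psi K \<cdot> alg_pull_ar Nr a.psi K)"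
  proof (rule extensionalityI[OF c.psi_extensional])
    fix K assume K [simp]: "K \<in> \<J>"
    \<comment> \<open>\<open>Nl\<close> and \<open>Nr\<close> fix objects, so the pulled-back
      transformations have the same components as \<open>p\<close> and \<open>q\<close>, as
      \<open>psi_cmp\<close> requires.\<close>
    have "c.psi K = b.psi K \<cdot> a.psi K"
      by (rule psi_cmp[OF a b c _ _ K]) (simp_all add: alg_pull_ar_def balg_pull_ar_def)
    then show "c.psi K = (\<lambda>K\<in>\<J>. b.psi K \<cdot> alg_pull_ar Nr a.psi K) K"
      by (simp add: alg_pull_ar_def)
  qed simp
  then show "onAr Hom_fctr X Z (g \<cdot>\<^bsub>AlgStar_BAlg\<^esub> f) = onAr Hom_fctr Y Z g \<cdot>\<^bsub>Alg\<^esub> onAr Hom_fctr X Y f"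
    unfolding gf by (simp add: X Hom_fctr_def Alg_simps)
qed

end

text \<open>Composition in \<open>Alg0 U2\<close> is total on raw functions; the two membership
  claims are what make the displayed expression a composite of homomorphisms.\<close>

theorem theorem6p13:
  fixes V :: "('o, 'm) smc" and \<J> :: "'o set"
  assumes "amenable_arity_system V \<J>"
  shows "\<exists>H. cat_functor (arity_system.AlgStar_BAlg V \<J>) (arity_system.Alg V \<J>) H \<and>
    (\<forall>T U A D. ((T, A), (T, U, D)) \<in> Ob (arity_system.AlgStar_BAlg V \<J>) \<longrightarrow>
      onOb H ((T, A), (T, U, D)) = (U, arity_system.HomAlg V \<J> T U A D)) \<and>
    (\<forall>T1 U1 A1 D1 T2 U2 A2 D2 Ml Mr f g.
      ((T1, A1), (T1, U1, D1)) \<in> Ob (arity_system.AlgStar_BAlg V \<J>) \<and>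
      ((T2, A2), (T2, U2, D2)) \<in> Ob (arity_system.AlgStar_BAlg V \<J>) \<and>
      ((Ml, f), ((Ml, Mr), g)) \<in> Hom (arity_system.AlgStar_BAlg V \<J>)
        ((T1, A1), (T1, U1, D1)) ((T2, A2), (T2, U2, D2)) \<longrightarrow>
      arity_system.hom_comparison V \<J> T1 U1 T2 Ml Mr A1 D1
        \<in> Hom (arity_system.Alg0 V \<J> U2)
            (arity_system.alg_pull V \<J> Mr (arity_system.HomAlg V \<J> T1 U1 A1 D1))
            (arity_system.HomAlg V \<J> T2 U2 (arity_system.alg_pull V \<J> Ml A1)
              (arity_system.balg_pull V \<J> Ml Mr D1)) \<and>
      arity_system.HomAlg_ar V \<J> T2 U2 (arity_system.alg_pull V \<J> Ml A1) (arity_system.balg_pull V \<J> Ml Mr D1)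
          A2 D2 f g
        \<in> Hom (arity_system.Alg0 V \<J> U2)
            (arity_system.HomAlg V \<J> T2 U2 (arity_system.alg_pull V \<J> Ml A1)
              (arity_system.balg_pull V \<J> Ml Mr D1))
            (arity_system.HomAlg V \<J> T2 U2 A2 D2) \<and>
      onAr H ((T1, A1), (T1, U1, D1)) ((T2, A2), (T2, U2, D2)) ((Ml, f), ((Ml, Mr), g))
        = (Mr, cmp (arity_system.Alg0 V \<J> U2)
            (arity_system.HomAlg_ar V \<J> T2 U2 (arity_system.alg_pull V \<J> Ml A1)
              (arity_system.balg_pull V \<J> Ml Mr D1) A2 D2 f g)
            (arity_system.hom_comparison V \<J> T1 U1 T2 Ml Mr A1 D1)))"
proof -
  interpret amenable_arity_system V \<J> by (rule assms)
  show ?thesis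
  proof (intro exI[of _ Hom_fctr] conjI allI impI Hom_functor)
    fix T U A D
    show "onOb Hom_fctr ((T, A), (T, U, D)) = (U, HomAlg T U A D)"
      by (simp add: Hom_fctr_def)
  next
    fix T1 U1 A1 D1 T2 U2 A2 D2 Ml Mr f g
    assume "((T1, A1), (T1, U1, D1)) \<in> Ob AlgStar_BAlg \<and> ((T2, A2), (T2, U2, D2)) \<in> Ob AlgStar_BAlg \<and>
      ((Ml, f), ((Ml, Mr), g)) \<in> Hom AlgStar_BAlg ((T1, A1), (T1, U1, D1)) ((T2, A2), (T2, U2, D2))"
    then interpret hom_morphism V \<J> T1 U1 D1 A1 T2 U2 D2 A2 Ml Mr f g
      by (auto simp: AlgStar_BAlg_Ob AlgStar_BAlg_Hom)
    show "hom_comparison T1 U1 T2 Ml Mr A1 D1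
        \<in> Hom (Alg0 U2) (alg_pull Mr (HomAlg T1 U1 A1 D1)) (HomAlg T2 U2 (alg_pull Ml A1) (balg_pull Ml Mr D1))"
      using hom_comparison_in by (simp add: Alg0_def)
    show "HomAlg_ar T2 U2 (alg_pull Ml A1) (balg_pull Ml Mr D1) A2 D2 f g
        \<in> Hom (Alg0 U2) (HomAlg T2 U2 (alg_pull Ml A1) (balg_pull Ml Mr D1)) (HomAlg T2 U2 A2 D2)"
      using ar.HomAlg_ar_in by (simp add: Alg0_def)
    show "onAr Hom_fctr ((T1, A1), (T1, U1, D1)) ((T2, A2), (T2, U2, D2)) ((Ml, f), ((Ml, Mr), g))
        = (Mr, cmp (Alg0 U2) (HomAlg_ar T2 U2 (alg_pull Ml A1) (balg_pull Ml Mr D1) A2 D2 f g)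
            (hom_comparison T1 U1 T2 Ml Mr A1 D1))"
      by (simp add: Hom_fctr_def psi_def)
  qed
qed

end
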